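(* Let $\Omega\subset\mathbb R^3$ be a bounded polyhedral domain and let $\mathcal T$ be a conforming tetrahedral triangulation of $\Omega$. Let $Z_3^{\mathrm{red}}(\mathcal T)$ be the space of all $z\in L^2(\Omega)$ such that $z|_T\in Z_3^{\mathrm{red}}(T)$ for all $T\in\mathcal T$ and such that the vertex values $z(v)$ and vertex gradients $\nabla z(v)$ are single-valued for all vertices $v$ of $\mathcal T$ (they agree when computed from any two tetrahedra of $\mathcal T$ sharing $v$). Then $$Z_3^{\mathrm{red}}(\mathcal T)\subset H^2(\Omega).$$
   Context: Let $T=[v_0,v_1,v_2,v_3]\subset\mathbb R^3$ be a (nondegenerate) tetrahedron with barycentric coordinates $\lambda_0,\dots,\lambda_3$. Set $I=\{0,1,2,3\}$, $J_i=I\setminus\{i\}$. Let $f_i=\{\lambda_i=0\}$ be the face opposite to $v_i$, $\nu_i$ its outer unit normal, and $d_{ji}=\nabla\lambda_j\cdot\nu_i$. For $\ell\neq m$ let $e_{\ell m}=[v_\ell,v_m]$. $\mathcal P_k$ denotes polynomials of total degree at most $k$. Polynomial Zienkiewicz space: $Z_3^0(T)=\mathcal P_2(T)\oplus\mathrm{span}\{\lambda_i^2\lambda_j-\lambda_j^2\lambda_i:0\le i<j\le3\}$. Singular edge bubbles: for $0\le\ell<m\le3$ and $n\in I\setminus\{\ell,m\}$, $$E_{\ell m}^n=\frac{\lambda_n\lambda_\ell^2\lambda_m^2}{(\lambda_n+\lambda_\ell)(\lambda_n+\lambda_m)}.$$ Edge-enriched space: $Z_3^e(T)=Z_3^0(T)+\mathrm{span}\{E_{\ell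 m}^n:0\le\ell<m\le3,\ n\in I\setminus\{\ell,m\}\}$. On the face $f_i$ put $\mu_j=\lambda_j|_{f_i}$ for $j\in J_i$. For an edge $e_{\ell m}\subset f_i$ ($\ell<m$) with $\{n\}=I\setminus\{i,\ell,m\}$ set $$\Phi_{\ell m,\ell}^{n,i}=\frac{\mu_n\mu_\ell\mu_m^2(2\mu_n+\mu_\ell)}{(\mu_n+\mu_\ell)^2(\mu_n+\mu_m)},\quad \Phi_{\ell m,m}^{n,i}=\frac{\mu_n\mu_\ell^2\mu_m(2\mu_n+\mu_m)}{(\mu_n+\mu_\ell)(\mu_n+\mu_m)^2},$$ $$\Phi_{\ell m,n}^{n,i}=\frac{\mu_\ell^2\mu_m^2(\mu_\ell\mu_m-\mu_n^2)}{(\mu_n+\mu_\ell)^2(\mu_n+\mu_m)^2}-\mu_\ell\mu_m,$$ and let $Q_{\mathrm{edge}}(f_i)$ be the span of these functions over all edges $e_{\ell m}\subset f_i$. For $q\in Q_{\mathrm{edge}}(f_i)$ the canonical barycentric extension $\widetilde q$ to $T$ is obtained by replacing $\mu_j$ by $\lambda_j$ for all $j\in J_i$ in these formulas (extended linearly). The normal lift is $$L_iq=\frac{\lambda_i}{d_{ii}}\Theta_i\,\widetilde q,\qquad \Theta_i=\prod_{j\in J_i}\frac{\lambda_j}{\lambda_i+\lambda_j}.$$ Every $z\in Z_3^e(T)$ has on each face a unique decomposition $\partial_{\nu_i}z|_{f_i}=p_i(z)+q_i(z)$ with $p_i(z)\in\mathcal P_2(f_i)$, $q_i(z)\in Q_{\mathrm{edge}}(f_i)$.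 Set $\mathcal R_Tz=z-\sum_{i=0}^3L_iq_i(z)$ and $Z_3^{\mathrm{sing}}(T)=\mathcal R_TZ_3^e(T)$. The reduced singular Zienkiewicz space is $$Z_3^{\mathrm{red}}(T)=\{z\in Z_3^{\mathrm{sing}}(T):\partial_{\nu_i}z|_{f_i}\in\mathcal P_1(f_i)\text{ for all }i=0,\dots,3\}.$$ Values and gradients at points of $\partial T$ are understood by continuous extension. *)

theory Defs
  imports "HOL-Analysis.Analysis" "HOL-Library.Function_Algebras"
begin

text \<open>Real-valued functions form a real vector space, so that the library's \<open>span\<close> applies.\<close>

instantiation "fun" :: (type, real_vector) real_vector
begin

definition scaleR_fun :: "real \<Rightarrow> ('a \<Rightarrow> 'b) \<Rightarrow> 'a \<Rightarrow> 'b"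
  where "scaleR_fun c f = (\<lambda>x. c *\<^sub>R f x)"

instance
  by standard (simp_all add: scaleR_fun_def fun_eq_iff scaleR_add_right scaleR_add_left)

end


section \<open>Sobolev spaces\<close>

definition partial :: "'n::finite \<Rightarrow> (real^'n \<Rightarrow> real) \<Rightarrow> real^'n \<Rightarrow> real"
  where "partial i f x = frechet_derivative f (at x) (axis i 1)"

definition grad :: "(real^'n::finite \<Rightarrow> real) \<Rightarrow> real^'n \<Rightarrow> real^'n"
  where "grad f x = (\<chi> i. partial i f x)"

text \<open>A multi-index is given as the list of its directions of differentiation.\<close>

definition partials :: "'n::finite list \<Rightarrow> (real^'n \<Rightarrow> real) \<Rightarrow> real^'n \<Rightarrow> real"
  where "partials \<alpha> f = foldr partial \<alpha> f"

text \<open>If all iterated partial derivatives are differentiable, they are all continuous; hence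
  this is \<open>C\<^sup>\<infinity>\<close> on the whole space.\<close>

definition smooth :: "(real^'n::finite \<Rightarrow> real) \<Rightarrow> bool"
  where "smooth f \<longleftrightarrow> (\<forall>\<alpha> x. partials \<alpha> f differentiable (at x))"

definition test_functions :: "(real^'n::finite) set \<Rightarrow> (real^'n \<Rightarrow> real) set"
  where "test_functions \<Omega> =
    {\<phi>. smooth \<phi> \<and> compact (closure {x. \<phi> x \<noteq> 0}) \<and> closure {x. \<phi> x \<noteq> 0} \<subseteq> \<Omega>}"

text \<open>Elements of \<open>L\<^sup>2(\<Omega>)\<close> are represented by functions on the whole space whose values outside
  \<open>\<Omega>\<close> are irrelevant.\<close>

definition L2_space :: "(real^'n::finite) set \<Rightarrow> (real^'n \<Rightarrow> real) set"
  where "L2_space \<Omega> = {f. f \<in> borel_measurable (lebesgue_on \<Omega>) \<and>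
    integrable (lebesgue_on \<Omega>) (\<lambda>x. (f x)\<^sup>2)}"

definition weak_partials ::
    "(real^'n::finite) set \<Rightarrow> 'n list \<Rightarrow> (real^'n \<Rightarrow> real) \<Rightarrow> (real^'n \<Rightarrow> real) \<Rightarrow> bool"
  where "weak_partials \<Omega> \<alpha> f g \<longleftrightarrow> (\<forall>\<phi>\<in>test_functions \<Omega>.
    (\<integral>x. f x * partials \<alpha> \<phi> x \<partial>lebesgue_on \<Omega>) =
      (-1) ^ length \<alpha> * (\<integral>x. g x * \<phi> x \<partial>lebesgue_on \<Omega>))"

definition sobolev_H :: "nat \<Rightarrow> (real^'n::finite) set \<Rightarrow> (real^'n \<Rightarrow> real) set"
  where "sobolev_H k \<Omega> = {f \<in> L2_space \<Omega>.
    \<forall>\<alpha>. length \<alpha> \<le> k \<longrightarrow> (\<exists>g\<in>L2_space \<Omega>. weak_partials \<Omega> \<alpha> f g)}"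


section \<open>Tetrahedra\<close>

definition nondegenerate :: "(nat \<Rightarrow> real^3) \<Rightarrow> bool"
  where "nondegenerate v \<longleftrightarrow> inj_on v {0..3} \<and> \<not> affine_dependent (v ` {0..3})"

definition tet :: "(nat \<Rightarrow> real^3) \<Rightarrow> (real^3) set"
  where "tet v = convex hull (v ` {0..3})"

definition barys :: "(nat \<Rightarrow> real^3) \<Rightarrow> real^3 \<Rightarrow> nat \<Rightarrow> real"
  where "barys v x = (THE u. (\<forall>j. j \<notin> {0..3} \<longrightarrow> u j = 0) \<and>
    (\<Sum>j=0..3. u j) = 1 \<and> (\<Sum>j=0..3. u j *\<^sub>R v j) = x)"

definition bary :: "(nat \<Rightarrow> real^3) \<Rightarrow> nat \<Rightarrow> real^3 \<Rightarrow> real"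
  where "bary v j x = barys v x j"

definition J :: "nat \<Rightarrow> nat set"
  where "J i = {0..3} - {i}"

definition face :: "(nat \<Rightarrow> real^3) \<Rightarrow> nat \<Rightarrow> (real^3) set"
  where "face v i = {x \<in> tet v. bary v i x = 0}"

definition outer_normal :: "(nat \<Rightarrow> real^3) \<Rightarrow> nat \<Rightarrow> real^3"
  where "outer_normal v i = (THE \<nu>. norm \<nu> = 1 \<and>
    (\<forall>x\<in>face v i. \<forall>y\<in>face v i. \<nu> \<bullet> (x - y) = 0) \<and>
    (\<forall>x\<in>tet v. \<forall>y\<in>face v i. \<nu> \<bullet> (x - y) \<le> 0))"

text \<open>The function \<open>\<nabla>\<lambda>\<^sub>j\<close> is constant; it is evaluated at the vertex \<open>v\<^sub>0\<close>.\<close>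

definition dcoef :: "(nat \<Rightarrow> real^3) \<Rightarrow> nat \<Rightarrow> nat \<Rightarrow> real"
  where "dcoef v j i = grad (bary v j) (v 0) \<bullet> outer_normal v i"

text \<open>The continuous extension to \<open>T\<close> of a function given in the interior of \<open>T\<close>;
  unspecified at points where the limit does not exist.\<close>

definition cont_ext :: "(real^3) set \<Rightarrow> (real^3 \<Rightarrow> 'b::t2_space) \<Rightarrow> real^3 \<Rightarrow> 'b"
  where "cont_ext T g x = Lim (at x within interior T) g"

definition normal_deriv :: "(nat \<Rightarrow> real^3) \<Rightarrow> nat \<Rightarrow> (real^3 \<Rightarrow> real) \<Rightarrow> real^3 \<Rightarrow> real"
  where "normal_deriv v i z = cont_ext (tet v) (\<lambda>x. grad z x \<bullet> outer_normal v i)"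

definition polys :: "nat \<Rightarrow> (real^3 \<Rightarrow> real) set"
  where "polys k = span {\<lambda>x. \<Prod>i\<in>UNIV. x $ i ^ a i | a. (\<Sum>i\<in>UNIV. a i) \<le> k}"


section \<open>Singular Zienkiewicz spaces on a tetrahedron\<close>

text \<open>The functions below are total, but only their values on \<open>T\<close> matter. All denominators are
  positive in the interior of \<open>T\<close>. Where a denominator vanishes on the boundary of \<open>T\<close>, the
  functions \<open>E\<close>, \<open>\<Phi>\<close> and \<open>L\<close> tend to \<open>0\<close> up to the polynomial summand of the third \<open>\<Phi>\<close>, which is
  what the convention \<open>x / 0 = 0\<close> returns, so these total functions are their own continuous
  extensions to \<open>T\<close>.\<close>

definition Z0 :: "(nat \<Rightarrow> real^3) \<Rightarrow> (real^3 \<Rightarrow> real) set"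
  where "Z0 v = {p + c | p c. p \<in> polys 2 \<and>
    c \<in> span {\<lambda>x. (bary v i x)\<^sup>2 * bary v j x - (bary v j x)\<^sup>2 * bary v i x | i j. i < j \<and> j \<le> 3}}"

definition edge_bubble :: "(nat \<Rightarrow> real^3) \<Rightarrow> nat \<Rightarrow> nat \<Rightarrow> nat \<Rightarrow> real^3 \<Rightarrow> real"
  where "edge_bubble v l m n x =
    bary v n x * (bary v l x)\<^sup>2 * (bary v m x)\<^sup>2 /
      ((bary v n x + bary v l x) * (bary v n x + bary v m x))"

definition Ze :: "(nat \<Rightarrow> real^3) \<Rightarrow> (real^3 \<Rightarrow> real) set"
  where "Ze v = {z + e | z e. z \<in> Z0 v \<and>
    e \<in> span {edge_bubble v l m n | l m n. l < m \<and> m \<le> 3 \<and> n \<in> {0..3} - {l, m}}}"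

definition Phi_l :: "(nat \<Rightarrow> real^3) \<Rightarrow> nat \<Rightarrow> nat \<Rightarrow> nat \<Rightarrow> real^3 \<Rightarrow> real"
  where "Phi_l v l m n x = (let \<mu>l = bary v l x; \<mu>m = bary v m x; \<mu>n = bary v n x in
    \<mu>n * \<mu>l * \<mu>m\<^sup>2 * (2 * \<mu>n + \<mu>l) / ((\<mu>n + \<mu>l)\<^sup>2 * (\<mu>n + \<mu>m)))"

definition Phi_m :: "(nat \<Rightarrow> real^3) \<Rightarrow> nat \<Rightarrow> nat \<Rightarrow> nat \<Rightarrow> real^3 \<Rightarrow> real"
  where "Phi_m v l m n x = (let \<mu>l = bary v l x; \<mu>m = bary v m x; \<mu>n = bary v n x in
    \<mu>n * \<mu>l\<^sup>2 * \<mu>m * (2 * \<mu>n + \<mu>m) / ((\<mu>n + \<mu>l) * (\<mu>n + \<mu>m)\<^sup>2))"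

definition Phi_n :: "(nat \<Rightarrow> real^3) \<Rightarrow> nat \<Rightarrow> nat \<Rightarrow> nat \<Rightarrow> real^3 \<Rightarrow> real"
  where "Phi_n v l m n x = (let \<mu>l = bary v l x; \<mu>m = bary v m x; \<mu>n = bary v n x in
    \<mu>l\<^sup>2 * \<mu>m\<^sup>2 * (\<mu>l * \<mu>m - \<mu>n\<^sup>2) / ((\<mu>n + \<mu>l)\<^sup>2 * (\<mu>n + \<mu>m)\<^sup>2) - \<mu>l * \<mu>m)"

text \<open>The space \<open>Q_edge(f\<^sub>i)\<close> is represented by the canonical barycentric extensions of its members,
  i.e. by linear combinations of the same formulas in \<open>\<lambda>\<^sub>j\<close>, \<open>j \<in> J\<^sub>i\<close>; the members
  themselves are the restrictions to \<open>f\<^sub>i\<close>. All these formulas are homogeneous of degree 2 in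
  \<open>(\<lambda>\<^sub>j)\<close>, \<open>j \<in> J\<^sub>i\<close>, so a combination is determined on \<open>T\<close> by its restriction to \<open>f\<^sub>i\<close>.\<close>

definition Q_edge :: "(nat \<Rightarrow> real^3) \<Rightarrow> nat \<Rightarrow> (real^3 \<Rightarrow> real) set"
  where "Q_edge v i = span (\<Union>{{Phi_l v l m n, Phi_m v l m n, Phi_n v l m n} | l m n.
    l \<in> J i \<and> m \<in> J i \<and> l < m \<and> n \<in> J i - {l, m}})"

text \<open>The singular part \<open>q\<^sub>i(z)\<close> in \<open>\<partial>\<^bsub>\<nu>\<^sub>i\<^esub>z = p\<^sub>i(z) + q\<^sub>i(z)\<close> on \<open>f\<^sub>i\<close>, already extended to \<open>T\<close>. It is
  unique as a function on \<open>T\<close> for \<open>z\<close> in \<open>Ze v\<close>.\<close>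

definition q_part :: "(nat \<Rightarrow> real^3) \<Rightarrow> nat \<Rightarrow> (real^3 \<Rightarrow> real) \<Rightarrow> real^3 \<Rightarrow> real"
  where "q_part v i z = (SOME q. q \<in> Q_edge v i \<and>
    (\<exists>p\<in>polys 2. \<forall>x\<in>face v i. normal_deriv v i z x = p x + q x))"

definition Theta :: "(nat \<Rightarrow> real^3) \<Rightarrow> nat \<Rightarrow> real^3 \<Rightarrow> real"
  where "Theta v i x = (\<Prod>j\<in>J i. bary v j x / (bary v i x + bary v j x))"

definition normal_lift :: "(nat \<Rightarrow> real^3) \<Rightarrow> nat \<Rightarrow> (real^3 \<Rightarrow> real) \<Rightarrow> real^3 \<Rightarrow> real"
  where "normal_lift v i q x = bary v i x / dcoef v i i * Theta v i x * q x"

definition R_op :: "(nat \<Rightarrow> real^3) \<Rightarrow> (real^3 \<Rightarrow> real) \<Rightarrow> real^3 \<Rightarrow> real"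
  where "R_op v z x = z x - (\<Sum>i=0..3. normal_lift v i (q_part v i z) x)"

definition Z_sing :: "(nat \<Rightarrow> real^3) \<Rightarrow> (real^3 \<Rightarrow> real) set"
  where "Z_sing v = R_op v ` Ze v"

definition Z_red :: "(nat \<Rightarrow> real^3) \<Rightarrow> (real^3 \<Rightarrow> real) set"
  where "Z_red v = {z \<in> Z_sing v. \<forall>i\<in>{0..3}. \<exists>p\<in>polys 1. \<forall>x\<in>face v i. normal_deriv v i z x = p x}"


section \<open>The space on a triangulation\<close>

definition bounded_polyhedral_domain :: "(real^3) set \<Rightarrow> bool"
  where "bounded_polyhedral_domain \<Omega> \<longleftrightarrow> open \<Omega> \<and> connected \<Omega> \<and> \<Omega> \<noteq> {} \<and> bounded \<Omega> \<and>
    (\<exists>F. finite F \<and> (\<forall>P\<in>F. polytope P \<and> aff_dim P = 2) \<and> frontier \<Omega> = \<Union>F)"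

definition tetrahedral_triangulation :: "(real^3) set set \<Rightarrow> (real^3) set \<Rightarrow> bool"
  where "tetrahedral_triangulation \<T> \<Omega> \<longleftrightarrow>
    triangulation \<T> \<and> (\<forall>T\<in>\<T>. 3 simplex T) \<and> \<Union>\<T> = closure \<Omega>"

text \<open>The reduced space does not depend on the numbering of the vertices of \<open>T\<close>, so it is stated for
  \<open>T\<close> as a point set, with an arbitrary numbering.\<close>

definition Z_red_on :: "(real^3) set \<Rightarrow> (real^3 \<Rightarrow> real) set"
  where "Z_red_on T = \<Union>{Z_red v | v. nondegenerate v \<and> tet v = T}"

text \<open>An element of \<open>L\<^sup>2(\<Omega>)\<close> is only defined almost everywhere; \<open>w T\<close> is the representative of its
  restriction to \<open>T\<close> in the local space, whose (extended) values and gradients at the vertices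
  are to be single-valued.\<close>

definition Z_red_mesh :: "(real^3) set \<Rightarrow> (real^3) set set \<Rightarrow> (real^3 \<Rightarrow> real) set"
  where "Z_red_mesh \<Omega> \<T> = {z \<in> L2_space \<Omega>. \<exists>w.
    (\<forall>T\<in>\<T>. w T \<in> Z_red_on T \<and> (AE x in lebesgue_on (T \<inter> \<Omega>). z x = w T x)) \<and>
    (\<forall>T\<in>\<T>. \<forall>T'\<in>\<T>. \<forall>a. a extreme_point_of T \<and> a extreme_point_of T' \<longrightarrow>
      cont_ext T (w T) a = cont_ext T' (w T') a \<and>
      cont_ext T (grad (w T)) a = cont_ext T' (grad (w T')) a)}"

end

theory Submission
  imports Defs
begin

text \<open>On a single tetrahedron every function of the reduced space is continuously differentiable up to the
boundary, with a Lipschitz gradient. If the functions on two tetrahedra and their gradients agree on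
the common face, then the glued function is continuously differentiable with a piecewise Lipschitz
gradient, and such a function has bounded weak second derivatives. So there are three things to prove.

\<^emph>\<open>Regularity on one tetrahedron.\<close> Up to linear combinations, all functions involved are quotients
of a monomial in the barycentric coordinates by a product of sums \<open>\<lambda>\<^sub>a + \<lambda>\<^sub>b\<close>. Such a quotient is
bounded on the tetrahedron if, for every set \<open>S\<close> of indices, there are at most as many denominator
factors with both indices in \<open>S\<close> as numerator factors with index in \<open>S\<close>
(\<open>prod_list_dominated\<close>). A derivative lowers the surplus of numerator factors by at most one, so a
surplus of two makes the second derivatives bounded (\<open>bary_ratio_C11\<close>). The edge bubbles have this
surplus. The normal lifts have it because of the factor \<open>\<lambda>\<^sub>i \<Theta>\<^sub>i\<close>
  and because the functions \<open>\<Phi>\<close> vanish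
on the edges of the face.

\<^emph>\<open>Agreement on common faces.\<close> The normal lifts vanish on the boundary, so the traces are those of the
edge-enriched space (\<open>Ze_face_form\<close>), and in every direction normal to a face or an edge the
derivative is affine there (\<open>gradient_affine_faces\<close>). On an edge the trace is a cubic
polynomial and hence determined
  by its Hermite data; the same is then true of the whole gradient. The
gradient on the edges determines the coefficients of the three bubbles on a face, hence the trace on
the face, and then also the gradient (\<open>agree_on_common_face\<close>). The step from values to
gradients is \<open>gradients_agree\<close>: a jump of the gradient is orthogonal to the face, in that
direction both gradients are affine, and the jump is zero at the vertices.

\<^emph>\<open>Weak derivatives.\<close> Integration by parts needs no boundary integrals: the difference quotients of
a compactly supported Lipschitz function have integral zero, and dominated convergence applies
(\<open>piecewise_lipschitz_weak_partial\<close>). Using this for the function and for each component of its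
gradient gives the weak derivatives up to order two (\<open>piecewise_C11_sobolev\<close>).\<close>

section \<open>Weak derivatives of piecewise Lipschitz functions\<close>

lemma test_function_differentiable:
  assumes "\<phi> \<in> test_functions \<Omega>"
  shows "\<phi> differentiable (at x)"
proof -
  have "partials [] \<phi> differentiable (at x)"
    using assms unfolding test_functions_def smooth_def by blast
  then show ?thesis by (simp add: partials_def)
qed

lemma test_function_support:
  assumes "\<phi> \<in> test_functions \<Omega>"
  shows "compact (closure {x. \<phi> x \<noteq> 0})" "closure {x. \<phi> x \<noteq> 0} \<subseteq> \<Omega>"
    "x \<notin> closure {x. \<phi> x \<noteq> 0} \<Longrightarrow> \<phi> x = 0"
  using assms closure_subset[of "{x. \<phi> x \<noteq> 0}"] by (auto simp: test_functions_def)

lemma partial_zero_off_support: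
  fixes \<phi> :: "real^'n::finite \<Rightarrow> real"
  assumes "x \<notin> closure {x. \<phi> x \<noteq> 0}"
  shows "partial i \<phi> x = 0"
proof -
  have "((\<lambda>x. 0) has_derivative (\<lambda>h. 0)) (at x)" by simp
  then have "(\<phi> has_derivative (\<lambda>h. 0)) (at x)"
    by (rule has_derivative_transform_within_open[where s = "- closure {x. \<phi> x \<noteq> 0}"])
      (use assms closure_subset[of "{x. \<phi> x \<noteq> 0}"] in auto)
  from frechet_derivative_at[OF this] show ?thesis
    unfolding partial_def by metis
qed

lemma test_function_partial:
  assumes "\<phi> \<in> test_functions \<Omega>"
  shows "partial j \<phi> \<in> test_functions \<Omega>"
proof -
  have "{x. partial j \<phi> x \<noteq> 0} \<subseteq> closure {x. \<phi> x \<noteq> 0}"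
    using partial_zero_off_support by blast
  then have sub: "closure {x. partial j \<phi> x \<noteq> 0} \<subseteq> closure {x. \<phi> x \<noteq> 0}"
    by (simp add: closure_minimal)
  have "smooth (partial j \<phi>)"
    unfolding smooth_def
  proof (intro allI)
    fix \<alpha> x
    have "partials (\<alpha> @ [j]) \<phi> differentiable at x"
      using assms unfolding test_functions_def smooth_def by blast
    then show "partials \<alpha> (partial j \<phi>) differentiable at x"
      by (simp add: partials_def)
  qed
  moreover have "compact (closure {x. partial j \<phi> x \<noteq> 0})"
    using sub test_function_support(1)[OF assms]
    by (meson bounded_subset closed_closure compact_eq_bounded_closed)
  ultimately show ?thesis
    using sub test_function_support(2)[OF assms] unfolding test_functions_def by blast
qed

lemma test_function_continuous:
  assumes "\<phi> \<in> test_functions \<Omega>"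
  shows "continuous_on S \<phi>"
  using test_function_differentiable[OF assms]
  by (simp add: continuous_at_imp_continuous_on differentiable_imp_continuous_within)

lemma test_function_bounded:
  fixes \<phi> :: "real^'n::finite \<Rightarrow> real"
  assumes "\<phi> \<in> test_functions \<Omega>"
  shows "\<exists>B\<ge>0. \<forall>x. \<bar>\<phi> x\<bar> \<le> B"
proof -
  let ?K = "closure {x. \<phi> x \<noteq> 0}"
  have "bounded (\<phi> ` ?K)"
    using test_function_support(1)[OF assms] test_function_continuous[OF assms]
    by (simp add: compact_continuous_image compact_imp_bounded)
  then obtain B where B: "\<And>x. x \<in> ?K \<Longrightarrow> \<bar>\<phi> x\<bar> \<le> B" "0 < B"
    unfolding bounded_pos real_norm_def by blast
  have "\<bar>\<phi> x\<bar> \<le> B" for x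
  proof (cases "x \<in> ?K")
    case False
    then have "\<phi> x = 0" by (rule test_function_support(3)[OF assms])
    then show ?thesis using B(2) by linarith
  qed (rule B(1))
  then show ?thesis using B(2) by (intro exI[of _ B]) auto
qed

lemma partial_along_line:
  fixes f :: "real^'n::finite \<Rightarrow> real"
  assumes "f differentiable (at (x + t *\<^sub>R axis i 1))"
  shows "((\<lambda>s. f (x + s *\<^sub>R axis i 1)) has_real_derivative
           partial i f (x + t *\<^sub>R axis i 1)) (at t)"
proof -
  let ?f' = "frechet_derivative f (at (x + t *\<^sub>R axis i 1))"
  have f: "(f has_derivative ?f') (at (x + t *\<^sub>R axis i 1))"
    using assms frechet_derivative_works by blast
  have "((\<lambda>s. x + s *\<^sub>R axis i 1) has_derivative (\<lambda>s. s *\<^sub>R axis i 1)) (at t)"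
    by (auto intro!: derivative_eq_intros)
  then have "((\<lambda>s. f (x + s *\<^sub>R axis i 1)) has_derivative (\<lambda>s. ?f' (s *\<^sub>R axis i 1))) (at t)"
    using has_derivative_compose[of "\<lambda>s. x + s *\<^sub>R axis i 1" "\<lambda>s. s *\<^sub>R axis i 1" t UNIV f ?f'] f
      by blast
  moreover have "?f' (s *\<^sub>R axis i 1) = s * partial i f (x + t *\<^sub>R axis i 1)" for s
    using linear_scale[OF has_derivative_linear[OF f]] by (simp add: partial_def)
  ultimately show ?thesis
    by (simp add: has_field_derivative_def mult.commute[of _ "partial i f _"])
qed

text \<open>The pieces cut the segment into finitely many closed sets of parameters, on each of which
  the function is Lipschitz with the same constant.\<close>

lemma lipschitz_along_segment:
  fixes f :: "'a::real_normed_vector \<Rightarrow> real"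
  assumes "finite \<T>" "\<And>T. T \<in> \<T> \<Longrightarrow> closed T" "\<And>T. T \<in> \<T> \<Longrightarrow> L-lipschitz_on T f"
    and seg: "closed_segment x y \<subseteq> \<Union>\<T>"
  shows "\<bar>f y - f x\<bar> \<le> L * norm (y - x)"
proof -
  define p where "p t = x + t *\<^sub>R (y - x)" for t :: real
  define U where "U T = {0..1} \<inter> p -` T" for T
  have pseg: "p t \<in> closed_segment x y" if "t \<in> {0..1}" for t
    using that unfolding p_def closed_segment_def
    by (auto intro!: exI[of _ t] simp: algebra_simps)
  have "x \<in> \<Union>\<T>" using seg by auto
  then obtain T0 where "T0 \<in> \<T>" by blast
  then have L: "0 \<le> L" using assms(3) lipschitz_on_nonneg by blast
  have "(L * norm (y - x))-lipschitz_on {0..1} (\<lambda>t. f (p t))"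
  proof (rule lipschitz_on_closed_Union[where I = \<T> and U = U])
    show "(L * norm (y - x))-lipschitz_on (U T) (\<lambda>t. f (p t))" if "T \<in> \<T>" for T
    proof (rule lipschitz_onI)
      fix s t assume "s \<in> U T" "t \<in> U T"
      then have "dist (f (p s)) (f (p t)) \<le> L * dist (p s) (p t)"
        using assms(3)[OF that] by (auto simp: U_def lipschitz_on_def)
      also have "dist (p s) (p t) = norm (y - x) * dist s t"
        by (simp add: p_def dist_norm flip: scaleR_left_diff_distrib)
      finally show "dist (f (p s)) (f (p t)) \<le> L * norm (y - x) * dist s t" by simp
    qed (use L in simp)
    show "closed (U T)" if "T \<in> \<T>" for T
      unfolding U_def p_def
      by (intro closed_Int closed_vimage assms(2) that closed_atLeastAtMost continuous_intros)
    show "{0..1} \<subseteq> (\<Union>T\<in>\<T>. U T)"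
    proof
      fix t :: real assume t: "t \<in> {0..1}"
      then obtain T where "T \<in> \<T>" "p t \<in> T" using pseg seg by blast
      then show "t \<in> (\<Union>T\<in>\<T>. U T)" using t by (auto simp: U_def)
    qed
  qed (use assms(1) L in auto)
  then have "dist (f (p 1)) (f (p 0)) \<le> L * norm (y - x) * dist (1::real) 0"
    by (rule lipschitz_onD) auto
  then show ?thesis by (simp add: p_def dist_norm)
qed

lemma piecewise_lipschitz_continuous:
  fixes f :: "'a::real_normed_vector \<Rightarrow> real"
  assumes "open \<Omega>" "finite \<T>" "\<And>T. T \<in> \<T> \<Longrightarrow> closed T" "\<And>T. T \<in> \<T> \<Longrightarrow> L-lipschitz_on T f"
    and cover: "\<Omega> \<subseteq> \<Union>\<T>"
  shows "continuous_on \<Omega> f"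
proof (rule continuous_at_imp_continuous_on, intro ballI)
  fix x assume x: "x \<in> \<Omega>"
  then obtain T0 where T0: "T0 \<in> \<T>" using cover by blast
  obtain r where r: "0 < r" "ball x r \<subseteq> \<Omega>"
    using assms(1) open_contains_ball x by blast
  have "L-lipschitz_on (ball x r) f"
  proof (rule lipschitz_onI)
    fix a b assume "a \<in> ball x r" "b \<in> ball x r"
    then have "closed_segment b a \<subseteq> ball x r" by (intro closed_segment_subset convex_ball)
    then have "closed_segment b a \<subseteq> \<Union>\<T>" using r(2) cover by blast
    from lipschitz_along_segment[OF assms(2-4) this]
    show "dist (f a) (f b) \<le> L * dist a b" by (simp add: dist_norm)
  qed (rule lipschitz_on_nonneg[OF assms(4)[OF T0]])
  then have "continuous_on (ball x r) f" by (rule lipschitz_on_continuous_on)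
  then show "isCont f x" using r by (simp add: continuous_on_eq_continuous_at)
qed

lemma integral_translate:
  fixes F :: "real^'n::finite \<Rightarrow> real"
  assumes "F \<in> borel_measurable borel"
  shows "integral\<^sup>L lebesgue (\<lambda>x. F (x + c)) = integral\<^sup>L lebesgue F"
proof -
  have "integral\<^sup>L lebesgue F = integral\<^sup>L lborel F"
    using assms by (simp add: integral_completion)
  also have "\<dots> = integral\<^sup>L (distr lborel borel ((+) c)) F"
    by (simp add: lborel_distr_plus)
  also have "\<dots> = integral\<^sup>L lborel (\<lambda>x. F (c + x))"
    using assms by (intro integral_distr) auto
  also have "\<dots> = integral\<^sup>L lebesgue (\<lambda>x. F (c + x))"
    using assms by (subst integral_completion) auto
  finally show ?thesis by (simp add: add.commute)
qed

lemma L2_spaceI: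
  fixes f :: "real^'n::finite \<Rightarrow> real"
  assumes "\<Omega> \<in> lmeasurable" "f \<in> borel_measurable borel"
    and "negligible N" "\<And>x. x \<in> \<Omega> - N \<Longrightarrow> \<bar>f x\<bar> \<le> M"
  shows "f \<in> L2_space \<Omega>"
proof -
  interpret finite_measure "lebesgue_on \<Omega>"
    using assms(1) by (rule finite_measure_lebesgue_on)
  have meas: "f \<in> borel_measurable (lebesgue_on \<Omega>)"
    using assms(2) by (simp add: measurable_completion measurable_restrict_space1)
  have "AE x in lebesgue_on \<Omega>. x \<in> \<Omega> - N"
    using assms(1,3) by (auto simp: AE_restrict_space_iff negligible_iff_null_sets fmeasurableD
        intro: AE_mp[OF AE_not_in])
  then have "AE x in lebesgue_on \<Omega>. norm ((f x)\<^sup>2) \<le> M\<^sup>2"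
  proof eventually_elim
    case (elim x)
    then have "\<bar>f x\<bar>\<^sup>2 \<le> M\<^sup>2" using assms(4) by (intro power_mono) auto
    then show ?case by simp
  qed
  then have "integrable (lebesgue_on \<Omega>) (\<lambda>x. (f x)\<^sup>2)"
    by (rule integrable_const_bound) (use meas in measurable)
  with meas show ?thesis by (simp add: L2_space_def)
qed

text \<open>For the zero extension \<open>F\<close> of \<open>f * \<phi>\<close> all integrals of \<open>F (x + h e) - F x\<close> vanish, because
  Lebesgue measure is translation invariant. The difference quotients are bounded uniformly in \<open>h\<close>
  and converge almost everywhere to \<open>\<partial>f * \<phi> + f * \<partial>\<phi>\<close>, so this function has integral zero by
  dominated convergence.\<close>

lemma piecewise_lipschitz_weak_partial:
  fixes f :: "real^'n::finite \<Rightarrow> real"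
  assumes "open \<Omega>" "bounded \<Omega>"
    and "finite \<T>" "\<And>T. T \<in> \<T> \<Longrightarrow> closed T" "\<And>T. T \<in> \<T> \<Longrightarrow> L-lipschitz_on T f"
    and cover: "\<Omega> \<subseteq> \<Union>\<T>"
    and M: "\<And>x. x \<in> \<Omega> \<Longrightarrow> \<bar>f x\<bar> \<le> M"
    and N: "negligible N" "\<And>x. x \<in> \<Omega> - N \<Longrightarrow> f differentiable (at x)"
  obtains g where "g \<in> borel_measurable borel"
    "\<And>x. x \<in> \<Omega> - N \<Longrightarrow> g x = partial i f x"
    "g \<in> L2_space \<Omega>"
    "\<And>\<phi>. \<phi> \<in> test_functions \<Omega> \<Longrightarrow>
      (\<integral>x. f x * partial i \<phi> x \<partial>lebesgue_on \<Omega>) = - (\<integral>x. g x * \<phi> x \<partial>lebesgue_on \<Omega>)"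
proof (cases "\<Omega> = {}")
  case True
  then have "space (lebesgue_on \<Omega>) = {}" by (simp add: space_restrict_space)
  then show ?thesis
    using that[of "\<lambda>_. 0"] True by (simp add: L2_space_def Bochner_Integration.integral_empty)
next
  case False
  then obtain x0 T0 where x0: "x0 \<in> \<Omega>" and T0: "T0 \<in> \<T>" using cover by blast
  have L0: "0 \<le> L" using lipschitz_on_nonneg[OF assms(5)[OF T0]] .
  have M0: "0 \<le> M" using M[OF x0] by linarith
  have lm: "\<Omega> \<in> lmeasurable"
    using assms(1,2) by (simp add: lmeasurable_open)
  interpret fm: finite_measure "lebesgue_on \<Omega>"
    using lm by (rule finite_measure_lebesgue_on)
  define e :: "real^'n" where "e = axis i 1"
  have norme: "norm e = 1" by (simp add: e_def)
  have lip: "\<bar>f y - f x\<bar> \<le> L * norm (y - x)" if "closed_segment x y \<subseteq> \<Omega>" for x y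
    by (rule lipschitz_along_segment[OF assms(3-5)]) (use that cover in auto)
  have contf: "continuous_on \<Omega> f"
    by (rule piecewise_lipschitz_continuous[OF assms(1,3-6)])
  define f0 where "f0 x = (if x \<in> \<Omega> then f x else 0)" for x
  have f0m [measurable]: "f0 \<in> borel_measurable borel"
  proof -
    have "(\<lambda>x. indicator \<Omega> x *\<^sub>R f x) \<in> borel_measurable borel"
      using assms(1) contf by (intro borel_measurable_continuous_on_indicator) auto
    moreover have "(\<lambda>x. indicator \<Omega> x *\<^sub>R f x) = f0" by (auto simp: f0_def indicator_def)
    ultimately show ?thesis by simp
  qed
  define h where "h n = inverse (real (Suc n))" for n
  have h0: "0 < h n" "h n \<le> 1" for n by (auto simp: h_def field_simps)
  have hlim: "filterlim h (at 0) sequentially"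
  proof -
    have "h \<longlonglongrightarrow> 0" unfolding h_def by (rule LIMSEQ_inverse_real_of_nat)
    moreover have "h n \<noteq> 0" for n using h0(1)[of n] by simp
    ultimately show ?thesis by (simp add: filterlim_at)
  qed
  have quot: "(\<lambda>n. (u (x + h n *\<^sub>R e) - u x) / h n) \<longlonglongrightarrow> d"
    if "((\<lambda>s. u (x + s *\<^sub>R e)) has_real_derivative d) (at 0)" for u :: "real^'n \<Rightarrow> real" and x d
  proof -
    have "((\<lambda>s. (u (x + s *\<^sub>R e) - u x) / s) \<longlongrightarrow> d) (at 0)"
      using that by (simp add: has_field_derivative_iff)
    then show ?thesis using hlim by (rule filterlim_compose)
  qed
  define g where "g x = lim (\<lambda>n. (f0 (x + h n *\<^sub>R e) - f0 x) / h n)" for x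
  have gm [measurable]: "g \<in> borel_measurable borel" unfolding g_def by measurable
  have f0deriv: "((\<lambda>s. f0 (x + s *\<^sub>R e)) has_real_derivative partial i f x) (at 0)"
    if x: "x \<in> \<Omega> - N" for x
  proof -
    have "((\<lambda>s. f (x + s *\<^sub>R e)) has_real_derivative partial i f x) (at 0)"
      using partial_along_line[of f x 0 i] N(2)[OF x] by (simp add: e_def)
    then show ?thesis
    proof (rule DERIV_cong_ev[OF refl _ refl, THEN iffD1, rotated])
      have "open ((\<lambda>s. x + s *\<^sub>R e) -` \<Omega>)"
        by (intro open_vimage assms(1) continuous_intros)
      then have "\<forall>\<^sub>F s in nhds 0. s \<in> (\<lambda>s. x + s *\<^sub>R e) -` \<Omega>"
        by (rule eventually_nhds_in_open) (use x in simp)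
      then show "\<forall>\<^sub>F s in nhds 0. f (x + s *\<^sub>R e) = f0 (x + s *\<^sub>R e)"
        by eventually_elim (simp add: f0_def)
    qed
  qed
  have geq: "g x = partial i f x" if "x \<in> \<Omega> - N" for x
    unfolding g_def using quot[OF f0deriv[OF that]] by (rule limI)
  have gbound: "\<bar>g x\<bar> \<le> L" if x: "x \<in> \<Omega> - N" for x
  proof -
    obtain r where r: "0 < r" "ball x r \<subseteq> \<Omega>"
      using assms(1) open_contains_ball x by blast
    have lim: "(\<lambda>n. (f0 (x + h n *\<^sub>R e) - f0 x) / h n) \<longlonglongrightarrow> g x"
      using quot[OF f0deriv[OF x]] geq[OF x] by simp
    have "\<forall>\<^sub>F n in sequentially. h n < r"
      using LIMSEQ_inverse_real_of_nat r(1) unfolding h_def by (rule order_tendstoD)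
    then have "\<forall>\<^sub>F n in sequentially. \<bar>(f0 (x + h n *\<^sub>R e) - f0 x) / h n\<bar> \<le> L"
    proof eventually_elim
      case (elim n)
      have "x + h n *\<^sub>R e \<in> ball x r" "x \<in> ball x r"
        using elim h0(1)[of n] r(1) norme by (auto simp: dist_norm)
      then have sub: "closed_segment x (x + h n *\<^sub>R e) \<subseteq> ball x r"
        by (intro closed_segment_subset convex_ball)
      have "\<bar>f (x + h n *\<^sub>R e) - f x\<bar> \<le> L * h n"
        using lip[of x "x + h n *\<^sub>R e"] sub r(2) h0(1)[of n] norme by auto
      moreover have "x + h n *\<^sub>R e \<in> \<Omega>" using sub r(2) by auto
      ultimately show ?case using x h0(1)[of n] by (simp add: f0_def field_simps)
    qed
    then show ?thesis
      using tendsto_upperbound[OF tendsto_rabs[OF lim]] by simp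
  qed
  have gL2: "g \<in> L2_space \<Omega>" by (rule L2_spaceI[OF lm gm N(1) gbound])
  have main: "(\<integral>x. f x * partial i \<phi> x \<partial>lebesgue_on \<Omega>) = - (\<integral>x. g x * \<phi> x \<partial>lebesgue_on \<Omega>)"
    if \<phi>: "\<phi> \<in> test_functions \<Omega>" for \<phi>
  proof -
    have \<phi>': "partial i \<phi> \<in> test_functions \<Omega>" using \<phi> by (rule test_function_partial)
    note [measurable] = borel_measurable_continuous_onI[OF test_function_continuous[OF \<phi>]]
      borel_measurable_continuous_onI[OF test_function_continuous[OF \<phi>']]
    obtain B where B: "\<And>x. \<bar>\<phi> x\<bar> \<le> B" "0 \<le> B" 
      using test_function_bounded[OF \<phi>] by auto
    obtain B' where B': "\<And>x. \<bar>partial i \<phi> x\<bar> \<le> B'" "0 \<le> B'"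
      using test_function_bounded[OF \<phi>'] by auto
    let ?K = "closure {x. \<phi> x \<noteq> 0}"
    obtain \<delta> where \<delta>: "0 < \<delta>" "(\<Union>x\<in>?K. ball x \<delta>) \<subseteq> \<Omega>"
      using compact_subset_open_imp_ball_epsilon_subset[OF test_function_support(1)[OF \<phi>]
          assms(1) test_function_support(2)[OF \<phi>]] by blast
    obtain R where R: "\<And>x. x \<in> \<Omega> \<Longrightarrow> norm x \<le> R" using assms(2) by (auto simp: bounded_iff)
    define F where "F x = f0 x * \<phi> x" for x
    have Fm [measurable]: "F \<in> borel_measurable borel" unfolding F_def by measurable
    have F0: "F x = 0" if "x \<notin> ?K" for x
      using test_function_support(3)[OF \<phi> that] by (simp add: F_def)
    have f0b: "\<bar>f0 x\<bar> \<le> M" for x using M M0 by (simp add: f0_def)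
    have Fb: "\<bar>F x\<bar> \<le> M * B" for x
      unfolding F_def abs_mult using f0b[of x] B M0 by (intro mult_mono) auto
    define s where "s n x = (F (x + h n *\<^sub>R e) - F x) / h n" for n x
    define D where "D x = indicator \<Omega> x * (g x * \<phi> x) + f0 x * partial i \<phi> x" for x
    \<comment> \<open>The first two terms bound the quotients for steps shorter than
      \<open>\<delta>\<close>, which stay in \<open>\<Omega>\<close> near the support; the last
      one bounds all longer steps.\<close>
    define C where "C = L * B + M * B' + 2 * M * B / \<delta>"
    have C: "0 \<le> L * B + M * B'" "0 \<le> 2 * M * B / \<delta>"
      using L0 M0 B(2) B'(2) \<delta>(1) by auto
    have sb: "\<bar>s n x\<bar> \<le> C" for n x
    proof (cases "h n < \<delta> \<and> (x \<in> ?K \<or> x + h n *\<^sub>R e \<in> ?K)")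
      case True
      have "closed_segment x (x + h n *\<^sub>R e) \<subseteq> \<Omega>"
      proof -
        obtain y where y: "y \<in> ?K" "x \<in> ball y \<delta>" "x + h n *\<^sub>R e \<in> ball y \<delta>"
          using True \<delta>(1) h0(1)[of n] norme by (auto simp: dist_norm)
        then have "closed_segment x (x + h n *\<^sub>R e) \<subseteq> ball y \<delta>"
          by (intro closed_segment_subset convex_ball)
        then show ?thesis using \<delta>(2) y(1) by blast
      qed
      moreover from this have "x \<in> \<Omega>" "x + h n *\<^sub>R e \<in> \<Omega>" by auto
      ultimately have 1: "\<bar>f0 (x + h n *\<^sub>R e) - f0 x\<bar> \<le> L * h n"
        using lip[of x "x + h n *\<^sub>R e"] h0(1)[of n] norme by (simp add: f0_def)
      have "\<exists>z>0. z < h n \<and> \<phi> (x + h n *\<^sub>R e) - \<phi> (x + 0 *\<^sub>R e)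
          = (h n - 0) * partial i \<phi> (x + z *\<^sub>R e)"
        by (rule MVT2[OF h0(1)])
          (use partial_along_line[OF test_function_differentiable[OF \<phi>]] in \<open>simp add: e_def\<close>)
      then obtain z where "\<phi> (x + h n *\<^sub>R e) - \<phi> x = h n * partial i \<phi> (x + z *\<^sub>R e)" by auto
      then have 2: "\<bar>\<phi> (x + h n *\<^sub>R e) - \<phi> x\<bar> \<le> B' * h n"
        using B'(1)[of "x + z *\<^sub>R e"] h0(1)[of n] by (simp add: abs_mult)
      have "F (x + h n *\<^sub>R e) - F x = (f0 (x + h n *\<^sub>R e) - f0 x) * \<phi> (x + h n *\<^sub>R e)
          + f0 x * (\<phi> (x + h n *\<^sub>R e) - \<phi> x)"
        by (simp add: F_def algebra_simps)
      also have "\<bar>\<dots>\<bar> \<le> (L * h n) * B + M * (B' * h n)"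
        by (rule order_trans[OF abs_triangle_ineq], unfold abs_mult)
          (intro add_mono mult_mono 1 2 B f0b; use L0 M0 h0(1)[of n] in simp)
      finally have "\<bar>s n x\<bar> \<le> L * B + M * B'"
        using h0(1)[of n] by (simp add: s_def field_simps)
      then show ?thesis using C by (simp add: C_def)
    next
      case False
      show ?thesis
      proof (cases "h n < \<delta>")
        case True
        then have "s n x = 0" using False F0 by (simp add: s_def)
        then show ?thesis using C by (simp add: C_def)
      next
        case h: False
        have "\<bar>s n x\<bar> \<le> 2 * M * B / h n"
          using h0(1)[of n] Fb[of x] Fb[of "x + h n *\<^sub>R e"]
            by (auto simp: s_def intro!: divide_right_mono)
        also have "\<dots> \<le> 2 * M * B / \<delta>"
          using h \<delta>(1) M0 B(2) by (intro divide_left_mono) auto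
        finally show ?thesis using C by (simp add: C_def)
      qed
    qed
    have s0: "s n x = 0" if "x \<notin> cball 0 (R + 1)" for n x
    proof -
      have "x \<notin> \<Omega>" using R[of x] that by auto
      moreover have "x + h n *\<^sub>R e \<notin> \<Omega>"
      proof
        assume "x + h n *\<^sub>R e \<in> \<Omega>"
        then have "norm (x + h n *\<^sub>R e) \<le> R" by (rule R)
        moreover have "norm x \<le> norm (x + h n *\<^sub>R e) + norm (h n *\<^sub>R e)"
          using norm_triangle_ineq4[of "x + h n *\<^sub>R e" "h n *\<^sub>R e"] by simp
        ultimately show False using that h0[of n] norme by auto
      qed
      ultimately show ?thesis by (simp add: s_def F_def f0_def)
    qed
    have AEN: "AE x in lebesgue. x \<notin> N"
      using N(1) by (intro AE_not_in) (simp add: negligible_iff_null_sets)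
    have lim: "AE x in lebesgue. (\<lambda>n. s n x) \<longlonglongrightarrow> D x"
      using AEN
    proof eventually_elim
      case (elim x)
      have "((\<lambda>t. F (x + t *\<^sub>R e)) has_real_derivative D x) (at 0)"
      proof (cases "x \<in> \<Omega>")
        case True
        with elim have x: "x \<in> \<Omega> - N" by simp
        have "((\<lambda>t. \<phi> (x + t *\<^sub>R e)) has_real_derivative partial i \<phi> x) (at 0)"
          using partial_along_line[OF test_function_differentiable[OF \<phi>], where x = x and t = 0
            and i = i]
          by (simp add: e_def)
        from DERIV_mult[OF f0deriv[OF x] this] show ?thesis
          using True by (simp add: F_def D_def geq[OF x] mult.commute add.commute)
      next
        case False
        have "open ((\<lambda>s. x + s *\<^sub>R e) -` (- ?K))"
          by (intro open_vimage continuous_intros) auto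
        moreover have "x \<notin> ?K" using False test_function_support(2)[OF \<phi>] by auto
        ultimately have ev: "\<forall>\<^sub>F s in nhds 0. s \<in> (\<lambda>s. x + s *\<^sub>R e) -` (- ?K)"
          by (intro eventually_nhds_in_open) auto
        have "((\<lambda>t. 0) has_real_derivative 0) (at (0::real))" by simp
        then have "((\<lambda>t. F (x + t *\<^sub>R e)) has_real_derivative 0) (at 0)"
          by (rule DERIV_cong_ev[OF refl _ refl, THEN iffD1, rotated])
            (use ev in eventually_elim, simp add: F0)
        then show ?thesis using False by (simp add: D_def f0_def)
      qed
      then show ?case unfolding s_def by (rule quot)
    qed
    have Fint: "integrable lebesgue F"
    proof (rule integrableI_bounded_set[where A = "cball 0 R" and B = "M * B"])
      show "F \<in> borel_measurable lebesgue" by (simp add: measurable_completion)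
      show "emeasure lebesgue (cball 0 R :: (real^'n) set) < \<infinity>"
        using emeasure_lborel_cball_finite[of "0 :: real^'n" R] by simp
      show "AE x in lebesgue. x \<in> cball 0 R \<longrightarrow> norm (F x) \<le> M * B" using Fb by simp
      show "AE x in lebesgue. x \<notin> cball 0 R \<longrightarrow> F x = 0"
      proof (rule AE_I2, rule impI)
        fix x :: "real^'n" assume "x \<notin> cball 0 R"
        then have "x \<notin> \<Omega>" using R[of x] by auto
        then show "F x = 0" by (simp add: F_def f0_def)
      qed
    qed simp
    have Ftint: "integrable lebesgue (\<lambda>x. F (x + c))" for c
    proof -
      have "integrable lborel F" using Fint by (simp add: integrable_completion)
      then have "integrable (distr lborel borel ((+) c)) F" by (simp add: lborel_distr_plus)
      then have "integrable lborel (\<lambda>x. F (c + x))"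
        by (subst (asm) integrable_distr_eq) auto
      then show ?thesis by (subst integrable_completion) (auto simp: add.commute)
    qed
    have zero: "integral\<^sup>L lebesgue (s n) = 0" for n
      unfolding s_def using Fint Ftint integral_translate[OF Fm, of "h n *\<^sub>R e"] by simp
    have sm: "s n \<in> borel_measurable lebesgue" for n
      by (intro measurable_completion) (unfold s_def, measurable)
    have Dm: "D \<in> borel_measurable borel"
    proof -
      have [measurable]: "\<Omega> \<in> sets borel" using assms(1) by simp
      show ?thesis unfolding D_def by measurable
    qed
    then have Dm': "D \<in> borel_measurable lebesgue" by (simp add: measurable_completion)
    have "(\<lambda>n. integral\<^sup>L lebesgue (s n)) \<longlonglongrightarrow> integral\<^sup>L lebesgue D"
    proof (rule integral_dominated_convergence[where w = "\<lambda>x. indicator (cball 0 (R + 1)) x * C",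
            OF Dm' sm _ lim])
      have "integrable lebesgue (\<lambda>x::real^'n. indicator (cball 0 (R + 1)) x *\<^sub>R C)"
        by (intro integrable_indicator_iff[THEN iffD2] integrable_scaleR_left)
          (use emeasure_lborel_cball_finite[of "0 :: real^'n" "R + 1"] in auto)
      then show "integrable lebesgue (\<lambda>x::real^'n. indicator (cball 0 (R + 1)) x * C)" by simp
      show "AE x in lebesgue. norm (s n x) \<le> indicator (cball 0 (R + 1)) x * C" for n
        using sb[of n] s0[of _ n] by (auto simp: indicator_def)
    qed
    then have "integral\<^sup>L lebesgue D = 0" by (simp add: zero LIMSEQ_const_iff)
    moreover have "integral\<^sup>L lebesgue D
        = (\<integral>x. g x * \<phi> x + f x * partial i \<phi> x \<partial>lebesgue_on \<Omega>)"
    proof -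
      have "(\<integral>x. g x * \<phi> x + f x * partial i \<phi> x \<partial>lebesgue_on \<Omega>)
          = (\<integral>x. indicator \<Omega> x *\<^sub>R (g x * \<phi> x + f x * partial i \<phi> x) \<partial>lebesgue)"
        using assms(1) by (intro integral_restrict_space) auto
      also have "\<dots> = integral\<^sup>L lebesgue D"
        by (rule Bochner_Integration.integral_cong) (auto simp: D_def f0_def indicator_def)
      finally show ?thesis by simp
    qed
    moreover have "integrable (lebesgue_on \<Omega>) (\<lambda>x. g x * \<phi> x)"
    proof (rule fm.integrable_const_bound[where B = "L * B"])
      have "AE x in lebesgue_on \<Omega>. x \<in> \<Omega> - N"
        using AEN assms(1) by (auto simp: AE_restrict_space_iff)
      then show "AE x in lebesgue_on \<Omega>. norm (g x * \<phi> x) \<le> L * B"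
      proof eventually_elim
        case (elim x)
        then show ?case using gbound B L0 by (auto simp: abs_mult intro!: mult_mono)
      qed
      show "(\<lambda>x. g x * \<phi> x) \<in> borel_measurable (lebesgue_on \<Omega>)"
        by (intro measurable_restrict_space1 measurable_completion) (simp, measurable)
    qed
    moreover have "integrable (lebesgue_on \<Omega>) (\<lambda>x. f x * partial i \<phi> x)"
    proof -
      have "integrable (lebesgue_on \<Omega>) (\<lambda>x. f0 x * partial i \<phi> x)"
      proof (rule fm.integrable_const_bound[where B = "M * B'"])
        show "AE x in lebesgue_on \<Omega>. norm (f0 x * partial i \<phi> x) \<le> M * B'"
          using f0b B' M0 by (auto simp: abs_mult intro!: mult_mono AE_I2)
        show "(\<lambda>x. f0 x * partial i \<phi> x) \<in> borel_measurable (lebesgue_on \<Omega>)"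
          by (intro measurable_restrict_space1 measurable_completion) (simp, measurable)
      qed
      then show ?thesis
        by (rule Bochner_Integration.integrable_cong[THEN iffD1, rotated 2])
          (auto simp: f0_def space_restrict_space)
    qed
    ultimately show ?thesis by simp
  qed
  show ?thesis by (rule that[OF gm geq gL2 main])
qed

section \<open>Functions with Lipschitz gradient\<close>

text \<open>The gradient \<open>G\<close> is a parameter, so that it also carries its continuous extension to the boundary
  of \<open>T\<close>. Differentiability of \<open>G\<close> in the interior is included because a Lipschitz function is
  known to be differentiable almost everywhere only by Rademacher's theorem.\<close>

definition C11 :: "(real^'n::finite) set \<Rightarrow> (real^'n \<Rightarrow> real) \<Rightarrow> (real^'n \<Rightarrow> real^'n) \<Rightarrow> bool"
  where "C11 T f G \<longleftrightarrow> continuous_on T f \<and> (\<exists>L. L-lipschitz_on T G) \<and>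
    (\<forall>x\<in>interior T. (f has_derivative (\<lambda>h. G x \<bullet> h)) (at x) \<and> G differentiable (at x))"

lemma C11_cong:
  assumes "C11 T f G" "\<And>x. x \<in> T \<Longrightarrow> f x = f' x" "\<And>x. x \<in> T \<Longrightarrow> G x = G' x"
  shows "C11 T f' G'"
proof -
  have int: "x \<in> interior T \<Longrightarrow> x \<in> T" for x using interior_subset by blast
  have "continuous_on T f'" using assms by (auto simp: C11_def cong: continuous_on_cong)
  moreover have "\<exists>L. L-lipschitz_on T G'"
    using assms unfolding C11_def lipschitz_on_def by (metis (no_types, lifting))
  moreover have "(f' has_derivative (\<lambda>h. G' x \<bullet> h)) (at x) \<and> G' differentiable (at x)"
    if x: "x \<in> interior T" for x
  proof
    have "(f has_derivative (\<lambda>h. G' x \<bullet> h)) (at x)"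
      using assms(1,3) x int by (auto simp: C11_def)
    then show "(f' has_derivative (\<lambda>h. G' x \<bullet> h)) (at x)"
      by (rule has_derivative_transform_within_open[OF _ open_interior x]) (simp add: int assms(2))
    obtain D where "(G has_derivative D) (at x)"
      using assms(1) x by (auto simp: C11_def differentiable_def)
    then have "(G' has_derivative D) (at x)"
      by (rule has_derivative_transform_within_open[OF _ open_interior x]) (simp add: int assms(3))
    then show "G' differentiable (at x)" by (auto simp: differentiable_def)
  qed
  ultimately show ?thesis by (simp add: C11_def)
qed

lemma C11_add:
  assumes "C11 T f F" "C11 T g G"
  shows "C11 T (\<lambda>x. f x + g x) (\<lambda>x. F x + G x)"
proof -
  obtain K L where "K-lipschitz_on T F" "L-lipschitz_on T G" using assms by (auto simp: C11_def)
  then have "(K + L)-lipschitz_on T (\<lambda>x. F x + G x)" by (rule lipschitz_on_add)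
  then show ?thesis
    using assms by (auto simp: C11_def inner_add_left intro!: continuous_on_add has_derivative_add)
qed

lemma C11_scale:
  assumes "C11 T f F"
  shows "C11 T (\<lambda>x. c * f x) (\<lambda>x. c *\<^sub>R F x)"
proof -
  obtain K where "K-lipschitz_on T F" using assms by (auto simp: C11_def)
  then have "(\<bar>c\<bar> * K)-lipschitz_on T (\<lambda>x. c *\<^sub>R F x)" by (rule lipschitz_on_cmult)
  then show ?thesis
    using assms by (auto simp: C11_def intro!: continuous_intros has_derivative_mult_right)
qed

lemma C11_zero: "C11 T (\<lambda>x. 0) (\<lambda>x. 0)"
  using lipschitz_on_constant[of T 0] by (auto simp: C11_def)

text \<open>In the interior this is the mean value theorem for \<open>f - (\<bullet>) (G x)\<close> on the segment; both sides
  are continuous in \<open>x\<close> and \<open>y\<close>, so it extends to the closure. Through this estimate the values of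
  \<open>f\<close> on a boundary face control the tangential part of \<open>G\<close> there.\<close>

lemma C11_taylor:
  assumes "C11 T f G" "convex T" "closed T" "interior T \<noteq> {}"
  obtains L where "0 \<le> L"
    "\<And>x y. x \<in> T \<Longrightarrow> y \<in> T \<Longrightarrow> \<bar>f y - f x - G x \<bullet> (y - x)\<bar> \<le> L * (norm (y - x))\<^sup>2"
proof -
  obtain L where L: "L-lipschitz_on T G" using assms(1) by (auto simp: C11_def)
  have L0: "0 \<le> L" using lipschitz_on_nonneg[OF L] .
  have cl: "closure (interior T) = T"
    using assms(2-4) by (simp add: convex_closure_interior)
  have cf: "continuous_on T f" using assms(1) by (simp add: C11_def)
  have cG: "continuous_on T G" using L by (rule lipschitz_on_continuous_on)
  let ?e = "\<lambda>x y. \<bar>f y - f x - G x \<bullet> (y - x)\<bar> - L * (norm (y - x))\<^sup>2"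
  have int: "?e x y \<le> 0" if x: "x \<in> interior T" and y: "y \<in> interior T" for x y
  proof -
    let ?S = "closed_segment x y"
    have S: "?S \<subseteq> interior T"
      using x y assms(2) by (intro closed_segment_subset convex_interior) auto
    have "norm ((f y - G x \<bullet> y) - (f x - G x \<bullet> x)) \<le> (L * norm (y - x)) * norm (y - x)"
    proof (rule differentiable_bound[where f = "\<lambda>w. f w - G x \<bullet> w" and S = ?S
          and f' = "\<lambda>w h. G w \<bullet> h - G x \<bullet> h"])
      fix w assume w: "w \<in> ?S"
      have "(f has_derivative (\<lambda>h. G w \<bullet> h)) (at w)"
        using assms(1) S w unfolding C11_def by blast
      from has_derivative_diff[OF this bounded_linear_imp_has_derivative[OF bounded_linear_inner_right]]
      show "((\<lambda>w. f w - G x \<bullet> w) has_derivative (\<lambda>h. G w \<bullet> h - G x \<bullet> h)) (at w within ?S)"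
        by (rule has_derivative_at_withinI)
      have "w \<in> T" "x \<in> T" using S w x interior_subset[of T] by blast+
      then have "norm (G w - G x) \<le> L * norm (w - x)"
        using lipschitz_onD[OF L] by (simp add: dist_norm)
      also have "\<dots> \<le> L * norm (y - x)"
        using segment_bound1[OF w] L0 by (intro mult_left_mono) auto
      finally have n: "norm (G w - G x) \<le> L * norm (y - x)" .
      show "onorm (\<lambda>h. G w \<bullet> h - G x \<bullet> h) \<le> L * norm (y - x)"
      proof (rule onorm_le)
        fix h
        have "norm (G w \<bullet> h - G x \<bullet> h) \<le> norm (G w - G x) * norm h"
          using Cauchy_Schwarz_ineq2[of "G w - G x" h] by (simp add: inner_diff_left)
        also have "\<dots> \<le> L * norm (y - x) * norm h" using n by (intro mult_right_mono) auto
        finally show "norm (G w \<bullet> h - G x \<bullet> h) \<le> L * norm (y - x) * norm h" .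
      qed
    qed auto
    then show ?thesis by (simp add: inner_diff_right power2_eq_square algebra_simps)
  qed
  have half: "?e x y \<le> 0" if x: "x \<in> interior T" and y: "y \<in> T" for x y
  proof (rule continuous_le_on_closure[where S = "interior T" and f = "\<lambda>y. ?e x y"])
    show "continuous_on (closure (interior T)) (\<lambda>y. ?e x y)"
      unfolding cl by (intro continuous_intros cf)
  qed (use x y cl int[OF x] in simp_all)
  have all: "?e x y \<le> 0" if x: "x \<in> T" and y: "y \<in> T" for x y
  proof (rule continuous_le_on_closure[where S = "interior T" and f = "\<lambda>x. ?e x y"])
    show "continuous_on (closure (interior T)) (\<lambda>x. ?e x y)"
      unfolding cl by (intro continuous_intros cf cG)
  qed (use x y cl half[OF _ y] in simp_all)
  show ?thesis
  proof (rule that[OF L0])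
    show "\<bar>f y - f x - G x \<bullet> (y - x)\<bar> \<le> L * (norm (y - x))\<^sup>2" if "x \<in> T" "y \<in> T" for x y
      using all[OF that] by simp
  qed
qed

lemma C11_lipschitz:
  assumes "C11 T f G" "convex T" "compact T" "interior T \<noteq> {}"
  obtains K where "K-lipschitz_on T f"
proof -
  obtain L where L: "0 \<le> L"
    "\<And>x y. x \<in> T \<Longrightarrow> y \<in> T \<Longrightarrow> \<bar>f y - f x - G x \<bullet> (y - x)\<bar> \<le> L * (norm (y - x))\<^sup>2"
    using C11_taylor[OF assms(1,2) compact_imp_closed[OF assms(3)] assms(4)] by metis
  obtain L' where "L'-lipschitz_on T G" using assms(1) by (auto simp: C11_def)
  then have "continuous_on T G" by (rule lipschitz_on_continuous_on)
  then have "bounded (G ` T)"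
    using assms(3) by (simp add: compact_continuous_image compact_imp_bounded)
  then obtain B where B: "\<And>x. x \<in> T \<Longrightarrow> norm (G x) \<le> B" "0 < B"
    unfolding bounded_pos by blast
  have d: "norm (y - x) \<le> diameter T" if "x \<in> T" "y \<in> T" for x y
    using diameter_bounded_bound[OF compact_imp_bounded[OF assms(3)] that(2,1)]
    by (simp add: dist_norm)
  have "(B + L * diameter T)-lipschitz_on T f"
  proof (rule lipschitz_onI)
    fix x y assume xy: "x \<in> T" "y \<in> T"
    have "\<bar>f y - f x\<bar> \<le> \<bar>G x \<bullet> (y - x)\<bar> + L * (norm (y - x))\<^sup>2"
      using L(2)[OF xy] by linarith
    also have "\<dots> \<le> B * norm (y - x) + L * (diameter T * norm (y - x))"
    proof (rule add_mono)
      show "\<bar>G x \<bullet> (y - x)\<bar> \<le> B * norm (y - x)"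
        using Cauchy_Schwarz_ineq2[of "G x" "y - x"] mult_right_mono[OF B(1)[OF xy(1)], of
          "norm (y - x)"]
        by simp
      show "L * (norm (y - x))\<^sup>2 \<le> L * (diameter T * norm (y - x))"
        unfolding power2_eq_square using L(1) d[OF xy]
        by (intro mult_left_mono mult_right_mono) auto
    qed
    finally show "dist (f x) (f y) \<le> (B + L * diameter T) * dist x y"
      by (simp add: dist_norm abs_minus_commute norm_minus_commute algebra_simps)
  next
    show "0 \<le> B + L * diameter T"
      using B(2) L(1) diameter_ge_0[OF compact_imp_bounded[OF assms(3)]] by simp
  qed
  then show ?thesis by (rule that)
qed

lemma partial_eq:
  assumes "(f has_derivative D) (at x)"
  shows "partial i f x = D (axis i 1)"
  unfolding partial_def using frechet_derivative_at[OF assms] by simp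

text \<open>Off the boundaries of the pieces, which have measure zero, the function and its gradient are
  differentiable, and both are Lipschitz on each piece. The gradient being one single function on
  the whole domain, it can be differentiated weakly a second time.\<close>

theorem piecewise_C11_sobolev:
  fixes u z :: "real^'n::finite \<Rightarrow> real" and G :: "real^'n \<Rightarrow> real^'n"
  assumes \<Omega>: "open \<Omega>" "bounded \<Omega>"
    and "finite \<T>"
    and T: "\<And>T. T \<in> \<T> \<Longrightarrow> compact T" "\<And>T. T \<in> \<T> \<Longrightarrow> convex T" "\<And>T. T \<in> \<T> \<Longrightarrow> interior T \<noteq> {}"
    and cover: "\<Omega> \<subseteq> \<Union>\<T>"
    and C11: "\<And>T. T \<in> \<T> \<Longrightarrow> C11 T u G"
    and z: "z \<in> L2_space \<Omega>" "AE x in lebesgue_on \<Omega>. z x = u x"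
  shows "z \<in> sobolev_H 2 \<Omega>"
proof -
  define N where "N = (\<Union>T\<in>\<T>. frontier T)"
  have N: "negligible N"
    unfolding N_def using assms(3) T(2) by (intro negligible_Union)
      (auto intro: negligible_convex_frontier)
  have inside: "\<exists>T\<in>\<T>. x \<in> interior T" if x: "x \<in> \<Omega> - N" for x
  proof -
    obtain T where "T \<in> \<T>" "x \<in> T" using cover x by blast
    moreover have "x \<notin> frontier T" using x \<open>T \<in> \<T>\<close> by (auto simp: N_def)
    ultimately show ?thesis
      using closure_subset[of T] by (auto simp: frontier_def)
  qed
  have du: "(u has_derivative (\<lambda>h. G x \<bullet> h)) (at x)" and dG: "G differentiable (at x)"
    if x: "x \<in> \<Omega> - N" for x
    using inside[OF x] C11 by (auto simp: C11_def)
  have uniform: "\<exists>L. \<forall>T\<in>\<T>. L-lipschitz_on T f"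
    if f: "\<And>T. T \<in> \<T> \<Longrightarrow> \<exists>L. L-lipschitz_on T f" for f :: "real^'n \<Rightarrow> real"
  proof -
    obtain L where L: "\<And>T. T \<in> \<T> \<Longrightarrow> (L T)-lipschitz_on T f" using f by metis
    have "(\<Sum>T\<in>\<T>. \<bar>L T\<bar>)-lipschitz_on T f" if "T \<in> \<T>" for T
    proof (rule lipschitz_on_mono[OF L[OF that] subset_refl])
      have "L T \<le> \<bar>L T\<bar>" by simp
      also have "\<dots> \<le> (\<Sum>T\<in>\<T>. \<bar>L T\<bar>)"
        using assms(3) that by (intro member_le_sum) auto
      finally show "L T \<le> (\<Sum>T\<in>\<T>. \<bar>L T\<bar>)" .
    qed
    then show ?thesis by blast
  qed
  have bnd: "\<exists>M. \<forall>x\<in>\<Omega>. \<bar>f x\<bar> \<le> M"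
    if f: "\<And>T. T \<in> \<T> \<Longrightarrow> continuous_on T f" for f :: "real^'n \<Rightarrow> real"
  proof -
    have "bounded (f ` T)" if "T \<in> \<T>" for T
      using compact_continuous_image[OF f[OF that] T(1)[OF that]] by (rule compact_imp_bounded)
    then have "bounded (\<Union>T\<in>\<T>. f ` T)" using assms(3) by (intro bounded_UN) auto
    then obtain M where M: "\<forall>y\<in>(\<Union>T\<in>\<T>. f ` T). norm y \<le> M" unfolding bounded_iff by blast
    have "\<bar>f x\<bar> \<le> M" if x: "x \<in> \<Omega>" for x
    proof -
      obtain T where "T \<in> \<T>" "x \<in> T" using cover x by blast
      then have "f x \<in> (\<Union>T\<in>\<T>. f ` T)" by blast
      then show ?thesis using M by (metis real_norm_def)
    qed
    then show ?thesis by blast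
  qed
  have cT: "\<And>T. T \<in> \<T> \<Longrightarrow> closed T" using T(1) compact_imp_closed by blast
  have "\<exists>L. \<forall>T\<in>\<T>. L-lipschitz_on T u"
  proof (rule uniform)
    fix T assume TT: "T \<in> \<T>"
    show "\<exists>L. L-lipschitz_on T u"
      by (rule C11_lipschitz[OF C11[OF TT] T(2)[OF TT] T(1)[OF TT] T(3)[OF TT]]) blast
  qed
  then obtain L where L: "\<And>T. T \<in> \<T> \<Longrightarrow> L-lipschitz_on T u" by blast
  have "\<exists>M. \<forall>x\<in>\<Omega>. \<bar>u x\<bar> \<le> M"
    by (rule bnd) (use C11 in \<open>simp add: C11_def\<close>)
  then obtain M where M: "\<And>x. x \<in> \<Omega> \<Longrightarrow> \<bar>u x\<bar> \<le> M" by blast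
  have meas: "f \<in> borel_measurable (lebesgue_on \<Omega>)"
    if "\<And>T. T \<in> \<T> \<Longrightarrow> K-lipschitz_on T f" for f :: "real^'n \<Rightarrow> real" and K
    using piecewise_lipschitz_continuous[OF \<Omega>(1) assms(3) cT that cover] \<Omega>(1)
    by (intro continuous_imp_measurable_on_sets_lebesgue) auto
  have zu: "(\<integral>x. z x * f x \<partial>lebesgue_on \<Omega>) = (\<integral>x. u x * f x \<partial>lebesgue_on \<Omega>)"
    if "f \<in> borel_measurable borel" for f :: "real^'n \<Rightarrow> real"
  proof (rule integral_cong_AE)
    have f: "f \<in> borel_measurable (lebesgue_on \<Omega>)"
      using that by (simp add: measurable_completion measurable_restrict_space1)
    have zm: "z \<in> borel_measurable (lebesgue_on \<Omega>)" using z(1) by (simp add: L2_space_def)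
    show "(\<lambda>x. z x * f x) \<in> borel_measurable (lebesgue_on \<Omega>)" using f zm by measurable
    have "u \<in> borel_measurable (lebesgue_on \<Omega>)" using L by (rule meas)
    then show "(\<lambda>x. u x * f x) \<in> borel_measurable (lebesgue_on \<Omega>)" using f by measurable
    show "AE x in lebesgue_on \<Omega>. z x * f x = u x * f x" using z(2) by eventually_elim simp
  qed
  have first: "\<exists>g\<in>L2_space \<Omega>. (\<forall>x\<in>\<Omega> - N. g x = G x $ i) \<and>
      (\<forall>\<phi>\<in>test_functions \<Omega>. (\<integral>x. u x * partial i \<phi> x \<partial>lebesgue_on \<Omega>)
        = - (\<integral>x. g x * \<phi> x \<partial>lebesgue_on \<Omega>))" for i
  proof (rule piecewise_lipschitz_weak_partial[OF \<Omega> assms(3) cT L cover M N, where i = i])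
    show "u differentiable at x" if "x \<in> \<Omega> - N" for x
      using du[OF that] by (auto simp: differentiable_def)
    fix g assume g: "g \<in> L2_space \<Omega>" "\<And>x. x \<in> \<Omega> - N \<Longrightarrow> g x = partial i u x"
      "\<And>\<phi>. \<phi> \<in> test_functions \<Omega> \<Longrightarrow> (\<integral>x. u x * partial i \<phi> x \<partial>lebesgue_on \<Omega>)
        = - (\<integral>x. g x * \<phi> x \<partial>lebesgue_on \<Omega>)"
    have "g x = G x $ i" if "x \<in> \<Omega> - N" for x
      using g(2)[OF that] partial_eq[OF du[OF that], of i] by (simp add: inner_axis)
    then show ?thesis using g(1,3) by blast
  qed
  have second: "\<exists>g\<in>L2_space \<Omega>.
      (\<lambda>x. G x $ i) \<in> borel_measurable (lebesgue_on \<Omega>) \<and>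
      (\<forall>\<phi>\<in>test_functions \<Omega>. (\<integral>x. G x $ i * partial j \<phi> x \<partial>lebesgue_on \<Omega>)
        = - (\<integral>x. g x * \<phi> x \<partial>lebesgue_on \<Omega>))" for i j
  proof -
    have lip: "\<exists>L. L-lipschitz_on T (\<lambda>x. G x $ i)" if TT: "T \<in> \<T>" for T
    proof -
      obtain L where L: "L-lipschitz_on T G" using C11[OF TT] by (auto simp: C11_def)
      have "L-lipschitz_on T (\<lambda>x. G x $ i)"
      proof (rule lipschitz_onI)
        fix x y assume xy: "x \<in> T" "y \<in> T"
        have "dist (G x $ i) (G y $ i) \<le> dist (G x) (G y)" by (rule dist_vec_nth_le)
        also have "\<dots> \<le> L * dist x y" by (rule lipschitz_onD[OF L xy])
        finally show "dist (G x $ i) (G y $ i) \<le> L * dist x y" .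
      qed (rule lipschitz_on_nonneg[OF L])
      then show ?thesis by blast
    qed
    obtain L where L: "\<And>T. T \<in> \<T> \<Longrightarrow> L-lipschitz_on T (\<lambda>x. G x $ i)"
      using uniform[OF lip] by blast
    have "\<exists>M. \<forall>x\<in>\<Omega>. \<bar>G x $ i\<bar> \<le> M"
      by (rule bnd) (rule lipschitz_on_continuous_on[OF L])
    then obtain M where M: "\<And>x. x \<in> \<Omega> \<Longrightarrow> \<bar>G x $ i\<bar> \<le> M" by blast
    show ?thesis
    proof (rule piecewise_lipschitz_weak_partial[OF \<Omega> assms(3) cT L cover M N, where i = j])
      show "(\<lambda>x. G x $ i) differentiable at x" if "x \<in> \<Omega> - N" for x
        using dG[OF that] bounded_linear.has_derivative[OF bounded_linear_vec_nth]
        unfolding differentiable_def by fast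
      fix g assume "g \<in> L2_space \<Omega>"
        "\<And>\<phi>. \<phi> \<in> test_functions \<Omega> \<Longrightarrow> (\<integral>x. G x $ i * partial j \<phi> x \<partial>lebesgue_on \<Omega>)
          = - (\<integral>x. g x * \<phi> x \<partial>lebesgue_on \<Omega>)"
      then show ?thesis using meas[OF L] by blast
    qed
  qed
  have bm: "\<phi> \<in> borel_measurable borel" if "\<phi> \<in> test_functions \<Omega>" for \<phi>
    using test_function_continuous[OF that] by (rule borel_measurable_continuous_onI)
  have off: "AE x in lebesgue_on \<Omega>. x \<in> \<Omega> - N"
    using N \<Omega>(1) by (auto simp: AE_restrict_space_iff negligible_iff_null_sets intro: AE_mp[OF AE_not_in])
  have "\<exists>g\<in>L2_space \<Omega>. weak_partials \<Omega> \<alpha> z g" if len: "length \<alpha> \<le> 2" for \<alpha>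
  proof -
    consider "\<alpha> = []" | i where "\<alpha> = [i]" | i j where "\<alpha> = [j, i]"
      using len by (cases \<alpha>; cases "tl \<alpha>"; cases "tl (tl \<alpha>)") auto
    then show ?thesis
    proof cases
      case 1
      then show ?thesis using z(1) by (intro bexI[of _ z])
        (auto simp: weak_partials_def partials_def)
    next
      case 2
      obtain g where "g \<in> L2_space \<Omega>" "\<And>\<phi>. \<phi> \<in> test_functions \<Omega> \<Longrightarrow>
          (\<integral>x. u x * partial i \<phi> x \<partial>lebesgue_on \<Omega>) = - (\<integral>x. g x * \<phi> x \<partial>lebesgue_on \<Omega>)"
        using first[of i] by blast
      then show ?thesis using zu[OF bm[OF test_function_partial]] 2
        by (intro bexI[of _ g]) (auto simp: weak_partials_def partials_def)
    next
      case 3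
      obtain g where g: "g \<in> L2_space \<Omega>" "\<And>x. x \<in> \<Omega> - N \<Longrightarrow> g x = G x $ j"
        "\<And>\<phi>. \<phi> \<in> test_functions \<Omega> \<Longrightarrow>
          (\<integral>x. u x * partial j \<phi> x \<partial>lebesgue_on \<Omega>) = - (\<integral>x. g x * \<phi> x \<partial>lebesgue_on \<Omega>)"
        using first[of j] by blast
      obtain k where k: "k \<in> L2_space \<Omega>" and Gm: "(\<lambda>x. G x $ j) \<in> borel_measurable (lebesgue_on \<Omega>)"
        and k': "\<And>\<phi>. \<phi> \<in> test_functions \<Omega> \<Longrightarrow>
          (\<integral>x. G x $ j * partial i \<phi> x \<partial>lebesgue_on \<Omega>) = - (\<integral>x. k x * \<phi> x \<partial>lebesgue_on \<Omega>)"
        using second[of j i] by blast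
      have "(\<integral>x. z x * partial j (partial i \<phi>) x \<partial>lebesgue_on \<Omega>)
          = (\<integral>x. k x * \<phi> x \<partial>lebesgue_on \<Omega>)" if \<phi>: "\<phi> \<in> test_functions \<Omega>" for \<phi>
      proof -
        have \<phi>': "partial i \<phi> \<in> test_functions \<Omega>" using \<phi> by (rule test_function_partial)
        have "(\<integral>x. z x * partial j (partial i \<phi>) x \<partial>lebesgue_on \<Omega>)
            = - (\<integral>x. g x * partial i \<phi> x \<partial>lebesgue_on \<Omega>)"
          using zu[OF bm[OF test_function_partial[OF \<phi>']]] g(3)[OF \<phi>'] by simp
        also have "(\<integral>x. g x * partial i \<phi> x \<partial>lebesgue_on \<Omega>)
            = (\<integral>x. G x $ j * partial i \<phi> x \<partial>lebesgue_on \<Omega>)"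
        proof (rule integral_cong_AE)
          have "partial i \<phi> \<in> borel_measurable (lebesgue_on \<Omega>)"
            using bm[OF \<phi>'] by (simp add: measurable_completion measurable_restrict_space1)
          moreover have "g \<in> borel_measurable (lebesgue_on \<Omega>)"
            using g(1) by (simp add: L2_space_def)
          ultimately show "(\<lambda>x. g x * partial i \<phi> x) \<in> borel_measurable (lebesgue_on \<Omega>)"
            "(\<lambda>x. G x $ j * partial i \<phi> x) \<in> borel_measurable (lebesgue_on \<Omega>)"
            using Gm by measurable
          show "AE x in lebesgue_on \<Omega>. g x * partial i \<phi> x = G x $ j * partial i \<phi> x"
            using off by eventually_elim (simp add: g(2))
        qed
        finally show ?thesis using k'[OF \<phi>] by simp
      qed
      then show ?thesis using k 3
        by (intro bexI[of _ k]) (auto simp: weak_partials_def partials_def)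
    qed
  qed
  then show ?thesis using z(1) by (simp add: sobolev_H_def)
qed

section \<open>Barycentric coordinates\<close>

text \<open>The functions \<open>bary v j\<close> are affine on the whole space, since the vertices form an affine basis.\<close>

locale tetrahedron =
  fixes v :: "nat \<Rightarrow> real^3"
  assumes nondeg: "nondegenerate v"
begin

lemma inj_v: "inj_on v {0..3}" and indep_v: "\<not> affine_dependent (v ` {0..3})"
  using nondeg by (auto simp: nondegenerate_def)

lemma barys_exists:
  "\<exists>u. (\<forall>j. j \<notin> {0..3} \<longrightarrow> u j = 0) \<and> (\<Sum>j=0..3. u j) = 1 \<and> (\<Sum>j=0..3. u j *\<^sub>R v j) = x"
proof -
  have "card (v ` {0..3}) = Suc DIM(real^3)" using inj_v by (simp add: card_image)
  then have "x \<in> affine hull (v ` {0..3})" using affine_independent_span_eq[OF indep_v] by simp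
  then obtain u where u: "sum u (v ` {0..3}) = 1" "(\<Sum>a\<in>v ` {0..3}. u a *\<^sub>R a) = x"
    by (auto simp: affine_hull_finite)
  show ?thesis
    by (rule exI[of _ "\<lambda>j. if j \<in> {0..3} then u (v j) else 0"])
      (use u inj_v in \<open>simp add: sum.reindex\<close>)
qed

lemma barys_unique:
  assumes "(\<Sum>j=0..3. u j) = (\<Sum>j=0..3. w j)" "(\<Sum>j=0..3. u j *\<^sub>R v j) = (\<Sum>j=0..3. w j *\<^sub>R v j)"
    "i \<le> 3"
  shows "u i = w i"
proof (rule ccontr)
  assume ne: "u i \<noteq> w i"
  define U where "U a = u (inv_into {0..3} v a) - w (inv_into {0..3} v a)" for a
  have Uv: "U (v j) = u j - w j" if "j \<in> {0..3}" for j using inj_v that by (simp add: U_def)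
  have "sum U (v ` {0..3}) = 0" using assms(1) inj_v by (simp add: sum.reindex Uv sum_subtractf)
  moreover have "(\<Sum>a\<in>v ` {0..3}. U a *\<^sub>R a) = 0"
    using assms(2) inj_v by (simp add: sum.reindex Uv sum_subtractf scaleR_left_diff_distrib)
  moreover have "\<exists>a\<in>v ` {0..3}. U a \<noteq> 0" using ne assms(3) Uv[of i] by force
  ultimately have "affine_dependent (v ` {0..3})" by (subst affine_dependent_explicit_finite) auto
  with indep_v show False by simp
qed

lemma barys_properties:
  "(\<forall>j. j \<notin> {0..3} \<longrightarrow> barys v x j = 0) \<and> (\<Sum>j=0..3. barys v x j) = 1 \<and>
   (\<Sum>j=0..3. barys v x j *\<^sub>R v j) = x"
proof -
  have "\<exists>!u. (\<forall>j. j \<notin> {0..3} \<longrightarrow> u j = 0) \<and> (\<Sum>j=0..3. u j) = 1 \<and> (\<Sum>j=0..3. u j *\<^sub>R v j) = x"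
  proof (rule ex_ex1I[OF barys_exists])
    fix u w :: "nat \<Rightarrow> real"
    assume u: "(\<forall>j. j \<notin> {0..3} \<longrightarrow> u j = 0) \<and> (\<Sum>j=0..3. u j) = 1 \<and> (\<Sum>j=0..3. u j *\<^sub>R v j) = x"
      and w: "(\<forall>j. j \<notin> {0..3} \<longrightarrow> w j = 0) \<and> (\<Sum>j=0..3. w j) = 1 \<and> (\<Sum>j=0..3. w j *\<^sub>R v j) = x"
    show "u = w"
    proof
      fix j show "u j = w j" using barys_unique[of u w j] u w by (cases "j \<le> 3") auto
    qed
  qed
  from theI'[OF this] show ?thesis unfolding barys_def .
qed

lemma bary_sum: "(\<Sum>j=0..3. bary v j x) = 1"
  and bary_comb: "(\<Sum>j=0..3. bary v j x *\<^sub>R v j) = x"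
  using barys_properties by (auto simp: bary_def)

lemma bary_eqI:
  assumes "(\<Sum>j=0..3. u j) = 1" "(\<Sum>j=0..3. u j *\<^sub>R v j) = x" "i \<le> 3"
  shows "bary v i x = u i"
  using barys_unique[of "\<lambda>j. bary v j x" u i] assms bary_sum bary_comb by simp

lemma bary_beyond: "3 < i \<Longrightarrow> bary v i x = 0"
  using barys_properties by (simp add: bary_def)

definition bgrad :: "nat \<Rightarrow> real^3"
  where "bgrad j = adjoint (\<lambda>h. bary v j h - bary v j 0) 1"

lemma bary_diff: "bary v j y - bary v j x = bgrad j \<bullet> (y - x)"
proof -
  have "linear (\<lambda>h. bary v j h - bary v j 0)"
  proof (cases "j \<le> 3")
    case True
    show ?thesis
    proof (rule linearI)
      fix x y :: "real^3"
      have "bary v j (x + y) = bary v j x + bary v j y - bary v j 0"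
        by (rule bary_eqI[where u = "\<lambda>j. bary v j x + bary v j y - bary v j 0", OF _ _ True])
          (simp_all add: sum.distrib sum_subtractf bary_sum bary_comb scaleR_left_distrib
            scaleR_left_diff_distrib)
      then show "bary v j (x + y) - bary v j 0 = (bary v j x - bary v j 0) + (bary v j y - bary v j 0)"
        by simp
    next
      fix c and x :: "real^3"
      have "bary v j (c *\<^sub>R x) = c * bary v j x + (1 - c) * bary v j 0"
      proof (rule bary_eqI[where u = "\<lambda>j. c * bary v j x + (1 - c) * bary v j 0", OF _ _ True])
        show "(\<Sum>j = 0..3. c * bary v j x + (1 - c) * bary v j 0) = 1"
          by (simp only: sum.distrib sum_distrib_left[symmetric] bary_sum) simp
        show "(\<Sum>j = 0..3. (c * bary v j x + (1 - c) * bary v j 0) *\<^sub>R v j) = c *\<^sub>R x"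
          by (simp only: scaleR_left_distrib sum.distrib scaleR_scaleR[symmetric]
              scaleR_right.sum[symmetric] bary_comb) simp
      qed
      then show "bary v j (c *\<^sub>R x) - bary v j 0 = c *\<^sub>R (bary v j x - bary v j 0)"
        by (simp add: algebra_simps)
    qed
  qed (simp add: bary_beyond linear_iff)
  from adjoint_works[OF this]
  have "bary v j h - bary v j 0 = bgrad j \<bullet> h" for h
    by (simp add: bgrad_def inner_commute)
  from this[of x] this[of y] show ?thesis by (simp add: inner_diff_right)
qed

lemma bary_affine: "bary v j x = bary v j 0 + bgrad j \<bullet> x"
  using bary_diff[of j x 0] by simp

lemma bary_has_derivative: "(bary v j has_derivative (\<lambda>h. bgrad j \<bullet> h)) (at x)"
proof -
  have "((\<lambda>x. bary v j 0 + bgrad j \<bullet> x) has_derivative (\<lambda>h. 0 + bgrad j \<bullet> h)) (at x)"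
    by (intro has_derivative_add has_derivative_const bounded_linear_imp_has_derivative
        bounded_linear_inner_right)
  then show ?thesis by (simp flip: bary_affine)
qed

lemma bary_continuous [continuous_intros]: "continuous_on S (bary v j)"
  by (intro continuous_at_imp_continuous_on ballI has_derivative_continuous[OF bary_has_derivative])

lemma bary_combination:
  assumes "(\<Sum>j=0..3. u j) = 1" "i \<le> 3"
  shows "bary v i (\<Sum>j=0..3. u j *\<^sub>R v j) = u i"
  using assms bary_eqI by blast

lemma bary_vertex:
  assumes "i \<le> 3" "j \<le> 3"
  shows "bary v j (v i) = (if i = j then 1 else 0)"
  using assms
  by (intro bary_eqI[where u = "\<lambda>j. if i = j then 1 else 0"])
    (auto simp: if_distrib[of "\<lambda>a. a *\<^sub>R _"] cong: if_cong)

lemma tet_iff: "x \<in> tet v \<longleftrightarrow> (\<forall>j\<le>3. 0 \<le> bary v j x)"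
proof
  assume "x \<in> tet v"
  then obtain u where u: "\<forall>a\<in>v ` {0..3}. 0 \<le> u a" "sum u (v ` {0..3}) = 1"
    "(\<Sum>a\<in>v ` {0..3}. u a *\<^sub>R a) = x"
    unfolding tet_def by (subst (asm) convex_hull_finite) auto
  have "bary v j x = u (v j)" if "j \<le> 3" for j
    using u inj_v that by (intro bary_eqI[where u = "\<lambda>j. u (v j)"]) (auto simp: sum.reindex)
  then show "\<forall>j\<le>3. 0 \<le> bary v j x" using u(1) by auto
next
  assume "\<forall>j\<le>3. 0 \<le> bary v j x"
  then have "(\<Sum>j=0..3. bary v j x *\<^sub>R v j) \<in> convex hull (v ` {0..3})"
    by (intro convex_sum convex_convex_hull) (auto simp: bary_sum intro: hull_inc)
  then show "x \<in> tet v" by (simp add: bary_comb tet_def)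
qed

lemma bary_le_1:
  assumes "x \<in> tet v" "j \<le> 3"
  shows "bary v j x \<le> 1"
proof -
  have "bary v j x \<le> (\<Sum>j=0..3. bary v j x)"
    using assms by (intro member_le_sum) (auto simp: tet_iff)
  then show ?thesis by (simp add: bary_sum)
qed

lemma vertex_in_tet: "i \<le> 3 \<Longrightarrow> v i \<in> tet v"
  by (simp add: tet_def hull_inc)

text \<open>The vectors \<open>v j\<close> and \<open>bgrad j\<close> are dual to each other in the sense that
  \<open>h = (\<Sum>j. (bgrad j \<bullet> h) v j)\<close>; this is the transposed identity.\<close>

lemma bgrad_expansion: "\<xi> = (\<Sum>j=0..3. (\<xi> \<bullet> v j) *\<^sub>R bgrad j)"
proof -
  have "h \<bullet> \<xi> = h \<bullet> (\<Sum>j=0..3. (\<xi> \<bullet> v j) *\<^sub>R bgrad j)" for h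
  proof -
    have e: "bgrad j \<bullet> h = bary v j h - bary v j 0" for j using bary_diff[of j h 0] by simp
    have "(\<Sum>j=0..3. (bgrad j \<bullet> h) *\<^sub>R v j)
        = (\<Sum>j=0..3. bary v j h *\<^sub>R v j) - (\<Sum>j=0..3. bary v j 0 *\<^sub>R v j)"
      by (simp only: e scaleR_left_diff_distrib sum_subtractf)
    also have "\<dots> = h" by (simp add: bary_comb)
    finally have "h \<bullet> \<xi> = (\<Sum>j=0..3. (bgrad j \<bullet> h) *\<^sub>R v j) \<bullet> \<xi>" by simp
    also have "\<dots> = (\<Sum>j=0..3. (bgrad j \<bullet> h) * (v j \<bullet> \<xi>))"
      by (simp only: inner_sum_left inner_scaleR_left)
    also have "\<dots> = (\<Sum>j=0..3. (\<xi> \<bullet> v j) * (h \<bullet> bgrad j))"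
    proof (rule sum.cong[OF refl])
      fix j show "(bgrad j \<bullet> h) * (v j \<bullet> \<xi>) = (\<xi> \<bullet> v j) * (h \<bullet> bgrad j)"
        using inner_commute[of "bgrad j" h] inner_commute[of "v j" \<xi>] by simp
    qed
    also have "\<dots> = h \<bullet> (\<Sum>j=0..3. (\<xi> \<bullet> v j) *\<^sub>R bgrad j)"
      by (simp only: inner_sum_right inner_scaleR_right)
    finally show ?thesis .
  qed
  then show ?thesis by (rule vector_eq_ldot[THEN iffD1, OF allI])
qed

lemma bgrad_sum: "(\<Sum>j=0..3. bgrad j) = 0"
proof -
  have "h \<bullet> (\<Sum>j=0..3. bgrad j) = h \<bullet> 0" for h
  proof -
    have e: "h \<bullet> bgrad j = bary v j h - bary v j 0" for j
      using bary_diff[of j h 0] by (simp add: inner_commute)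
    show ?thesis by (simp only: inner_sum_right e sum_subtractf bary_sum) simp
  qed
  then show ?thesis by (rule vector_eq_ldot[THEN iffD1, OF allI])
qed

text \<open>A vector \<open>\<xi>\<close> that is constant, equal to \<open>\<kappa>\<close>, on the vertices of a face is by this formula a
  combination of the gradients \<open>bgrad j\<close> with \<open>v j\<close> outside that face, i.e. of the normals of the
  facets that contain it.\<close>

lemma bgrad_expansion_shift: "\<xi> = (\<Sum>j=0..3. (\<xi> \<bullet> v j - \<kappa>) *\<^sub>R bgrad j)"
proof -
  have "(\<Sum>j=0..3. (\<xi> \<bullet> v j - \<kappa>) *\<^sub>R bgrad j) = (\<Sum>j=0..3. (\<xi> \<bullet> v j) *\<^sub>R bgrad j) - \<kappa> *\<^sub>R (\<Sum>j=0..3. bgrad j)"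
    by (simp only: scaleR_left_diff_distrib sum_subtractf scaleR_right.sum)
  then show ?thesis using bgrad_expansion[of \<xi>] bgrad_sum by simp
qed

lemma bgrad_nonzero:
  assumes "j \<le> 3" shows "bgrad j \<noteq> 0"
proof
  assume 0: "bgrad j = 0"
  define i :: nat where "i = (if j = 0 then 1 else 0)"
  have "bary v j (v j) - bary v j (v i) = 0" by (simp add: bary_diff 0)
  then show False using assms by (auto simp: bary_vertex i_def split: if_splits)
qed

lemma interior_tet: "interior (tet v) = {x. \<forall>j\<le>3. 0 < bary v j x}"
proof
  show "interior (tet v) \<subseteq> {x. \<forall>j\<le>3. 0 < bary v j x}"
  proof clarify
    fix x j assume x: "x \<in> interior (tet v)" and j: "j \<le> (3::nat)"
    obtain e where e: "0 < e" "ball x e \<subseteq> tet v" using x mem_interior by blast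
    define y where "y = x - (e / 2 / norm (bgrad j)) *\<^sub>R bgrad j"
    have "y \<in> ball x e" using e(1) bgrad_nonzero[OF j] by (simp add: y_def dist_norm)
    then have "0 \<le> bary v j y" using e(2) tet_iff j by blast
    also have "bary v j y = bary v j x - e / 2 * norm (bgrad j)"
      using bary_diff[of j y x] bgrad_nonzero[OF j]
      by (simp add: y_def dot_square_norm power2_eq_square)
    finally show "0 < bary v j x" using e(1) bgrad_nonzero[OF j]
      by (smt (verit) divide_pos_pos mult_pos_pos zero_less_norm_iff)
  qed
  show "{x. \<forall>j\<le>3. 0 < bary v j x} \<subseteq> interior (tet v)"
  proof (rule interior_maximal)
    show "{x. \<forall>j\<le>3. 0 < bary v j x} \<subseteq> tet v" by (auto simp: tet_iff less_imp_le)
    have "{x. \<forall>j\<le>3. 0 < bary v j x} = (\<Inter>j\<in>{0..3}. {x. 0 < bary v j x})" by auto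
    also have "open \<dots>"
      by (intro open_INT ballI open_Collect_less continuous_on_const bary_continuous) auto
    finally show "open {x. \<forall>j\<le>3. 0 < bary v j x}" .
  qed
qed

lemma tet_convex: "convex (tet v)" and tet_compact: "compact (tet v)" and tet_closed:
  "closed (tet v)"
proof -
  show "compact (tet v)" unfolding tet_def by (intro finite_imp_compact_convex_hull) auto
  then show "closed (tet v)" by (rule compact_imp_closed)
qed (simp add: tet_def)

lemma interior_nonempty: "interior (tet v) \<noteq> {}"
proof -
  have "bary v i (\<Sum>j=0..3. (1/4) *\<^sub>R v j) = 1/4" if "i \<le> 3" for i
    using bary_combination[of "\<lambda>_. 1/4" i] that by simp
  then have "0 < bary v i (\<Sum>j=0..3. (1/4) *\<^sub>R v j)" if "i \<le> 3" for i
    using that by (metis zero_less_divide_1_iff zero_less_numeral)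
  then have "(\<Sum>j=0..3. (1/4) *\<^sub>R v j) \<in> interior (tet v)" unfolding interior_tet by blast
  then show ?thesis by blast
qed

lemma closure_interior: "closure (interior (tet v)) = tet v"
  using convex_closure_interior[OF tet_convex interior_nonempty] tet_closed by simp

lemma face_iff: "x \<in> face v i \<longleftrightarrow> x \<in> tet v \<and> bary v i x = 0"
  by (simp add: face_def)

lemma outer_normal_eq:
  assumes i: "i \<le> 3"
  shows "outer_normal v i = - (1 / norm (bgrad i)) *\<^sub>R bgrad i"
  unfolding outer_normal_def
proof (rule the_equality)
  let ?n = "- (1 / norm (bgrad i)) *\<^sub>R bgrad i"
  have n: "?n \<bullet> (x - y) = - (bary v i x - bary v i y) / norm (bgrad i)" for x y
    by (simp add: bary_diff)
  show "norm ?n = 1 \<and> (\<forall>x\<in>face v i. \<forall>y\<in>face v i. ?n \<bullet> (x - y) = 0) \<and>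
    (\<forall>x\<in>tet v. \<forall>y\<in>face v i. ?n \<bullet> (x - y) \<le> 0)"
  proof (intro conjI ballI)
    show "norm ?n = 1" using bgrad_nonzero[OF i] by simp
    show "?n \<bullet> (x - y) = 0" if "x \<in> face v i" "y \<in> face v i" for x y
      unfolding n using that by (simp add: face_iff)
    show "?n \<bullet> (x - y) \<le> 0" if "x \<in> tet v" "y \<in> face v i" for x y
    proof -
      have "0 \<le> bary v i x" "bary v i y = 0" using that i by (simp_all add: face_iff tet_iff)
      then show ?thesis unfolding n by (simp add: divide_le_0_iff)
    qed
  qed
next
  fix \<nu> assume \<nu>: "norm \<nu> = 1 \<and> (\<forall>x\<in>face v i. \<forall>y\<in>face v i. \<nu> \<bullet> (x - y) = 0) \<and>
    (\<forall>x\<in>tet v. \<forall>y\<in>face v i. \<nu> \<bullet> (x - y) \<le> 0)"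
  then have \<nu>1: "norm \<nu> = 1"
    and \<nu>2: "\<And>x y. x \<in> face v i \<Longrightarrow> y \<in> face v i \<Longrightarrow> \<nu> \<bullet> (x - y) = 0"
    and \<nu>3: "\<And>x y. x \<in> tet v \<Longrightarrow> y \<in> face v i \<Longrightarrow> \<nu> \<bullet> (x - y) \<le> 0" by blast+
  \<comment> \<open>Any vertex of the face serves as its base point.\<close>
  define k :: nat where "k = (if i = 0 then 1 else 0)"
  have k: "k \<le> 3" "k \<noteq> i" by (auto simp: k_def)
  have vf: "v j \<in> face v i" if "j \<le> 3" "j \<noteq> i" for j
    using that i by (simp add: face_iff vertex_in_tet bary_vertex)
  have eq: "\<nu> \<bullet> v j - \<nu> \<bullet> v k = 0" if "j \<le> 3" "j \<noteq> i" for j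
    using \<nu>2[OF vf[OF that] vf[OF k]] by (simp add: inner_diff_right)
  define c where "c = \<nu> \<bullet> v i - \<nu> \<bullet> v k"
  have c: "c \<le> 0" using \<nu>3[OF vertex_in_tet[OF i] vf[OF k]] by (simp add: c_def inner_diff_right)
  have "\<nu> = (\<Sum>j=0..3. (\<nu> \<bullet> v j - \<nu> \<bullet> v k) *\<^sub>R bgrad j)" by (rule bgrad_expansion_shift)
  also have "\<dots> = (\<Sum>j=0..3. if j = i then c *\<^sub>R bgrad i else 0)"
  proof (rule sum.cong[OF refl])
    fix j assume "j \<in> {0..3::nat}"
    then show "(\<nu> \<bullet> v j - \<nu> \<bullet> v k) *\<^sub>R bgrad j = (if j = i then c *\<^sub>R bgrad i else 0)"
      using eq[of j] by (cases "j = i") (simp_all add: c_def)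
  qed
  finally have \<nu>c: "\<nu> = c *\<^sub>R bgrad i" using i by simp
  then have "- c * norm (bgrad i) = 1" using \<nu>1 c by simp
  then have "c = - (1 / norm (bgrad i))" using bgrad_nonzero[OF i] by (simp add: field_simps)
  then show "\<nu> = - (1 / norm (bgrad i)) *\<^sub>R bgrad i" using \<nu>c by simp
qed

end

section \<open>Rational monomials in barycentric coordinates\<close>

definition pair_in :: "nat set \<Rightarrow> nat \<times> nat \<Rightarrow> bool"
  where "pair_in S p \<longleftrightarrow> fst p \<in> S \<and> snd p \<in> S"

lemma prod_list_split_vertex:
  fixes x :: "nat \<Rightarrow> real"
  assumes "set N \<subseteq> V"
  shows "(\<Prod>a\<leftarrow>N. x a) =
    (\<Prod>a\<leftarrow>filter (\<lambda>a. a \<in> V - {t}) N. x a) * x t ^ length (filter (\<lambda>a. a \<notin> V - {t}) N)"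
  using assms by (induction N) (simp_all add: algebra_simps)

text \<open>A pair that lies in \<open>V\<close> but not in \<open>V - {t}\<close> contains \<open>t\<close>, so its factor is at least \<open>x t\<close>.\<close>

lemma prod_list_split_pairs:
  fixes x :: "nat \<Rightarrow> real"
  assumes "\<And>p. p \<in> set D \<Longrightarrow> pair_in V p" "\<And>a. a \<in> V \<Longrightarrow> 0 \<le> x a" "t \<in> V"
  defines "s \<equiv> \<lambda>p. x (fst p) + x (snd p)"
  shows "0 \<le> (\<Prod>p\<leftarrow>filter (pair_in (V - {t})) D. s p) \<and>
    (\<Prod>p\<leftarrow>filter (pair_in (V - {t})) D. s p) * x t ^ length (filter (\<lambda>p. \<not> pair_in (V - {t}) p) D)
      \<le> (\<Prod>p\<leftarrow>D. s p)"
  using assms(1)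
proof (induction D)
  case (Cons p D)
  let ?A = "\<Prod>p\<leftarrow>filter (pair_in (V - {t})) D. s p"
    and ?B = "x t ^ length (filter (\<lambda>p. \<not> pair_in (V - {t}) p) D)"
  have IH: "0 \<le> ?A" "?A * ?B \<le> (\<Prod>p\<leftarrow>D. s p)" using Cons.IH Cons.prems by auto
  have xt: "0 \<le> x t" using assms(2,3) by blast
  have V: "fst p \<in> V" "snd p \<in> V" using Cons.prems[of p] by (auto simp: pair_in_def)
  have x: "0 \<le> x (fst p)" "0 \<le> x (snd p)" using assms(2) V by blast+
  have AB: "0 \<le> ?A * ?B" using IH(1) xt by simp
  show ?case
  proof (cases "pair_in (V - {t}) p")
    case True
    have "s p * (?A * ?B) \<le> s p * (\<Prod>p\<leftarrow>D. s p)"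
      using IH(2) x by (intro mult_left_mono) (auto simp: s_def)
    then show ?thesis using True IH(1) x by (simp add: mult_ac s_def)
  next
    case False
    then have "fst p = t \<or> snd p = t" using V by (auto simp: pair_in_def)
    then have "x t \<le> s p" using x by (auto simp: s_def)
    then have "x t * (?A * ?B) \<le> s p * (\<Prod>p\<leftarrow>D. s p)"
      using IH(2) AB x by (intro mult_mono) (auto simp: s_def)
    then show ?thesis using False IH(1) by (simp add: mult_ac)
  qed
qed simp

text \<open>Remove a vertex \<open>t\<close> where \<open>x\<close> is maximal. Factors of the denominator that involve \<open>t\<close> are at
  least \<open>x t\<close>, the others are treated by the induction hypothesis with the bound \<open>x t\<close>; the surplus
  of numerator factors inside \<open>V - {t}\<close>, each at most \<open>x t\<close>, pays for the former.\<close>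

lemma prod_list_dominated:
  fixes x :: "nat \<Rightarrow> real"
  assumes "finite V" "set N \<subseteq> V" "\<And>p. p \<in> set D \<Longrightarrow> pair_in V p"
    and "\<And>a. a \<in> V \<Longrightarrow> 0 \<le> x a" "\<And>a. a \<in> V \<Longrightarrow> x a \<le> u"
    and "\<And>S. S \<subseteq> V \<Longrightarrow> length (filter (pair_in S) D) \<le> length (filter (\<lambda>a. a \<in> S) N)"
  shows "(\<Prod>a\<leftarrow>N. x a) \<le> (\<Prod>p\<leftarrow>D. x (fst p) + x (snd p)) * u ^ (length N - length D)"
  using assms
proof (induction V arbitrary: N D u rule: finite_psubset_induct)
  case (psubset V)
  show ?case
  proof (cases "V = {}")
    case True
    have "N = []" using psubset.prems(1) True by simp
    moreover have "D = []"
    proof (rule ccontr)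
      assume "D \<noteq> []"
      then have "hd D \<in> set D" by simp
      from psubset.prems(2)[OF this] True show False by (simp add: pair_in_def)
    qed
    ultimately show ?thesis by simp
  next
    case False
    have "Max (x ` V) \<in> x ` V" using psubset.hyps False by (intro Max_in) auto
    then obtain t where t: "t \<in> V" "x t = Max (x ` V)" by auto
    have tmax: "x a \<le> x t" if "a \<in> V" for a
      unfolding t(2) using psubset.hyps that by (intro Max_ge) auto
    define W where "W = V - {t}"
    define N' where "N' = filter (\<lambda>a. a \<in> W) N"
    define D' where "D' = filter (pair_in W) D"
    define n where "n = length (filter (\<lambda>a. a \<notin> W) N)"
    define d where "d = length (filter (\<lambda>p. \<not> pair_in W p) D)"
    have lN: "length N = length N' + n"
      using sum_length_filter_compl[of "\<lambda>a. a \<in> W" N] by (simp add: N'_def n_def)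
    have lD: "length D = length D' + d"
      using sum_length_filter_compl[of "pair_in W" D] by (simp add: D'_def d_def)
    have S': "filter (\<lambda>a. a \<in> S) N' = filter (\<lambda>a. a \<in> S) N"
      "filter (pair_in S) D' = filter (pair_in S) D" if "S \<subseteq> W" for S
      unfolding N'_def D'_def filter_filter using that
      by (auto intro!: filter_cong simp: pair_in_def)
    have IH: "(\<Prod>a\<leftarrow>N'. x a)
        \<le> (\<Prod>p\<leftarrow>D'. x (fst p) + x (snd p)) * x t ^ (length N' - length D')"
    proof (rule psubset.IH)
      show "W \<subset> V" using t(1) by (auto simp: W_def)
      show "set N' \<subseteq> W" by (auto simp: N'_def)
      show "pair_in W p" if "p \<in> set D'" for p using that by (simp add: D'_def)
      show "0 \<le> x a" if "a \<in> W" for a using that psubset.prems(3)[of a] by (simp add: W_def)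
      show "x a \<le> x t" if "a \<in> W" for a using that tmax[of a] by (simp add: W_def)
      show "length (filter (pair_in S) D') \<le> length (filter (\<lambda>a. a \<in> S) N')" if "S \<subseteq> W" for S
        using psubset.prems(5)[of S] that S'[OF that] by (auto simp: W_def)
    qed
    have WV: "W \<subseteq> V" by (auto simp: W_def)
    have "filter (pair_in V) D = D" "filter (\<lambda>a. a \<in> V) N = N"
      using psubset.prems(1,2) by (auto simp: filter_id_conv)
    then have le: "length D \<le> length N" using psubset.prems(5)[of V] by simp
    have le': "length D' \<le> length N'" using psubset.prems(5)[OF WV] by (simp add: D'_def N'_def)
    have split: "(length N' - length D') + n = d + (length N - length D)"
      using lN lD le le' by simp
    note pairs = prod_list_split_pairs[of D V x t, OF psubset.prems(2,3) t(1), folded W_def, folded D'_def d_def]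
    have xt: "0 \<le> x t" using psubset.prems(3)[OF t(1)] .
    have u: "x t \<le> u" using psubset.prems(4)[OF t(1)] .
    have "(\<Prod>a\<leftarrow>N. x a) = (\<Prod>a\<leftarrow>N'. x a) * x t ^ n"
      unfolding N'_def n_def W_def by (rule prod_list_split_vertex[OF psubset.prems(1)])
    also have "\<dots> \<le> ((\<Prod>p\<leftarrow>D'. x (fst p) + x (snd p)) * x t ^ (length N' - length D')) * x t ^ n"
      using IH xt by (intro mult_right_mono) auto
    also have "\<dots> = (\<Prod>p\<leftarrow>D'. x (fst p) + x (snd p)) * x t ^ ((length N' - length D') + n)"
      by (simp only: power_add mult.assoc)
    also have "\<dots> = ((\<Prod>p\<leftarrow>D'. x (fst p) + x (snd p)) * x t ^ d) * x t ^ (length N - length D)"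
      by (simp only: split power_add mult.assoc)
    also have "\<dots> \<le> (\<Prod>p\<leftarrow>D. x (fst p) + x (snd p)) * u ^ (length N - length D)"
    proof (rule mult_mono)
      have "0 \<le> (\<Prod>p\<leftarrow>D'. x (fst p) + x (snd p)) * x t ^ d" using pairs xt by simp
      then show "0 \<le> (\<Prod>p\<leftarrow>D. x (fst p) + x (snd p))" using pairs by linarith
    qed (use pairs xt u in \<open>auto intro: power_mono\<close>)
    finally show ?thesis .
  qed
qed

text \<open>Along the part of the boundary where all \<open>\<lambda>\<^sub>a\<close> with \<open>a \<in> S\<close> vanish, the quotient with numerator
  factors \<open>N\<close> and denominator pairs \<open>D\<close> vanishes at least to order \<open>k\<close>. Only sets \<open>S\<close> that contain a
  pair matter: elsewhere the quotient is smooth, whatever its order, and without pairs there is no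
  condition at all.\<close>

definition order_ge :: "nat \<Rightarrow> nat list \<Rightarrow> (nat \<times> nat) list \<Rightarrow> bool"
  where "order_ge k N D \<longleftrightarrow> set N \<subseteq> {0..3} \<and> (\<forall>p\<in>set D. pair_in {0..3} p \<and> fst p \<noteq> snd p) \<and>
    (\<forall>S. (\<exists>p\<in>set D. pair_in S p) \<longrightarrow>
      k + length (filter (pair_in S) D) \<le> length (filter (\<lambda>a. a \<in> S) N))"

text \<open>The product rule for \<open>\<Prod>a\<leftarrow>N. f a\<close>: one entry per factor, with the remaining factors.\<close>

fun removals :: "nat list \<Rightarrow> (nat \<times> nat list) list"
  where "removals [] = []"
  | "removals (a # N) = (a, N) # map (\<lambda>q. (fst q, a # snd q)) (removals N)"

lemma removals_filter:
  assumes "q \<in> set (removals N)"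
  shows "length (filter P N) \<le> Suc (length (filter P (snd q))) \<and> set (snd q) \<subseteq> set N"
  using assms
proof (induction N arbitrary: q)
  case (Cons a N)
  show ?case
  proof (cases "q = (a, N)")
    case False
    then obtain q' where q': "q' \<in> set (removals N)" "q = (fst q', a # snd q')"
      using Cons.prems by auto
    show ?thesis using Cons.IH[OF q'(1)] q'(2) by auto
  qed auto
qed simp

text \<open>This and the next lemma say that a derivative costs one order: it either removes a numerator factor
  or repeats a denominator factor.\<close>

lemma order_ge_removal:
  assumes "order_ge (Suc k) N D" "q \<in> set (removals N)"
  shows "order_ge k (snd q) D"
  unfolding order_ge_def
proof (intro conjI allI impI)
  show "set (snd q) \<subseteq> {0..3}" using assms(1) removals_filter[OF assms(2)]
    by (auto simp: order_ge_def)
  show "\<forall>p\<in>set D. pair_in {0..3} p \<and> fst p \<noteq> snd p" using assms(1) by (simp add: order_ge_def)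
  fix S assume "\<exists>p\<in>set D. pair_in S p"
  then have "Suc k + length (filter (pair_in S) D) \<le> length (filter (\<lambda>a. a \<in> S) N)"
    using assms(1) by (simp add: order_ge_def)
  then show "k + length (filter (pair_in S) D) \<le> length (filter (\<lambda>a. a \<in> S) (snd q))"
    using removals_filter[OF assms(2), of "\<lambda>a. a \<in> S"] by simp
qed

lemma order_ge_pair:
  assumes "order_ge (Suc k) N D" "p \<in> set D"
  shows "order_ge k N (p # D)"
  unfolding order_ge_def
proof (intro conjI allI impI)
  show "set N \<subseteq> {0..3}" using assms(1) by (simp add: order_ge_def)
  show "\<forall>q\<in>set (p # D). pair_in {0..3} q \<and> fst q \<noteq> snd q" using assms by (simp add: order_ge_def)
  fix S assume "\<exists>q\<in>set (p # D). pair_in S q"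
  then have "\<exists>q\<in>set D. pair_in S q" using assms(2) by auto
  then have "Suc k + length (filter (pair_in S) D) \<le> length (filter (\<lambda>a. a \<in> S) N)"
    using assms(1) by (simp add: order_ge_def)
  then show "k + length (filter (pair_in S) (p # D)) \<le> length (filter (\<lambda>a. a \<in> S) N)" by simp
qed

lemma order_ge_Suc: "order_ge (Suc k) N D \<Longrightarrow> order_ge k N D"
  by (fastforce simp: order_ge_def)

lemma scaleR_sum_list: "(\<Sum>p\<leftarrow>xs. c *\<^sub>R f p) = c *\<^sub>R (\<Sum>p\<leftarrow>xs. f p :: 'a::real_vector)"
  by (induction xs) (simp_all add: scaleR_right_distrib)

lemma norm_sum_list_le:
  fixes f :: "'b \<Rightarrow> 'a::real_normed_vector"
  assumes "\<And>p. p \<in> set xs \<Longrightarrow> \<bar>c p\<bar> \<le> 1"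
  shows "norm (\<Sum>p\<leftarrow>xs. c p *\<^sub>R f p) \<le> (\<Sum>p\<leftarrow>xs. norm (f p))"
  using assms
proof (induction xs)
  case (Cons p xs)
  have "norm (c p *\<^sub>R f p) \<le> 1 * norm (f p)"
    using Cons.prems[of p] by (simp only: norm_scaleR) (intro mult_right_mono; simp)
  moreover have "norm (\<Sum>p\<leftarrow>xs. c p *\<^sub>R f p) \<le> (\<Sum>p\<leftarrow>xs. norm (f p))"
    using Cons.prems by (intro Cons.IH) simp
  ultimately show ?case
    using norm_triangle_ineq[of "c p *\<^sub>R f p" "\<Sum>p\<leftarrow>xs. c p *\<^sub>R f p"] by simp
qed simp

lemma lipschitz_sum_list:
  fixes f :: "'b \<Rightarrow> 'a::real_normed_vector"
  assumes "\<And>p. p \<in> set xs \<Longrightarrow> \<exists>L. L-lipschitz_on T (c p)"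
  shows "\<exists>L. L-lipschitz_on T (\<lambda>x. \<Sum>p\<leftarrow>xs. c p x *\<^sub>R f p)"
  using assms
proof (induction xs)
  case Nil
  show ?case by (rule exI[of _ 0]) (simp add: lipschitz_on_constant)
next
  case (Cons p xs)
  obtain K where K: "K-lipschitz_on T (c p)" using Cons.prems[of p] by auto
  obtain L where L: "L-lipschitz_on T (\<lambda>x. \<Sum>p\<leftarrow>xs. c p x *\<^sub>R f p)"
    using Cons.IH Cons.prems by auto
  have "(K * norm (f p))-lipschitz_on T (\<lambda>x. c p x *\<^sub>R f p)"
  proof (rule lipschitz_onI)
    fix x y assume "x \<in> T" "y \<in> T"
    then have "\<bar>c p x - c p y\<bar> \<le> K * dist x y" using lipschitz_onD[OF K]
      by (simp add: dist_real_def)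
    then have "\<bar>c p x - c p y\<bar> * norm (f p) \<le> K * dist x y * norm (f p)"
      by (rule mult_right_mono) simp
    then show "dist (c p x *\<^sub>R f p) (c p y *\<^sub>R f p) \<le> K * norm (f p) * dist x y"
      by (simp add: dist_norm mult_ac flip: scaleR_left_diff_distrib)
  qed (use lipschitz_on_nonneg[OF K] in simp)
  from lipschitz_on_add[OF this L] show ?case by auto
qed

lemma differentiable_sum_list:
  fixes f :: "'b \<Rightarrow> 'a::real_normed_vector" and c :: "'b \<Rightarrow> 'c::real_normed_vector \<Rightarrow> real"
  assumes "\<And>p. p \<in> set xs \<Longrightarrow> c p differentiable (at x)"
  shows "(\<lambda>x. \<Sum>p\<leftarrow>xs. c p x *\<^sub>R f p) differentiable (at x)"
  using assms
  by (induction xs) (simp_all add: differentiable_add differentiable_scaleR)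

context tetrahedron begin

definition pair_sum :: "nat \<times> nat \<Rightarrow> real^3 \<Rightarrow> real"
  where "pair_sum p x = bary v (fst p) x + bary v (snd p) x"

definition bary_ratio :: "nat list \<Rightarrow> (nat \<times> nat) list \<Rightarrow> real^3 \<Rightarrow> real"
  where "bary_ratio N D x = (\<Prod>a\<leftarrow>N. bary v a x) / (\<Prod>p\<leftarrow>D. pair_sum p x)"

text \<open>A formula for the gradient that makes sense on the whole closed tetrahedron, where vanishing
  denominators give \<open>0\<close>. For orders of at least two it is the continuous extension of the gradient.\<close>

definition bary_ratio_grad :: "nat list \<Rightarrow> (nat \<times> nat) list \<Rightarrow> real^3 \<Rightarrow> real^3"
  where "bary_ratio_grad N D x = (\<Sum>q\<leftarrow>removals N. bary_ratio (snd q) D x *\<^sub>R bgrad (fst q))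
    - (\<Sum>p\<leftarrow>D. bary_ratio N (p # D) x *\<^sub>R (bgrad (fst p) + bgrad (snd p)))"

lemma pair_sum_pos:
  assumes "x \<in> interior (tet v)" "pair_in {0..3} p"
  shows "0 < pair_sum p x"
  using assms by (auto simp: interior_tet pair_sum_def pair_in_def intro!: add_pos_pos)

lemma pair_sum_nonneg:
  assumes "x \<in> tet v" "pair_in {0..3} p"
  shows "0 \<le> pair_sum p x"
  using assms by (auto simp: tet_iff pair_sum_def pair_in_def intro!: add_nonneg_nonneg)

text \<open>Order zero yields the hypothesis of \<open>prod_list_dominated\<close> with \<open>u = 1\<close>.\<close>

lemma bary_ratio_bounds:
  assumes "order_ge 0 N D" "x \<in> tet v"
  shows "0 \<le> bary_ratio N D x" "bary_ratio N D x \<le> 1"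
proof -
  have D: "pair_in {0..3} p" "fst p \<noteq> snd p" if "p \<in> set D" for p
    using assms(1) that by (auto simp: order_ge_def)
  have N: "set N \<subseteq> {0..3}" using assms(1) by (simp add: order_ge_def)
  have nn: "0 \<le> (\<Prod>p\<leftarrow>D. pair_sum p x)"
    using D(1) pair_sum_nonneg[OF assms(2)] by (intro prod_list_nonneg) auto
  have "0 \<le> (\<Prod>a\<leftarrow>N. bary v a x)"
    using N assms(2) by (intro prod_list_nonneg) (auto simp: tet_iff)
  then show "0 \<le> bary_ratio N D x" using nn by (simp add: bary_ratio_def)
  have "(\<Prod>a\<leftarrow>N. bary v a x)
      \<le> (\<Prod>p\<leftarrow>D. bary v (fst p) x + bary v (snd p) x) * 1 ^ (length N - length D)"
  proof (rule prod_list_dominated[where V = "{0..3}"])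
    show "length (filter (pair_in S) D) \<le> length (filter (\<lambda>a. a \<in> S) N)" for S
    proof (cases "\<exists>p\<in>set D. pair_in S p")
      case True
      then show ?thesis using assms(1) by (simp add: order_ge_def)
    next
      case False
      then have "filter (pair_in S) D = []" by (simp add: filter_empty_conv)
      then show ?thesis by simp
    qed
  qed (use N D assms(2) bary_le_1[OF assms(2)] in \<open>auto simp: tet_iff\<close>)
  then have le: "(\<Prod>a\<leftarrow>N. bary v a x) \<le> (\<Prod>p\<leftarrow>D. pair_sum p x)" by (simp add: pair_sum_def)
  show "bary_ratio N D x \<le> 1"
  proof (cases "(\<Prod>p\<leftarrow>D. pair_sum p x) = 0")
    case False
    then show ?thesis using le nn by (simp add: bary_ratio_def divide_le_eq)
  qed (simp add: bary_ratio_def)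
qed

text \<open>The quotient by one more copy of the denominator \<open>p\<close> is still bounded, so the monomial
  vanishes at least as fast as \<open>p\<close>.\<close>

lemma bary_ratio_le_pair_sum:
  assumes "order_ge 1 N D" "x \<in> tet v" "p \<in> set D"
  shows "bary_ratio N D x \<le> pair_sum p x"
proof (cases "pair_sum p x = 0")
  case True
  then have "(\<Prod>p\<leftarrow>D. pair_sum p x) = 0" using assms(3) by (auto simp: prod_list_zero_iff)
  then show ?thesis using True by (simp add: bary_ratio_def)
next
  case False
  have p: "pair_in {0..3} p" using assms(1,3) by (simp add: order_ge_def)
  have pos: "0 < pair_sum p x" using pair_sum_nonneg[OF assms(2) p] False by simp
  have "bary_ratio N D x = pair_sum p x * bary_ratio N (p # D) x" using False
    by (simp add: bary_ratio_def)
  also have "\<dots> \<le> pair_sum p x * 1"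
    using bary_ratio_bounds(2)[OF order_ge_pair[of 0 N D p] assms(2)] assms(1,3) pos
      by (intro mult_left_mono) auto
  finally show ?thesis by simp
qed

lemma pair_sum_continuous [continuous_intros]: "continuous_on S (pair_sum p)"
  unfolding pair_sum_def by (intro continuous_intros)

lemma prod_list_continuous:
  assumes "\<And>a. a \<in> set N \<Longrightarrow> continuous_on S (f a :: real^3 \<Rightarrow> real)"
  shows "continuous_on S (\<lambda>x. \<Prod>a\<leftarrow>N. f a x)"
  using assms by (induction N) (simp_all add: continuous_on_mult)

text \<open>Where a denominator vanishes, the value is \<open>0\<close> by convention, and this is the limit by
  \<open>bary_ratio_le_pair_sum\<close>.\<close>

lemma bary_ratio_continuous:
  assumes "order_ge 1 N D"
  shows "continuous_on (tet v) (bary_ratio N D)"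
  unfolding continuous_on_def
proof
  fix x assume x: "x \<in> tet v"
  show "(bary_ratio N D \<longlongrightarrow> bary_ratio N D x) (at x within tet v)"
  proof (cases "\<exists>p\<in>set D. pair_sum p x = 0")
    case True
    then obtain p where p: "p \<in> set D" "pair_sum p x = 0" by blast
    then have "(\<Prod>p\<leftarrow>D. pair_sum p x) = 0" by (auto simp: prod_list_zero_iff)
    then have 0: "bary_ratio N D x = 0" by (simp add: bary_ratio_def)
    have lim: "(pair_sum p \<longlongrightarrow> 0) (at x within tet v)"
      using pair_sum_continuous[of "tet v" p] x p(2) by (auto simp: continuous_on_def)
    have "\<forall>\<^sub>F y in at x within tet v. norm (bary_ratio N D y) \<le> pair_sum p y"
      unfolding eventually_at_filter
    proof (intro always_eventually allI impI)
      fix y assume y: "y \<in> tet v"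
      show "norm (bary_ratio N D y) \<le> pair_sum p y"
        using bary_ratio_le_pair_sum[OF assms y p(1)] bary_ratio_bounds(1)[OF _ y] order_ge_Suc[of 0 N D] assms by simp
    qed
    then show ?thesis unfolding 0 using lim by (rule Lim_null_comparison)
  next
    case False
    then have "(\<Prod>p\<leftarrow>D. pair_sum p x) \<noteq> 0" by (auto simp: prod_list_zero_iff)
    moreover have "((\<lambda>x. \<Prod>p\<leftarrow>D. pair_sum p x) \<longlongrightarrow> (\<Prod>p\<leftarrow>D. pair_sum p x)) (at x within tet v)"
      using prod_list_continuous[of D "tet v" pair_sum] pair_sum_continuous x
      unfolding continuous_on_def by blast
    moreover have "((\<lambda>x. \<Prod>a\<leftarrow>N. bary v a x) \<longlongrightarrow> (\<Prod>a\<leftarrow>N. bary v a x)) (at x within tet v)"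
      using prod_list_continuous[of N "tet v" "bary v"] bary_continuous x
      unfolding continuous_on_def by blast
    ultimately show ?thesis unfolding bary_ratio_def by (intro tendsto_divide)
  qed
qed

lemma numerator_has_derivative:
  "((\<lambda>x. \<Prod>a\<leftarrow>N. bary v a x) has_derivative
    (\<lambda>h. (\<Sum>q\<leftarrow>removals N. (\<Prod>a\<leftarrow>snd q. bary v a x) *\<^sub>R bgrad (fst q)) \<bullet> h)) (at x)"
proof (induction N)
  case (Cons a N)
  let ?P = "\<Prod>a\<leftarrow>N. bary v a x" and ?G = "\<Sum>q\<leftarrow>removals N. (\<Prod>a\<leftarrow>snd q. bary v a x) *\<^sub>R bgrad (fst q)"
  have "((\<lambda>x. bary v a x * (\<Prod>a\<leftarrow>N. bary v a x)) has_derivative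
      (\<lambda>h. bary v a x * (?G \<bullet> h) + (bgrad a \<bullet> h) * ?P)) (at x)"
    by (rule has_derivative_mult[OF bary_has_derivative Cons.IH])
  moreover have "(\<Sum>q\<leftarrow>removals (a # N). (\<Prod>a\<leftarrow>snd q. bary v a x) *\<^sub>R bgrad (fst q)) =
      ?P *\<^sub>R bgrad a + bary v a x *\<^sub>R ?G"
    by (simp add: comp_def flip: scaleR_sum_list)
  ultimately show ?case by (simp add: inner_add_left algebra_simps)
qed simp

lemma denominator_has_derivative:
  assumes "\<And>p. p \<in> set D \<Longrightarrow> pair_sum p x \<noteq> 0"
  shows "((\<lambda>x. inverse (\<Prod>p\<leftarrow>D. pair_sum p x)) has_derivative
    (\<lambda>h. - (\<Sum>p\<leftarrow>D. inverse (\<Prod>p\<leftarrow>p # D. pair_sum p x) *\<^sub>R (bgrad (fst p) + bgrad (snd p))) \<bullet> h))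
      (at x)"
  using assms
proof (induction D)
  case Nil
  have "(\<lambda>h. - (0::real^3) \<bullet> h) = (\<lambda>h. 0)" by (simp add: fun_eq_iff)
  then show ?case by simp
next
  case (Cons r D)
  let ?s = "pair_sum r x" and ?g = "bgrad (fst r) + bgrad (snd r)" and ?R =
    "inverse (\<Prod>p\<leftarrow>D. pair_sum p x)"
  let ?G = "\<Sum>p\<leftarrow>D. inverse (\<Prod>p\<leftarrow>p # D. pair_sum p x) *\<^sub>R (bgrad (fst p) + bgrad (snd p))"
  have "(pair_sum r has_derivative (\<lambda>h. bgrad (fst r) \<bullet> h + bgrad (snd r) \<bullet> h)) (at x)"
    unfolding pair_sum_def by (rule has_derivative_add[OF bary_has_derivative bary_has_derivative])
  then have "(pair_sum r has_derivative (\<lambda>h. ?g \<bullet> h)) (at x)" by (simp add: inner_add_left)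
  then have 1: "((\<lambda>x. inverse (pair_sum r x)) has_derivative (\<lambda>h. - (inverse ?s * (?g \<bullet> h) * inverse ?s))) (at x)"
    using Cons.prems[of r] by (intro Deriv.has_derivative_inverse) auto
  have 2: "((\<lambda>x. inverse (\<Prod>p\<leftarrow>D. pair_sum p x)) has_derivative (\<lambda>h. - ?G \<bullet> h)) (at x)"
    using Cons.prems by (intro Cons.IH) simp
  have e: "(\<Sum>p\<leftarrow>r # D. inverse (\<Prod>p\<leftarrow>p # r # D. pair_sum p x) *\<^sub>R (bgrad (fst p) + bgrad (snd p)))
      = (inverse ?s * inverse ?s * ?R) *\<^sub>R ?g + inverse ?s *\<^sub>R ?G"
    by (simp add: mult_ac flip: scaleR_sum_list)
  show ?case
    using has_derivative_mult[OF 1 2] unfolding e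
    by (simp add: inner_add_left inner_diff_left algebra_simps)
qed

lemma bary_ratio_has_derivative:
  assumes "\<And>p. p \<in> set D \<Longrightarrow> pair_in {0..3} p" "x \<in> interior (tet v)"
  shows "(bary_ratio N D has_derivative (\<lambda>h. bary_ratio_grad N D x \<bullet> h)) (at x)"
proof -
  let ?P = "\<Prod>a\<leftarrow>N. bary v a x" and ?R = "inverse (\<Prod>p\<leftarrow>D. pair_sum p x)"
  have nz: "pair_sum p x \<noteq> 0" if "p \<in> set D" for p
    using pair_sum_pos[OF assms(2) assms(1)[OF that]] by simp
  have 1: "(\<Sum>q\<leftarrow>removals N. bary_ratio (snd q) D x *\<^sub>R bgrad (fst q))
      = ?R *\<^sub>R (\<Sum>q\<leftarrow>removals N. (\<Prod>a\<leftarrow>snd q. bary v a x) *\<^sub>R bgrad (fst q))"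
    by (simp add: bary_ratio_def divide_inverse mult.commute flip: scaleR_sum_list)
  have 2: "(\<Sum>p\<leftarrow>D. bary_ratio N (p # D) x *\<^sub>R (bgrad (fst p) + bgrad (snd p)))
      = ?P *\<^sub>R (\<Sum>p\<leftarrow>D. inverse (\<Prod>p\<leftarrow>p # D. pair_sum p x) *\<^sub>R (bgrad (fst p) + bgrad (snd p)))"
    by (simp add: bary_ratio_def divide_inverse flip: scaleR_sum_list)
  have "((\<lambda>x. (\<Prod>a\<leftarrow>N. bary v a x) * inverse (\<Prod>p\<leftarrow>D. pair_sum p x)) has_derivative
      (\<lambda>h. bary_ratio_grad N D x \<bullet> h)) (at x)"
    using has_derivative_mult[OF numerator_has_derivative denominator_has_derivative[OF nz]]
    unfolding bary_ratio_grad_def 1 2 by (simp add: inner_diff_left algebra_simps)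
  then show ?thesis by (simp add: bary_ratio_def[abs_def] divide_inverse)
qed

text \<open>The gradient has order zero, so it is bounded.\<close>

lemma bary_ratio_lipschitz:
  assumes "order_ge 1 N D"
  shows "\<exists>L. L-lipschitz_on (tet v) (bary_ratio N D)"
proof -
  define B where "B = (\<Sum>q\<leftarrow>removals N. norm (bgrad (fst q))) + (\<Sum>p\<leftarrow>D. norm (bgrad (fst p) + bgrad (snd p)))"
  have D: "pair_in {0..3} p" if "p \<in> set D" for p using assms that by (simp add: order_ge_def)
  have bound: "norm (bary_ratio_grad N D x) \<le> B" if x: "x \<in> tet v" for x
  proof -
    have "\<bar>bary_ratio (snd q) D x\<bar> \<le> 1" if "q \<in> set (removals N)" for q
      using bary_ratio_bounds[OF order_ge_removal[of 0 N D q] x] that assms by simp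
    then have 1: "norm (\<Sum>q\<leftarrow>removals N. bary_ratio (snd q) D x *\<^sub>R bgrad (fst q)) \<le> (\<Sum>q\<leftarrow>removals N. norm (bgrad (fst q)))"
      by (rule norm_sum_list_le)
    have "\<bar>bary_ratio N (p # D) x\<bar> \<le> 1" if "p \<in> set D" for p
      using bary_ratio_bounds[OF order_ge_pair[of 0 N D p] x] that assms by simp
    then have 2: "norm (\<Sum>p\<leftarrow>D. bary_ratio N (p # D) x *\<^sub>R (bgrad (fst p) + bgrad (snd p)))
        \<le> (\<Sum>p\<leftarrow>D. norm (bgrad (fst p) + bgrad (snd p)))"
      by (rule norm_sum_list_le)
    show ?thesis unfolding bary_ratio_grad_def B_def
      by (rule order_trans[OF norm_triangle_ineq4 add_mono[OF 1 2]])
  qed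
  have B0: "0 \<le> B" using bound[OF vertex_in_tet[of 0]] norm_ge_zero order_trans by blast
  have "B-lipschitz_on (interior (tet v)) (bary_ratio N D)"
  proof (rule lipschitz_onI[OF _ B0])
    fix x y assume xy: "x \<in> interior (tet v)" "y \<in> interior (tet v)"
    have "norm (bary_ratio N D x - bary_ratio N D y) \<le> B * norm (x - y)"
    proof (rule differentiable_bound[OF convex_interior[OF tet_convex] _ _ xy,
          where f' = "\<lambda>x h. bary_ratio_grad N D x \<bullet> h"])
      fix w assume w: "w \<in> interior (tet v)"
      show "(bary_ratio N D has_derivative (\<lambda>h. bary_ratio_grad N D w \<bullet> h)) (at w within interior (tet v))"
        by (rule has_derivative_at_withinI[OF bary_ratio_has_derivative[OF D w]])
      show "onorm (\<lambda>h. bary_ratio_grad N D w \<bullet> h) \<le> B"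
      proof (rule onorm_le)
        fix h
        have "norm (bary_ratio_grad N D w \<bullet> h) \<le> norm (bary_ratio_grad N D w) * norm h"
          using Cauchy_Schwarz_ineq2[of "bary_ratio_grad N D w" h] by simp
        also have "\<dots> \<le> B * norm h"
          using bound[of w] w interior_subset by (intro mult_right_mono) auto
        finally show "norm (bary_ratio_grad N D w \<bullet> h) \<le> B * norm h" .
      qed
    qed
    then show "dist (bary_ratio N D x) (bary_ratio N D y) \<le> B * dist x y" by (simp add: dist_norm)
  qed
  from lipschitz_on_closure[OF this] bary_ratio_continuous[OF assms]
  show ?thesis by (auto simp: closure_interior)
qed

lemma bary_ratio_C11:
  assumes "order_ge 2 N D"
  shows "C11 (tet v) (bary_ratio N D) (bary_ratio_grad N D)"
  unfolding C11_def
proof (intro conjI ballI)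
  have order_ge: "order_ge (Suc 1) N D" using assms by (simp add: numeral_2_eq_2)
  have D: "pair_in {0..3} p" if "p \<in> set D" for p using assms that by (simp add: order_ge_def)
  show "continuous_on (tet v) (bary_ratio N D)"
    by (rule bary_ratio_continuous[OF order_ge_Suc[OF order_ge]])
  obtain K where K: "K-lipschitz_on (tet v) (\<lambda>x. \<Sum>q\<leftarrow>removals N. bary_ratio (snd q) D x *\<^sub>R bgrad (fst q))"
    using lipschitz_sum_list[of "removals N" "tet v" "\<lambda>q. bary_ratio (snd q) D" "\<lambda>q. bgrad (fst q)"]
      bary_ratio_lipschitz[OF order_ge_removal[OF order_ge]] by blast
  obtain L where L: "L-lipschitz_on (tet v) (\<lambda>x. \<Sum>p\<leftarrow>D. bary_ratio N (p # D) x *\<^sub>R (bgrad (fst p) + bgrad (snd p)))"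
    using lipschitz_sum_list[of D "tet v" "\<lambda>p. bary_ratio N (p # D)"
      "\<lambda>p. bgrad (fst p) + bgrad (snd p)"]
      bary_ratio_lipschitz[OF order_ge_pair[OF order_ge]] by blast
  have "(K + L)-lipschitz_on (tet v) (bary_ratio_grad N D)"
    unfolding bary_ratio_grad_def[abs_def] by (rule lipschitz_on_diff[OF K L])
  then show "\<exists>L. L-lipschitz_on (tet v) (bary_ratio_grad N D)" by blast
  fix x assume x: "x \<in> interior (tet v)"
  show "(bary_ratio N D has_derivative (\<lambda>h. bary_ratio_grad N D x \<bullet> h)) (at x)"
    by (rule bary_ratio_has_derivative[OF D x])
  have d: "bary_ratio M E differentiable (at x)" if "\<And>p. p \<in> set E \<Longrightarrow> pair_in {0..3} p" for M E
    using bary_ratio_has_derivative[OF that x] differentiableI by blast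
  show "bary_ratio_grad N D differentiable (at x)"
    unfolding bary_ratio_grad_def[abs_def]
    by (intro differentiable_diff differentiable_sum_list d) (use D in auto)
qed

end

section \<open>Polynomials as forms in the barycentric coordinates\<close>

lemma polys_mono_degree: "j \<le> k \<Longrightarrow> polys j \<subseteq> polys k"
  unfolding polys_def by (rule span_mono) (auto intro: order_trans)

lemma polys_add: "p \<in> polys k \<Longrightarrow> q \<in> polys k \<Longrightarrow> (\<lambda>x. p x + q x) \<in> polys k"
  using span_add[of p _ q] by (simp add: polys_def plus_fun_def)

lemma polys_scale: "p \<in> polys k \<Longrightarrow> (\<lambda>x. c * p x) \<in> polys k"
  using span_scale[of p _ c] by (simp add: polys_def scaleR_fun_def)

lemma polys_zero: "(\<lambda>x. 0) \<in> polys k"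
  unfolding polys_def zero_fun_def[symmetric] by (rule span_zero)

lemma polys_one: "(\<lambda>x. 1) \<in> polys k"
  unfolding polys_def
  by (rule span_base) (auto intro!: exI[of _ "\<lambda>_. 0::nat"])

lemma polys_sum_list: "(\<And>q. q \<in> set xs \<Longrightarrow> f q \<in> polys k) \<Longrightarrow> (\<lambda>x. \<Sum>q\<leftarrow>xs. f q x) \<in> polys k"
  by (induction xs) (simp_all add: polys_zero polys_add)

lemma polys_sum:
  assumes "finite I" "\<And>i. i \<in> I \<Longrightarrow> f i \<in> polys k"
  shows "(\<lambda>x. \<Sum>i\<in>I. f i x) \<in> polys k"
  using assms by (induction I rule: finite_induct) (simp_all add: polys_zero polys_add)

lemma polys_times_coordinate:
  assumes "p \<in> polys k"
  shows "(\<lambda>x. x $ i * p x) \<in> polys (Suc k)"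
  using assms unfolding polys_def[of k]
proof (induction p rule: span_induct_alt)
  case base
  show ?case using polys_zero by (simp add: zero_fun_def)
next
  case (step c f g)
  then obtain a where a: "f = (\<lambda>x. \<Prod>j\<in>UNIV. x $ j ^ a j)" "(\<Sum>j\<in>UNIV. a j) \<le> k" by auto
  have "(\<lambda>x. x $ i * f x) = (\<lambda>x. \<Prod>j\<in>UNIV. x $ j ^ (a(i := Suc (a i))) j)"
  proof
    fix x :: "real^3"
    have "(\<Prod>j\<in>UNIV. x $ j ^ (a(i := Suc (a i))) j)
        = x $ i ^ Suc (a i) * (\<Prod>j\<in>UNIV - {i}. x $ j ^ (a(i := Suc (a i))) j)"
      by (subst prod.remove[of UNIV i]) auto
    also have "(\<Prod>j\<in>UNIV - {i}. x $ j ^ (a(i := Suc (a i))) j) = (\<Prod>j\<in>UNIV - {i}. x $ j ^ a j)"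
      by (rule prod.cong) auto
    also have "x $ i ^ Suc (a i) * (\<Prod>j\<in>UNIV - {i}. x $ j ^ a j) = x $ i * f x"
      unfolding a(1) by (subst prod.remove[of UNIV i "\<lambda>j. x $ j ^ a j"]) auto
    finally show "x $ i * f x = (\<Prod>j\<in>UNIV. x $ j ^ (a(i := Suc (a i))) j)" ..
  qed
  moreover have "(\<Sum>j\<in>UNIV. (a(i := Suc (a i))) j) \<le> Suc k"
  proof -
    have "(\<Sum>j\<in>UNIV. (a(i := Suc (a i))) j) = Suc (a i) + (\<Sum>j\<in>UNIV - {i}. (a(i := Suc (a i))) j)"
      by (subst sum.remove[of UNIV i]) auto
    also have "(\<Sum>j\<in>UNIV - {i}. (a(i := Suc (a i))) j) = (\<Sum>j\<in>UNIV - {i}. a j)"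
      by (rule sum.cong) auto
    also have "Suc (a i) + (\<Sum>j\<in>UNIV - {i}. a j) = Suc (\<Sum>j\<in>UNIV. a j)"
      by (subst sum.remove[of UNIV i a]) auto
    finally show ?thesis using a(2) by simp
  qed
  ultimately have "(\<lambda>x. x $ i * f x) \<in> polys (Suc k)"
    unfolding polys_def by (intro span_base) blast
  from polys_add[OF polys_scale[OF this, of c] step.IH]
  show ?case by (simp add: plus_fun_def scaleR_fun_def algebra_simps)
qed

context tetrahedron begin

text \<open>Since the \<open>\<lambda>\<^sub>a\<close> sum to one, every polynomial of degree at most \<open>k\<close> is a form of degree \<open>k\<close> in them
  (\<open>polys_homog\<close>), and it can be treated like the other quotients, with an empty denominator.\<close>

definition homog :: "nat \<Rightarrow> (real^3 \<Rightarrow> real) set"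
  where "homog k = span {bary_ratio N [] | N. set N \<subseteq> {0..3} \<and> length N = k}"

lemma homog_add: "f \<in> homog k \<Longrightarrow> g \<in> homog k \<Longrightarrow> (\<lambda>x. f x + g x) \<in> homog k"
  using span_add[of f _ g] by (simp add: homog_def plus_fun_def)

lemma homog_scale: "f \<in> homog k \<Longrightarrow> (\<lambda>x. c * f x) \<in> homog k"
  using span_scale[of f _ c] by (simp add: homog_def scaleR_fun_def)

lemma homog_zero: "(\<lambda>x. 0) \<in> homog k"
  unfolding homog_def zero_fun_def[symmetric] by (rule span_zero)

lemma homog_sum:
  assumes "finite I" "\<And>i. i \<in> I \<Longrightarrow> f i \<in> homog k"
  shows "(\<lambda>x. \<Sum>i\<in>I. f i x) \<in> homog k"
  using assms by (induction I rule: finite_induct) (simp_all add: homog_zero homog_add)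

lemma bary_ratio_in_homog: "set N \<subseteq> {0..3} \<Longrightarrow> length N = k \<Longrightarrow> bary_ratio N [] \<in> homog k"
  unfolding homog_def by (rule span_base) blast

lemma homog_times_bary:
  assumes "f \<in> homog k" "a \<le> 3"
  shows "(\<lambda>x. bary v a x * f x) \<in> homog (Suc k)"
  using assms(1) unfolding homog_def[of k]
proof (induction f rule: span_induct_alt)
  case base
  show ?case using homog_zero by (simp add: zero_fun_def)
next
  case (step c f g)
  then obtain N where N: "f = bary_ratio N []" "set N \<subseteq> {0..3}" "length N = k" by auto
  have "bary_ratio (a # N) [] \<in> homog (Suc k)" using N assms(2) by (intro bary_ratio_in_homog) auto
  moreover have "(\<lambda>x. bary v a x * f x) = bary_ratio (a # N) []"
    by (simp add: N(1) bary_ratio_def fun_eq_iff)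
  ultimately have "(\<lambda>x. bary v a x * f x) \<in> homog (Suc k)" by simp
  from homog_add[OF homog_scale[OF this, of c] step.IH]
  show ?case by (simp add: plus_fun_def scaleR_fun_def algebra_simps)
qed

text \<open>Multiply by \<open>\<Sum>a. \<lambda>\<^sub>a = 1\<close>.\<close>

lemma homog_Suc:
  assumes "f \<in> homog k" shows "f \<in> homog (Suc k)"
proof -
  have "(\<lambda>x. \<Sum>a=0..3. bary v a x * f x) \<in> homog (Suc k)"
    by (rule homog_sum) (auto intro: homog_times_bary assms)
  moreover have "(\<lambda>x. \<Sum>a=0..3. bary v a x * f x) = f"
    by (rule ext) (simp only: sum_distrib_right[symmetric] bary_sum mult_1_left)
  ultimately show ?thesis by simp
qed

lemma homog_times_coordinate:
  assumes "f \<in> homog k" shows "(\<lambda>x. x $ i * f x) \<in> homog (Suc k)"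
proof -
  have "(\<lambda>x. \<Sum>a=0..3. v a $ i * (bary v a x * f x)) \<in> homog (Suc k)"
    by (rule homog_sum) (simp, rule homog_scale[OF homog_times_bary[OF assms]], simp)
  moreover have "(\<Sum>a=0..3. v a $ i * (bary v a x * f x)) = x $ i * f x" for x
  proof -
    have "x $ i = (\<Sum>a=0..3. bary v a x *\<^sub>R v a) $ i" by (simp only: bary_comb)
    also have "\<dots> = (\<Sum>a=0..3. bary v a x * v a $ i)"
      by (simp only: sum_component vector_scaleR_component real_scaleR_def)
    finally show ?thesis by (simp only: sum_distrib_left mult_ac)
  qed
  ultimately show ?thesis by simp
qed

lemma monomial_in_homog:
  fixes a :: "3 \<Rightarrow> nat"
  assumes "(\<Sum>i\<in>UNIV. a i) \<le> k"
  shows "(\<lambda>x. \<Prod>i\<in>UNIV. x $ i ^ a i) \<in> homog k"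
  using assms
proof (induction k arbitrary: a)
  case 0
  then have "a i = 0" for i by simp
  then have "(\<lambda>x::real^3. \<Prod>i\<in>UNIV. x $ i ^ a i) = bary_ratio [] []"
    by (simp add: bary_ratio_def fun_eq_iff)
  then show ?case using bary_ratio_in_homog[of "[]" 0] by simp
next
  case (Suc k)
  show ?case
  proof (cases "(\<Sum>i\<in>UNIV. a i) \<le> k")
    case True
    then show ?thesis using homog_Suc Suc.IH by blast
  next
    case False
    then obtain i where i: "a i \<noteq> 0" by (metis le0 sum.neutral)
    define b where "b = a(i := a i - 1)"
    have "(\<Sum>j\<in>UNIV. a j) = a i + (\<Sum>j\<in>UNIV - {i}. a j)" by (rule sum.remove) auto
    moreover have "(\<Sum>j\<in>UNIV. b j) = b i + (\<Sum>j\<in>UNIV - {i}. b j)" by (rule sum.remove) auto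
    moreover have "(\<Sum>j\<in>UNIV - {i}. b j) = (\<Sum>j\<in>UNIV - {i}. a j)" by (rule sum.cong)
      (auto simp: b_def)
    moreover have "b i = a i - 1" by (simp add: b_def)
    ultimately have "(\<Sum>j\<in>UNIV. b j) \<le> k" using Suc.prems i by linarith
    then have "(\<lambda>x. x $ i * (\<Prod>j\<in>UNIV. x $ j ^ b j)) \<in> homog (Suc k)"
      by (intro homog_times_coordinate Suc.IH)
    moreover have "x $ i * (\<Prod>j\<in>UNIV. x $ j ^ b j) = (\<Prod>j\<in>UNIV. x $ j ^ a j)" for x :: "real^3"
    proof -
      have "(\<Prod>j\<in>UNIV. x $ j ^ b j) = x $ i ^ b i * (\<Prod>j\<in>UNIV - {i}. x $ j ^ b j)"
        by (rule prod.remove) auto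
      moreover have "(\<Prod>j\<in>UNIV. x $ j ^ a j) = x $ i ^ a i * (\<Prod>j\<in>UNIV - {i}. x $ j ^ a j)"
        by (rule prod.remove) auto
      moreover have "(\<Prod>j\<in>UNIV - {i}. x $ j ^ b j) = (\<Prod>j\<in>UNIV - {i}. x $ j ^ a j)"
        by (rule prod.cong) (auto simp: b_def)
      moreover have "x $ i ^ a i = x $ i * x $ i ^ b i" using i by (simp add: b_def power_eq_if)
      ultimately show ?thesis by simp
    qed
    ultimately show ?thesis by simp
  qed
qed

lemma polys_homog: "polys k \<subseteq> homog k"
  unfolding polys_def homog_def
proof (rule span_minimal)
  show "{\<lambda>x::real^3. \<Prod>i\<in>UNIV. x $ i ^ a i |a. sum a UNIV \<le> k} \<subseteq> span {bary_ratio N [] |N. set N \<subseteq> {0..3} \<and> length N = k}"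
    using monomial_in_homog unfolding homog_def by blast
qed (rule subspace_span)

lemma polys_times_bary:
  assumes "p \<in> polys k" shows "(\<lambda>x. bary v a x * p x) \<in> polys (Suc k)"
proof -
  have "(\<lambda>x. \<Sum>i\<in>UNIV. bgrad a $ i * (x $ i * p x)) \<in> polys (Suc k)"
    by (rule polys_sum) (simp, rule polys_scale[OF polys_times_coordinate[OF assms]])
  moreover have "(\<lambda>x. bary v a 0 * p x) \<in> polys (Suc k)"
    using polys_scale[OF assms] polys_mono_degree[of k "Suc k"] by auto
  ultimately have "(\<lambda>x. bary v a 0 * p x + (\<Sum>i\<in>UNIV. bgrad a $ i * (x $ i * p x))) \<in> polys (Suc k)"
    using polys_add by blast
  moreover have "bary v a 0 * p x + (\<Sum>i\<in>UNIV. bgrad a $ i * (x $ i * p x)) = bary v a x * p x" for x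
    using bary_affine[of a x] by (simp add: inner_vec_def sum_distrib_left algebra_simps)
  ultimately show ?thesis by simp
qed

lemma bary_ratio_in_polys: "bary_ratio N [] \<in> polys (length N)"
proof (induction N)
  case Nil
  have "bary_ratio [] [] = (\<lambda>x. 1)" by (simp add: bary_ratio_def fun_eq_iff)
  then show ?case using polys_one by simp
next
  case (Cons a N)
  have "bary_ratio (a # N) [] = (\<lambda>x. bary v a x * bary_ratio N [] x)"
    by (simp add: bary_ratio_def fun_eq_iff)
  then show ?case using polys_times_bary[OF Cons.IH] by simp
qed

lemma removals_length: "q \<in> set (removals N) \<Longrightarrow> Suc (length (snd q)) = length N"
  by (induction N arbitrary: q) auto

lemma bary_ratio_grad_poly:
  assumes "length N = Suc k"
  shows "(\<lambda>x. bary_ratio_grad N [] x \<bullet> \<nu>) \<in> polys k"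
proof -
  have "(\<lambda>x. \<Sum>q\<leftarrow>removals N. (bgrad (fst q) \<bullet> \<nu>) * bary_ratio (snd q) [] x) \<in> polys k"
  proof (rule polys_sum_list)
    fix q assume "q \<in> set (removals N)"
    then have "length (snd q) = k" using removals_length assms by fastforce
    then show "(\<lambda>x. (bgrad (fst q) \<bullet> \<nu>) * bary_ratio (snd q) [] x) \<in> polys k"
      using polys_scale[OF bary_ratio_in_polys[of "snd q"]] by simp
  qed
  moreover have "(\<Sum>q\<leftarrow>xs. f q *\<^sub>R g q) \<bullet> \<nu> = (\<Sum>q\<leftarrow>xs. (g q \<bullet> \<nu>) * f q)"
    for xs :: "(nat \<times> nat list) list" and f g
    by (induction xs) (simp_all add: inner_add_left)
  ultimately show ?thesis by (simp add: bary_ratio_grad_def)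
qed

lemma order_ge_no_pairs: "set N \<subseteq> {0..3} \<Longrightarrow> order_ge k N []"
  by (simp add: order_ge_def)

end

section \<open>Normal derivatives in the edge-enriched space\<close>

context tetrahedron begin

lemma bary_ratio_zero:
  assumes "p \<in> set D" "pair_sum p x = 0"
  shows "bary_ratio N D x = 0"
proof -
  have "(\<Prod>p\<leftarrow>D. pair_sum p x) = 0" using assms by (auto simp: prod_list_zero_iff)
  then show ?thesis by (simp add: bary_ratio_def)
qed

lemma edge_bubble_eq_bary_ratio: "edge_bubble v l m n = bary_ratio [n, l, l, m, m] [(n, l), (n, m)]"
  by (simp add: edge_bubble_def bary_ratio_def pair_sum_def fun_eq_iff power2_eq_square mult_ac)

lemma edge_bubble_order_ge:
  assumes "l \<le> 3" "m \<le> 3" "n \<le> 3" "l \<noteq> m" "n \<noteq> l" "n \<noteq> m"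
  shows "order_ge 2 [n, l, l, m, m] [(n, l), (n, m)]"
  unfolding order_ge_def
proof (intro conjI allI impI)
  fix S show "2 + length (filter (pair_in S) [(n, l), (n, m)]) \<le> length (filter (\<lambda>a. a \<in> S) [n, l, l, m, m])"
    if "\<exists>p\<in>set [(n, l), (n, m)]. pair_in S p"
    using that by (cases "n \<in> S"; cases "l \<in> S"; cases "m \<in> S") (simp_all add: pair_in_def)
qed (use assms in \<open>simp_all add: pair_in_def\<close>)

text \<open>The functions \<open>\<Phi>\<close> are the partial derivatives of the bubble with respect to \<open>\<lambda>\<^sub>l\<close>, \<open>\<lambda>\<^sub>m\<close>, \<open>\<lambda>\<^sub>n\<close>, up to the
  quadratic term \<open>\<lambda>\<^sub>l \<lambda>\<^sub>m\<close>. Where a denominator vanishes, the conventional values match as well.\<close>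

lemma edge_bubble_gradient:
  assumes x: "x \<in> tet v" and d: "l \<le> 3" "m \<le> 3" "n \<le> 3"
  shows "bary_ratio_grad [n, l, l, m, m] [(n, l), (n, m)] x =
    Phi_l v l m n x *\<^sub>R bgrad l + Phi_m v l m n x *\<^sub>R bgrad m +
    (Phi_n v l m n x + bary v l x * bary v m x) *\<^sub>R bgrad n"
proof -
  let ?D = "[(n, l), (n, m)]"
  define A where "A = bary_ratio [l, l, m, m] ?D x"
  define B where "B = bary_ratio [n, l, m, m] ?D x"
  define C where "C = bary_ratio [n, l, l, m] ?D x"
  define P where "P = bary_ratio [n, l, l, m, m] ((n, l) # ?D) x"
  define Q where "Q = bary_ratio [n, l, l, m, m] ((n, m) # ?D) x"
  have "bary_ratio_grad [n, l, l, m, m] ?D x = (2 * B - P) *\<^sub>R bgrad l + (2 * C - Q) *\<^sub>R bgrad m + (A - P - Q) *\<^sub>R bgrad n"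
    by (simp add: bary_ratio_grad_def vec_eq_iff algebra_simps flip: A_def B_def C_def P_def Q_def)
  moreover have "2 * B - P = Phi_l v l m n x \<and> 2 * C - Q = Phi_m v l m n x \<and>
      A - P - Q = Phi_n v l m n x + bary v l x * bary v m x"
  proof (cases "pair_sum (n, l) x = 0 \<or> pair_sum (n, m) x = 0")
    case True
    then have "A = 0" "B = 0" "C = 0" "P = 0" "Q = 0"
      unfolding A_def B_def C_def P_def Q_def by (auto intro: bary_ratio_zero)
    moreover have "Phi_l v l m n x = 0" "Phi_m v l m n x = 0"
      "Phi_n v l m n x = - bary v l x * bary v m x"
      using True by (auto simp: Phi_l_def Phi_m_def Phi_n_def Let_def pair_sum_def)
    ultimately show ?thesis by simp
  next
    case False
    define a b c where "a = bary v l x" and "b = bary v m x" and "c = bary v n x"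
    have "c + a \<noteq> 0" "c + b \<noteq> 0" using False by (auto simp: pair_sum_def a_def b_def c_def)
    then have "2 * (c * a * b * b / ((c + a) * (c + b))) - c * a * a * b * b / ((c + a) * (c + a) * (c + b))
        = c * a * b\<^sup>2 * (2 * c + a) / ((c + a)\<^sup>2 * (c + b))"
      "2 * (c * a * a * b / ((c + a) * (c + b))) - c * a * a * b * b / ((c + b) * (c + a) * (c + b))
        = c * a\<^sup>2 * b * (2 * c + b) / ((c + a) * (c + b)\<^sup>2)"
      "a * a * b * b / ((c + a) * (c + b)) - c * a * a * b * b / ((c + a) * (c + a) * (c + b))
        - c * a * a * b * b / ((c + b) * (c + a) * (c + b))
        = a\<^sup>2 * b\<^sup>2 * (a * b - c\<^sup>2) / ((c + a)\<^sup>2 * (c + b)\<^sup>2)"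
      by (simp_all add: divide_simps power2_eq_square) (simp_all add: algebra_simps)
    then show ?thesis
      unfolding A_def B_def C_def P_def Q_def Phi_l_def Phi_m_def Phi_n_def Let_def bary_ratio_def pair_sum_def
      by (simp add: a_def b_def c_def mult.assoc)
  qed
  ultimately show ?thesis by simp
qed

text \<open>The decomposition of the normal derivatives that the definition of \<open>q_part\<close> selects from; its
  existence is needed to know that the selected function lies in \<open>Q_edge\<close>.\<close>

definition splits :: "(real^3 \<Rightarrow> real) \<Rightarrow> bool"
  where "splits z \<longleftrightarrow> (\<exists>G. C11 (tet v) z G \<and> (\<forall>i\<le>3. \<exists>q\<in>Q_edge v i. \<exists>p\<in>polys 2.
    \<forall>x\<in>face v i. G x \<bullet> outer_normal v i = p x + q x))"

lemma Q_edge_add: "q \<in> Q_edge v i \<Longrightarrow> r \<in> Q_edge v i \<Longrightarrow> (\<lambda>x. q x + r x) \<in> Q_edge v i"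
  using span_add[of q _ r] by (simp add: Q_edge_def plus_fun_def)

lemma Q_edge_scale: "q \<in> Q_edge v i \<Longrightarrow> (\<lambda>x. c * q x) \<in> Q_edge v i"
  using span_scale[of q _ c] by (simp add: Q_edge_def scaleR_fun_def)

lemma Q_edge_zero: "(\<lambda>x. 0) \<in> Q_edge v i"
  unfolding Q_edge_def zero_fun_def[symmetric] by (rule span_zero)

lemma splits_add:
  assumes "splits y" "splits z" shows "splits (\<lambda>x. y x + z x)"
proof -
  obtain F where F: "C11 (tet v) y F" "\<And>i. i \<le> 3 \<Longrightarrow> \<exists>q\<in>Q_edge v i. \<exists>p\<in>polys 2.
      \<forall>x\<in>face v i. F x \<bullet> outer_normal v i = p x + q x"
    using assms(1) unfolding splits_def by blast
  obtain G where G: "C11 (tet v) z G" "\<And>i. i \<le> 3 \<Longrightarrow> \<exists>q\<in>Q_edge v i. \<exists>p\<in>polys 2.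
      \<forall>x\<in>face v i. G x \<bullet> outer_normal v i = p x + q x"
    using assms(2) unfolding splits_def by blast
  have "\<exists>q\<in>Q_edge v i. \<exists>p\<in>polys 2. \<forall>x\<in>face v i. (F x + G x) \<bullet> outer_normal v i = p x + q x"
    if i: "i \<le> 3" for i
  proof -
    obtain q p where 1: "q \<in> Q_edge v i" "p \<in> polys 2"
      "\<And>x. x \<in> face v i \<Longrightarrow> F x \<bullet> outer_normal v i = p x + q x"
      using F(2)[OF i] by blast
    obtain r s where 2: "r \<in> Q_edge v i" "s \<in> polys 2"
      "\<And>x. x \<in> face v i \<Longrightarrow> G x \<bullet> outer_normal v i = s x + r x"
      using G(2)[OF i] by blast
    show ?thesis
      by (intro bexI[OF _ Q_edge_add[OF 1(1) 2(1)]] bexI[OF _ polys_add[OF 1(2) 2(2)]])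
        (simp add: inner_add_left 1(3) 2(3))
  qed
  then show ?thesis unfolding splits_def using C11_add[OF F(1) G(1)] by blast
qed

lemma splits_scale:
  assumes "splits z" shows "splits (\<lambda>x. c * z x)"
proof -
  obtain G where G: "C11 (tet v) z G" "\<And>i. i \<le> 3 \<Longrightarrow> \<exists>q\<in>Q_edge v i. \<exists>p\<in>polys 2.
      \<forall>x\<in>face v i. G x \<bullet> outer_normal v i = p x + q x"
    using assms unfolding splits_def by blast
  have "\<exists>q\<in>Q_edge v i. \<exists>p\<in>polys 2. \<forall>x\<in>face v i. (c *\<^sub>R G x) \<bullet> outer_normal v i = p x + q x"
    if i: "i \<le> 3" for i
  proof -
    obtain q p where 1: "q \<in> Q_edge v i" "p \<in> polys 2"
      "\<And>x. x \<in> face v i \<Longrightarrow> G x \<bullet> outer_normal v i = p x + q x"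
      using G(2)[OF i] by blast
    show ?thesis
      by (intro bexI[OF _ Q_edge_scale[OF 1(1), of c]] bexI[OF _ polys_scale[OF 1(2), of c]])
        (simp add: 1(3) distrib_left)
  qed
  then show ?thesis unfolding splits_def using C11_scale[OF G(1)] by blast
qed

lemma splits_zero: "splits (\<lambda>x. 0)"
  unfolding splits_def
  by (intro exI[of _ "\<lambda>_. 0"] conjI C11_zero allI impI bexI[OF _ Q_edge_zero] bexI[OF _ polys_zero]) simp

lemma splits_span:
  assumes "\<And>b. b \<in> B \<Longrightarrow> splits b" "z \<in> span B" shows "splits z"
  using assms(2)
proof (induction z rule: span_induct_alt)
  case base
  show ?case using splits_zero by (simp add: zero_fun_def)
next
  case (step c x y)
  then show ?case using splits_add[OF splits_scale[OF assms(1)[OF step(1)], of c] step(2)]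
    by (simp add: plus_fun_def scaleR_fun_def)
qed

lemma homog_splits:
  assumes "z \<in> homog 3" shows "splits z"
  using _ assms unfolding homog_def
proof (rule splits_span)
  fix b assume "b \<in> {bary_ratio N [] | N. set N \<subseteq> {0..3} \<and> length N = 3}"
  then obtain N where N: "b = bary_ratio N []" "set N \<subseteq> {0..3}" "length N = Suc 2" by auto
  have "\<exists>q\<in>Q_edge v i. \<exists>p\<in>polys 2. \<forall>x\<in>face v i. bary_ratio_grad N [] x \<bullet> outer_normal v i = p x + q x" for i
    by (intro bexI[OF _ Q_edge_zero] bexI[OF _ bary_ratio_grad_poly[OF N(3), of
      "outer_normal v i"]]) simp
  then show "splits b"
    unfolding splits_def N(1) using bary_ratio_C11[OF order_ge_no_pairs[OF N(2)]] by blast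
qed

lemma Z0_homog: "Z0 v \<subseteq> homog 3"
proof
  fix z assume "z \<in> Z0 v"
  then obtain p c where z: "z = p + c" "p \<in> polys 2"
    "c \<in> span {\<lambda>x. (bary v i x)\<^sup>2 * bary v j x - (bary v j x)\<^sup>2 * bary v i x | i j. i < j \<and> j \<le> 3}"
    by (auto simp: Z0_def)
  have "p \<in> homog 3" using z(2) polys_homog[of 2] homog_Suc[of p 2] by (auto simp: numeral_3_eq_3)
  moreover have "c \<in> homog 3"
  proof -
    have "{\<lambda>x. (bary v i x)\<^sup>2 * bary v j x - (bary v j x)\<^sup>2 * bary v i x | i j. i < j \<and> j \<le> 3} \<subseteq> homog 3"
    proof clarify
      fix i j :: nat assume ij: "i < j" "j \<le> 3"
      have "bary_ratio [i, i, j] [] \<in> homog 3" "bary_ratio [j, j, i] [] \<in> homog 3" using ij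
        by (auto intro!: bary_ratio_in_homog)
      then have "(\<lambda>x. bary_ratio [i, i, j] [] x + (-1) * bary_ratio [j, j, i] [] x) \<in> homog 3"
        by (intro homog_add homog_scale)
      then show "(\<lambda>x. (bary v i x)\<^sup>2 * bary v j x - (bary v j x)\<^sup>2 * bary v i x) \<in> homog 3"
        by (simp add: bary_ratio_def power2_eq_square mult.assoc)
    qed
    then have "span {\<lambda>x. (bary v i x)\<^sup>2 * bary v j x - (bary v j x)\<^sup>2 * bary v i x | i j. i < j \<and> j \<le> 3} \<subseteq> homog 3"
      unfolding homog_def by (rule span_minimal) (rule subspace_span)
    then show ?thesis using z(3) by blast
  qed
  ultimately show "z \<in> homog 3" using homog_add[of p 3 c] by (simp add: z(1) plus_fun_def)
qed

text \<open>On a face whose index is not among \<open>l\<close>, \<open>m\<close>, \<open>n\<close> all three functions \<open>\<Phi>\<close> contribute to \<open>Q_edge\<close>.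
  On the other faces the derivatives of the bubble vanish, except that the one with respect to
  \<open>\<lambda>\<^sub>n\<close> is \<open>\<lambda>\<^sub>l \<lambda>\<^sub>m\<close> on the face \<open>n\<close>.\<close>

lemma edge_bubble_splits:
  assumes lm: "l < m" "m \<le> 3" "n \<in> {0..3} - {l, m}"
  shows "splits (edge_bubble v l m n)"
  unfolding splits_def
proof (intro exI[of _ "bary_ratio_grad [n, l, l, m, m] [(n, l), (n, m)]"] conjI allI impI)
  have d: "l \<le> 3" "m \<le> 3" "n \<le> 3" "l \<noteq> m" "n \<noteq> l" "n \<noteq> m" using lm by auto
  show "C11 (tet v) (edge_bubble v l m n) (bary_ratio_grad [n, l, l, m, m] [(n, l), (n, m)])"
    unfolding edge_bubble_eq_bary_ratio by (rule bary_ratio_C11[OF edge_bubble_order_ge[OF d]])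
  fix i :: nat assume i: "i \<le> 3"
  let ?\<nu> = "outer_normal v i"
  have g: "bary_ratio_grad [n, l, l, m, m] [(n, l), (n, m)] x \<bullet> ?\<nu> = (bgrad l \<bullet> ?\<nu>) * Phi_l v l m n x
      + (bgrad m \<bullet> ?\<nu>) * Phi_m v l m n x + (bgrad n \<bullet> ?\<nu>) * Phi_n v l m n x
      + (bgrad n \<bullet> ?\<nu>) * (bary v l x * bary v m x)" if "x \<in> face v i" for x
    using that edge_bubble_gradient[of x l m n] d
      by (simp add: face_iff inner_add_left algebra_simps)
  have "(\<lambda>x. bary v l x * bary v m x) \<in> polys 2"
    using bary_ratio_in_polys[of "[l, m]"] by (simp add: bary_ratio_def[abs_def] numeral_2_eq_2)
  then have p: "(\<lambda>x. (bgrad n \<bullet> ?\<nu>) * (bary v l x * bary v m x)) \<in> polys 2" by (rule polys_scale)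
  show "\<exists>q\<in>Q_edge v i. \<exists>p\<in>polys 2. \<forall>x\<in>face v i.
      bary_ratio_grad [n, l, l, m, m] [(n, l), (n, m)] x \<bullet> outer_normal v i = p x + q x"
  proof (cases "i \<in> {l, m, n}")
    case False
    then have "n \<in> J i - {l, m}" "l \<in> J i" "m \<in> J i" using d by (auto simp: J_def)
    then have "{Phi_l v l m n, Phi_m v l m n, Phi_n v l m n} \<subseteq> Q_edge v i"
      unfolding Q_edge_def using lm(1) by (intro order_trans[OF _ span_superset]) blast
    then have "(\<lambda>x. (bgrad l \<bullet> ?\<nu>) * Phi_l v l m n x + (bgrad m \<bullet> ?\<nu>) * Phi_m v l m n x
        + (bgrad n \<bullet> ?\<nu>) * Phi_n v l m n x) \<in> Q_edge v i"
      by (intro Q_edge_add Q_edge_scale) auto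
    then show ?thesis using p g by (intro bexI bexI[OF _ p] ballI) (auto simp: add_ac)
  next
    case True
    have "bary_ratio_grad [n, l, l, m, m] [(n, l), (n, m)] x \<bullet> ?\<nu>
        = (if i = n then (bgrad n \<bullet> ?\<nu>) * (bary v l x * bary v m x) else 0)" if x: "x \<in> face v i" for x
    proof -
      have 0: "bary v i x = 0" using x by (simp add: face_iff)
      show ?thesis
      proof (cases "i = n")
        case True
        then have "Phi_n v l m n x = 0" "Phi_l v l m n x = 0" "Phi_m v l m n x = 0"
          using 0 by (auto simp: Phi_l_def Phi_m_def Phi_n_def Let_def power2_eq_square)
        then show ?thesis using g[OF x] True by simp
      next
        case False
        then have "i = l \<or> i = m" using \<open>i \<in> {l, m, n}\<close> by auto
        then have "Phi_n v l m n x = 0" "Phi_l v l m n x = 0" "Phi_m v l m n x = 0"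
          "bary v l x * bary v m x = 0"
          using 0 by (auto simp: Phi_l_def Phi_m_def Phi_n_def Let_def)
        then show ?thesis using g[OF x] False by simp
      qed
    qed
    note eq = this
    show ?thesis
    proof (cases "i = n")
      case True
      show ?thesis
        by (intro bexI[OF _ Q_edge_zero] bexI[OF _ p] ballI) (use eq True in simp)
    next
      case False
      show ?thesis
        by (intro bexI[OF _ Q_edge_zero] bexI[OF _ polys_zero] ballI) (use eq False in simp)
    qed
  qed
qed

lemma Ze_splits:
  assumes "z \<in> Ze v" shows "splits z"
proof -
  obtain y e where z: "z = y + e" "y \<in> Z0 v"
    "e \<in> span {edge_bubble v l m n | l m n. l < m \<and> m \<le> 3 \<and> n \<in> {0..3} - {l, m}}"
    using assms by (auto simp: Ze_def)
  have "splits e"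
    by (rule splits_span[OF _ z(3)]) (use edge_bubble_splits in blast)
  moreover have "splits y" using homog_splits Z0_homog z(2) by blast
  ultimately show ?thesis using splits_add by (simp add: z(1) plus_fun_def)
qed

lemma at_within_interior_neq_bot:
  assumes "x \<in> tet v" shows "at x within interior (tet v) \<noteq> bot"
proof -
  have "x \<in> closure (interior (tet v))" using assms by (simp add: closure_interior)
  then have "x islimpt interior (tet v)"
    using interior_limit_point[of x "interior (tet v)"] by (auto simp: closure_def)
  then show ?thesis by (simp add: trivial_limit_within)
qed

lemma cont_ext_eq:
  fixes F g :: "real^3 \<Rightarrow> 'b::t2_space"
  assumes "continuous_on (tet v) F" "\<And>y. y \<in> interior (tet v) \<Longrightarrow> g y = F y" "x \<in> tet v"
  shows "cont_ext (tet v) g x = F x"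
  unfolding cont_ext_def
proof (rule tendsto_Lim[OF at_within_interior_neq_bot[OF assms(3)]])
  have "(F \<longlongrightarrow> F x) (at x within interior (tet v))"
    using assms(1,3) interior_subset[of "tet v"]
      by (auto simp: continuous_on_def intro: tendsto_within_subset)
  moreover have "\<forall>\<^sub>F y in at x within interior (tet v). F y = g y"
    unfolding eventually_at_filter by (rule always_eventually) (simp add: assms(2))
  ultimately show "(g \<longlongrightarrow> F x) (at x within interior (tet v))" by (rule Lim_transform_eventually)
qed

lemma C11_grad:
  assumes "C11 (tet v) z G" "y \<in> interior (tet v)"
  shows "grad z y = G y"
proof -
  have "(z has_derivative (\<lambda>h. G y \<bullet> h)) (at y)" using assms by (simp add: C11_def)
  from partial_eq[OF this] show ?thesis by (simp add: grad_def vec_eq_iff inner_axis)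
qed

lemma C11_continuous: "C11 T z G \<Longrightarrow> continuous_on T z" "C11 T z G \<Longrightarrow> continuous_on T G"
  by (auto simp: C11_def lipschitz_on_continuous_on)

lemma C11_cont_ext:
  assumes "C11 (tet v) z G" "x \<in> tet v"
  shows "cont_ext (tet v) z x = z x" "cont_ext (tet v) (grad z) x = G x"
    "normal_deriv v i z x = G x \<bullet> outer_normal v i"
  unfolding normal_deriv_def using C11_continuous[OF assms(1)] C11_grad[OF assms(1)] assms(2)
  by (auto intro!: cont_ext_eq[where F = z] cont_ext_eq[where F = G]
      cont_ext_eq[where F = "\<lambda>x. G x \<bullet> outer_normal v i"] continuous_intros)

lemma q_part_in_Q_edge:
  assumes "z \<in> Ze v" "i \<le> 3"
  shows "q_part v i z \<in> Q_edge v i"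
proof -
  obtain G where G: "C11 (tet v) z G" "\<exists>q\<in>Q_edge v i. \<exists>p\<in>polys 2.
      \<forall>x\<in>face v i. G x \<bullet> outer_normal v i = p x + q x"
    using Ze_splits[OF assms(1)] assms(2) unfolding splits_def by blast
  then have "\<exists>q. q \<in> Q_edge v i \<and> (\<exists>p\<in>polys 2. \<forall>x\<in>face v i. normal_deriv v i z x = p x + q x)"
    using C11_cont_ext(3)[OF G(1)] face_iff by (metis (no_types, lifting))
  from someI_ex[OF this] show ?thesis unfolding q_part_def by blast
qed

end

section \<open>Normal lifts and the reduced space\<close>

lemma lift_Phi_l_identity:
  fixes d i l m n a b c e f :: real
  shows "i / d * (l / a * (m / b * (n / c))) * (n * l * m\<^sup>2 * (2 * n + l) / (e\<^sup>2 * f))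
    = 1 / d * (2 * ((i * (l * (m * (n * (n * (l * (m * (m * n)))))))) / (a * (b * (c * (e * (e * f))))))
        + (i * (l * (m * (n * (n * (l * (m * (m * l)))))))) / (a * (b * (c * (e * (e * f))))))"
  by (simp add: divide_inverse power2_eq_square algebra_simps)

text \<open>The numerator of \<open>Phi_n\<close> over the common denominator is divisible by \<open>n\<close>. This is why \<open>\<lambda>\<^sub>l \<lambda>\<^sub>m\<close> is
  subtracted in its definition: without the factor \<open>n\<close> the normal lift would have order one only
  along the edge where \<open>\<lambda>\<^sub>i\<close> and \<open>\<lambda>\<^sub>n\<close> vanish.\<close>

lemma Phi_n_identity:
  fixes l m n :: real
  assumes "n + l \<noteq> 0" "n + m \<noteq> 0"
  shows "l\<^sup>2 * m\<^sup>2 * (l * m - n\<^sup>2) / ((n + l)\<^sup>2 * (n + m)\<^sup>2) - l * m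
    = - (l * m * n * (n^3 + 2 * n\<^sup>2 * l + 2 * n\<^sup>2 * m + n * l\<^sup>2 + n * m\<^sup>2 + 5 * n * l * m + 2 * l\<^sup>2 * m + 2 * l * m\<^sup>2)
        / ((n + l)\<^sup>2 * (n + m)\<^sup>2))"
proof -
  have nz: "(n + l)\<^sup>2 * (n + m)\<^sup>2 \<noteq> 0" using assms by simp
  have "l\<^sup>2 * m\<^sup>2 * (l * m - n\<^sup>2) - l * m * ((n + l)\<^sup>2 * (n + m)\<^sup>2)
    = - (l * m * n * (n^3 + 2 * n\<^sup>2 * l + 2 * n\<^sup>2 * m + n * l\<^sup>2 + n * m\<^sup>2 + 5 * n * l * m + 2 * l\<^sup>2 * m + 2 * l * m\<^sup>2))"
    by (simp add: power2_eq_square power3_eq_cube algebra_simps)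
  moreover have "l\<^sup>2 * m\<^sup>2 * (l * m - n\<^sup>2) / ((n + l)\<^sup>2 * (n + m)\<^sup>2) - l * m
    = (l\<^sup>2 * m\<^sup>2 * (l * m - n\<^sup>2) - l * m * ((n + l)\<^sup>2 * (n + m)\<^sup>2)) / ((n + l)\<^sup>2 * (n + m)\<^sup>2)"
    by (simp only: diff_divide_distrib nonzero_mult_div_cancel_right[OF nz])
  ultimately show ?thesis by (simp only: minus_divide_left)
qed

lemma lift_Phi_n_identity:
  fixes d i l m n a b c e f :: real
  shows "i / d * (l / a * (m / b * (n / c))) * - (l * m * n * (n^3 + 2 * n\<^sup>2 * l + 2 * n\<^sup>2 * m + n * l\<^sup>2
      + n * m\<^sup>2 + 5 * n * l * m + 2 * l\<^sup>2 * m + 2 * l * m\<^sup>2) / (e\<^sup>2 * f\<^sup>2))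
    = - (1 / d) * (1 * ((i * (l * (m * (n * (l * (m * (n * (n * (n * (n)))))))))) / (a * (b * (c * (e * (e * (f * f)))))))
      + 2 * ((i * (l * (m * (n * (l * (m * (n * (n * (n * (l)))))))))) / (a * (b * (c * (e * (e * (f * f)))))))
      + 2 * ((i * (l * (m * (n * (l * (m * (n * (n * (n * (m)))))))))) / (a * (b * (c * (e * (e * (f * f)))))))
      + 1 * ((i * (l * (m * (n * (l * (m * (n * (n * (l * (l)))))))))) / (a * (b * (c * (e * (e * (f * f)))))))
      + 1 * ((i * (l * (m * (n * (l * (m * (n * (n * (m * (m)))))))))) / (a * (b * (c * (e * (e * (f * f)))))))
      + 5 * ((i * (l * (m * (n * (l * (m * (n * (n * (l * (m)))))))))) / (a * (b * (c * (e * (e * (f * f)))))))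
      + 2 * ((i * (l * (m * (n * (l * (m * (n * (l * (l * (m)))))))))) / (a * (b * (c * (e * (e * (f * f)))))))
      + 2 * ((i * (l * (m * (n * (l * (m * (n * (l * (m * (m)))))))))) / (a * (b * (c * (e * (e * (f * f))))))))"
  by (simp add: divide_inverse power2_eq_square power3_eq_cube algebra_simps)

context tetrahedron begin

definition is_C11 :: "(real^3 \<Rightarrow> real) \<Rightarrow> bool"
  where "is_C11 f \<longleftrightarrow> (\<exists>G. C11 (tet v) f G)"

lemma is_C11_add: "is_C11 f \<Longrightarrow> is_C11 g \<Longrightarrow> is_C11 (\<lambda>x. f x + g x)"
  unfolding is_C11_def using C11_add by blast

lemma is_C11_scale: "is_C11 f \<Longrightarrow> is_C11 (\<lambda>x. c * f x)"
  unfolding is_C11_def using C11_scale by blast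

lemma is_C11_zero: "is_C11 (\<lambda>x. 0)"
  unfolding is_C11_def using C11_zero by blast

lemma is_C11_sum_list: "(\<And>q. q \<in> set xs \<Longrightarrow> is_C11 (f q)) \<Longrightarrow> is_C11 (\<lambda>x. \<Sum>q\<leftarrow>xs. f q x)"
  by (induction xs) (simp_all add: is_C11_zero is_C11_add)

lemma is_C11_sum:
  assumes "finite I" "\<And>i. i \<in> I \<Longrightarrow> is_C11 (f i)"
  shows "is_C11 (\<lambda>x. \<Sum>i\<in>I. f i x)"
  using assms by (induction I rule: finite_induct) (simp_all add: is_C11_zero is_C11_add)

lemma is_C11_cong:
  assumes "is_C11 f" "\<And>x. x \<in> tet v \<Longrightarrow> f x = g x"
  shows "is_C11 g"
  using assms(1) unfolding is_C11_def using C11_cong[where f = f and f' = g] assms(2) by metis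

lemma is_C11_bary_ratio: "order_ge 2 N D \<Longrightarrow> is_C11 (bary_ratio N D)"
  unfolding is_C11_def using bary_ratio_C11 by blast

lemma J_eq:
  assumes "i \<le> 3" "l \<le> 3" "m \<le> 3" "n \<le> 3" "distinct [i, l, m, n]"
  shows "J i = {l, m, n}"
proof -
  have "{l, m, n} \<subseteq> J i" using assms by (auto simp: J_def)
  moreover have "card (J i) = 3" using assms(1) by (simp add: J_def)
  moreover have "card {l, m, n} = 3" using assms by auto
  moreover have "finite (J i)" by (simp add: J_def)
  ultimately show ?thesis by (metis card_subset_eq)
qed

lemma Theta_eq:
  assumes "i \<le> 3" "l \<le> 3" "m \<le> 3" "n \<le> 3" "distinct [i, l, m, n]"
  shows "Theta v i x = bary v l x / (bary v i x + bary v l x) * (bary v m x / (bary v i x + bary v m x)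
    * (bary v n x / (bary v i x + bary v n x)))"
  using assms(5) unfolding Theta_def J_eq[OF assms] by simp

lemma lift_Phi_l_C11:
  assumes d: "i \<le> 3" "l \<le> 3" "m \<le> 3" "n \<le> 3" "distinct [i, l, m, n]"
  shows "is_C11 (normal_lift v i (Phi_l v l m n))"
proof -
  let ?D = "[(i, l), (i, m), (i, n), (n, l), (n, l), (n, m)]"
  have order_ge: "order_ge 2 [i, l, m, n, n, l, m, m, k] ?D" if "k = n \<or> k = l" for k
    unfolding order_ge_def
  proof (intro conjI allI impI)
    fix S show "2 + length (filter (pair_in S) ?D) \<le> length (filter (\<lambda>a. a \<in> S) [i, l, m, n, n, l, m, m, k])"
      if "\<exists>p\<in>set ?D. pair_in S p"
      using that \<open>k = n \<or> k = l\<close>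
      by (cases "i \<in> S"; cases "l \<in> S"; cases "m \<in> S"; cases "n \<in> S") (auto simp add: pair_in_def)
  qed (use d that in \<open>auto simp: pair_in_def\<close>)
  have "is_C11 (\<lambda>x. 1 / dcoef v i i * (2 * bary_ratio [i, l, m, n, n, l, m, m, n] ?D x + bary_ratio [i, l, m, n, n, l, m, m, l] ?D x))"
    by (intro is_C11_add is_C11_scale is_C11_bary_ratio order_ge) auto
  then show ?thesis
  proof (rule is_C11_cong)
    show "1 / dcoef v i i * (2 * bary_ratio [i, l, m, n, n, l, m, m, n] ?D x + bary_ratio [i, l, m, n, n, l, m, m, l] ?D x)
        = normal_lift v i (Phi_l v l m n) x" for x
      unfolding normal_lift_def Theta_eq[OF d] Phi_l_def Let_def lift_Phi_l_identity
      by (simp add: bary_ratio_def pair_sum_def)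
  qed
qed

lemma Phi_m_eq: "Phi_m v l m n = Phi_l v m l n"
  by (simp add: Phi_m_def Phi_l_def Let_def fun_eq_iff mult_ac)

lemma lift_Phi_n_C11:
  assumes d: "i \<le> 3" "l \<le> 3" "m \<le> 3" "n \<le> 3" "distinct [i, l, m, n]"
  shows "is_C11 (normal_lift v i (Phi_n v l m n))"
proof -
  let ?D = "[(i, l), (i, m), (i, n), (n, l), (n, l), (n, m), (n, m)]"
  \<comment> \<open>The terms of the cubic factor in \<open>Phi_n_identity\<close>.\<close>
  define T where "T = [(1, [n, n, n]), (2, [n, n, l]), (2, [n, n, m]), (1, [n, l, l]), (1, [n, m, m]),
    (5, [n, l, m]), (2, [l, l, m]), (2::real, [l, m, m])]"
  have order_ge: "order_ge 2 ([i, l, m, n, l, m, n] @ N) ?D" if N: "(c, N) \<in> set T" for c N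
    unfolding order_ge_def
  proof (intro conjI allI impI)
    fix S show "2 + length (filter (pair_in S) ?D) \<le> length (filter (\<lambda>a. a \<in> S) ([i, l, m, n, l, m, n] @ N))"
      if "\<exists>p\<in>set ?D. pair_in S p"
      using that N unfolding T_def
      by (cases "i \<in> S"; cases "l \<in> S"; cases "m \<in> S"; cases "n \<in> S") (auto simp add: pair_in_def)
  qed (use d N in \<open>auto simp: pair_in_def T_def\<close>)
  have "is_C11 (\<lambda>x. \<Sum>q\<leftarrow>T. fst q * bary_ratio ([i, l, m, n, l, m, n] @ snd q) ?D x)"
    by (rule is_C11_sum_list) (metis order_ge is_C11_bary_ratio is_C11_scale prod.collapse)
  then have "is_C11 (\<lambda>x. - (1 / dcoef v i i) * (\<Sum>q\<leftarrow>T. fst q * bary_ratio ([i, l, m, n, l, m, n] @ snd q) ?D x))"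
    by (rule is_C11_scale)
  then show ?thesis
  proof (rule is_C11_cong)
    fix x assume x: "x \<in> tet v"
    define a b c e where "a = bary v i x" and "b = bary v l x" and "c = bary v m x" and
      "e = bary v n x"
    have nn: "0 \<le> b" "0 \<le> c" "0 \<le> e" using x d by (simp_all add: tet_iff b_def c_def e_def)
    have L: "normal_lift v i (Phi_n v l m n) x = a / dcoef v i i * (b / (a + b) * (c / (a + c) * (e / (a + e))))
        * (b\<^sup>2 * c\<^sup>2 * (b * c - e\<^sup>2) / ((e + b)\<^sup>2 * (e + c)\<^sup>2) - b * c)"
      unfolding normal_lift_def Theta_eq[OF d] Phi_n_def Let_def
        by (simp add: a_def b_def c_def e_def)
    show "- (1 / dcoef v i i) * (\<Sum>q\<leftarrow>T. fst q * bary_ratio ([i, l, m, n, l, m, n] @ snd q) ?D x)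
        = normal_lift v i (Phi_n v l m n) x"
    proof (cases "e + b = 0 \<or> e + c = 0")
      case True
      then have "pair_sum (n, l) x = 0 \<or> pair_sum (n, m) x = 0"
        by (simp add: pair_sum_def b_def c_def e_def)
      then have "bary_ratio N ?D x = 0" for N by (auto intro: bary_ratio_zero)
      then have "(\<Sum>q\<leftarrow>T. fst q * bary_ratio ([i, l, m, n, l, m, n] @ snd q) ?D x) = 0" by simp
      moreover have "b * c = 0" using True nn by auto
      then have "normal_lift v i (Phi_n v l m n) x = 0" unfolding L by auto
      ultimately show ?thesis by simp
    next
      case False
      then have nz: "e + b \<noteq> 0" "e + c \<noteq> 0" by auto
      show ?thesis
        unfolding L Phi_n_identity[OF nz] lift_Phi_n_identity
        by (simp add: T_def bary_ratio_def pair_sum_def flip: a_def b_def c_def e_def)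
    qed
  qed
qed

lemma normal_lift_C11:
  assumes "q \<in> Q_edge v i" "i \<le> 3"
  shows "is_C11 (normal_lift v i q)"
  using assms(1) unfolding Q_edge_def
proof (induction q rule: span_induct_alt)
  case base
  have "normal_lift v i 0 = (\<lambda>x. 0)" by (simp add: normal_lift_def fun_eq_iff)
  then show ?case using is_C11_zero by (simp only:)
next
  case (step c f g)
  then obtain l m n where lmn: "l \<in> J i" "m \<in> J i" "l < m" "n \<in> J i - {l, m}"
    "f = Phi_l v l m n \<or> f = Phi_m v l m n \<or> f = Phi_n v l m n" by blast
  have d: "l \<le> 3" "m \<le> 3" "n \<le> 3" "distinct [i, l, m, n]" "distinct [i, m, l, n]"
    using lmn by (auto simp: J_def)
  have "is_C11 (normal_lift v i f)"
    using lmn(5) lift_Phi_l_C11[OF assms(2) d(1-4)] lift_Phi_l_C11[OF assms(2) d(2,1,3,5)]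
      lift_Phi_n_C11[OF assms(2) d(1-4)] by (auto simp: Phi_m_eq)
  then have "is_C11 (\<lambda>x. c * normal_lift v i f x + normal_lift v i g x)"
    using step.IH by (intro is_C11_add is_C11_scale)
  moreover have "normal_lift v i (c *\<^sub>R f + g) = (\<lambda>x. c * normal_lift v i f x + normal_lift v i g x)"
    by (simp add: normal_lift_def fun_eq_iff scaleR_fun_def algebra_simps add_divide_distrib)
  ultimately show ?case by (simp only:)
qed

lemma normal_lift_boundary:
  assumes "bary v j x = 0" "j \<le> 3"
  shows "normal_lift v i q x = 0"
proof (cases "j = i")
  case False
  have "Theta v i x = 0"
    unfolding Theta_def using assms False
    by (intro prod_zero) (auto simp: J_def intro!: bexI[of _ j])
  then show ?thesis by (simp add: normal_lift_def)
qed (use assms in \<open>simp add: normal_lift_def\<close>)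

text \<open>Affine functions commute with affine combinations; it suffices to check this for \<open>\<lambda>\<^sub>a\<close>.\<close>

lemma polys_1_affine:
  assumes "p \<in> polys 1" "(\<Sum>j=0..3. u j) = 1"
  shows "p (\<Sum>j=0..3. u j *\<^sub>R v j) = (\<Sum>j=0..3. u j * p (v j))"
proof -
  have "p \<in> span {bary_ratio N [] | N. set N \<subseteq> {0..3} \<and> length N = 1}"
    using polys_homog[of 1] assms(1) by (auto simp: homog_def)
  then show ?thesis
  proof (induction p rule: span_induct_alt)
    case base
    show ?case by (simp add: zero_fun_def)
  next
    case (step c f g)
    then obtain a where a: "f = bary_ratio [a] []" "a \<le> 3" by (auto simp: length_Suc_conv)
    have "f (\<Sum>j=0..3. u j *\<^sub>R v j) = u a"
      using bary_combination[OF assms(2) a(2)] by (simp add: a(1) bary_ratio_def)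
    moreover have "(\<Sum>j=0..3. u j * f (v j)) = (\<Sum>j=0..3. if j = a then u j else 0)"
      using a(2) by (intro sum.cong refl) (simp add: a(1) bary_ratio_def bary_vertex)
    then have "(\<Sum>j=0..3. u j * f (v j)) = u a" using a(2) by simp
    moreover have "(\<Sum>j=0..3. u j * (c *\<^sub>R f + g) (v j))
        = c * (\<Sum>j=0..3. u j * f (v j)) + (\<Sum>j=0..3. u j * g (v j))"
      by (simp only: plus_fun_def scaleR_fun_def real_scaleR_def distrib_left sum.distrib
          sum_distrib_left mult.left_commute)
    moreover have "(c *\<^sub>R f + g) (\<Sum>j=0..3. u j *\<^sub>R v j)
        = c * f (\<Sum>j=0..3. u j *\<^sub>R v j) + g (\<Sum>j=0..3. u j *\<^sub>R v j)"
      by (simp only: plus_fun_def scaleR_fun_def real_scaleR_def)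
    ultimately show ?case using step.IH by simp
  qed
qed

text \<open>On the boundary the corrections \<open>normal_lift\<close> are zero, so the traces are those of \<open>Ze\<close>. Their
  effect on the normal derivatives is not computed: the defining condition of \<open>Z_red\<close> already says
  that the normal derivatives are affine.\<close>

lemma Z_red_structure:
  assumes "w \<in> Z_red v"
  obtains G z where "C11 (tet v) w G" "z \<in> Ze v"
    "\<And>i x. i \<le> 3 \<Longrightarrow> x \<in> face v i \<Longrightarrow> w x = z x"
    "\<And>i. i \<le> 3 \<Longrightarrow> \<exists>p\<in>polys 1. \<forall>x\<in>face v i. G x \<bullet> bgrad i = p x"
proof -
  obtain z where z: "z \<in> Ze v" "w = R_op v z" using assms by (auto simp: Z_red_def Z_sing_def)
  have zC: "is_C11 z" using Ze_splits[OF z(1)] unfolding splits_def is_C11_def by blast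
  have "is_C11 (\<lambda>x. \<Sum>i=0..3. normal_lift v i (q_part v i z) x)"
    by (rule is_C11_sum) (auto intro: normal_lift_C11 q_part_in_Q_edge z(1))
  then have "is_C11 (\<lambda>x. z x + (-1) * (\<Sum>i=0..3. normal_lift v i (q_part v i z) x))"
    using zC by (intro is_C11_add is_C11_scale)
  moreover have "(\<lambda>x. z x + (-1) * (\<Sum>i=0..3. normal_lift v i (q_part v i z) x)) = w"
    by (simp add: z(2) R_op_def fun_eq_iff)
  ultimately obtain G where G: "C11 (tet v) w G" unfolding is_C11_def by auto
  show ?thesis
  proof (rule that[OF G z(1)])
    fix i :: nat assume i: "i \<le> 3"
    show "w x = z x" if "x \<in> face v i" for x
      using that normal_lift_boundary[OF _ i] by (simp add: z(2) R_op_def face_iff)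
    have "\<forall>i\<in>{0..3}. \<exists>p\<in>polys 1. \<forall>x\<in>face v i. normal_deriv v i w x = p x"
      using assms unfolding Z_red_def by blast
    moreover have "i \<in> {0..3}" using i by simp
    ultimately obtain p where p: "p \<in> polys 1" "\<And>x. x \<in> face v i \<Longrightarrow> normal_deriv v i w x = p x"
      by blast
    have "G x \<bullet> bgrad i = - norm (bgrad i) * p x" if x: "x \<in> face v i" for x
    proof -
      have "p x = G x \<bullet> outer_normal v i" using C11_cont_ext(3)[OF G] x p(2) face_iff by metis
      then show ?thesis using bgrad_nonzero[OF i] by (simp add: outer_normal_eq[OF i])
    qed
    then show "\<exists>p\<in>polys 1. \<forall>x\<in>face v i. G x \<bullet> bgrad i = p x"
      by (intro bexI[OF _ polys_scale[OF p(1), of "- norm (bgrad i)"]]) simp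
  qed
qed

end

section \<open>Traces on faces\<close>

definition face_bubble :: "real \<Rightarrow> real \<Rightarrow> real \<Rightarrow> real"
  where "face_bubble n l m = n * l\<^sup>2 * m\<^sup>2 / ((n + l) * (n + m))"

text \<open>The traces of \<open>Ze\<close> on a face with barycentric coordinates \<open>s\<close>, \<open>t\<close>, \<open>u\<close>: six quadratic terms,
  three cubic ones and three bubbles. The vertex data determine the first nine coefficients, the
  derivatives across the edges the last three.\<close>

definition face_shape :: "(nat \<Rightarrow> real) \<Rightarrow> real \<Rightarrow> real \<Rightarrow> real \<Rightarrow> real"
  where "face_shape k s t u = k 0 * s\<^sup>2 + k 1 * t\<^sup>2 + k 2 * u\<^sup>2
    + k 3 * (s * t) + k 4 * (t * u) + k 5 * (u * s)
    + k 6 * (s\<^sup>2 * t - t\<^sup>2 * s) + k 7 * (t\<^sup>2 * u - u\<^sup>2 * t) + k 8 * (u\<^sup>2 * s - s\<^sup>2 * u)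
    + k 9 * face_bubble u s t + k 10 * face_bubble s t u + k 11 * face_bubble t u s"

lemma face_shape_add: "face_shape k s t u + face_shape k' s t u = face_shape (\<lambda>i. k i + k' i) s t u"
  by (simp add: face_shape_def algebra_simps)

lemma face_shape_scale: "c * face_shape k s t u = face_shape (\<lambda>i. c * k i) s t u"
  by (simp add: face_shape_def algebra_simps)

text \<open>Expressed through the three points only, so that it can be compared between two tetrahedra that
  number their vertices differently.\<close>

definition face_form :: "real^3 \<Rightarrow> real^3 \<Rightarrow> real^3 \<Rightarrow> (real^3 \<Rightarrow> real) \<Rightarrow> bool"
  where "face_form a b c w \<longleftrightarrow> (\<exists>k. \<forall>s t u. 0 \<le> s \<longrightarrow> 0 \<le> t \<longrightarrow> 0 \<le> u \<longrightarrow> s + t + u = 1 \<longrightarrow>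
    w (s *\<^sub>R a + t *\<^sub>R b + u *\<^sub>R c) = face_shape k s t u)"

definition edge_form :: "real^3 \<Rightarrow> real^3 \<Rightarrow> (real^3 \<Rightarrow> real) \<Rightarrow> bool"
  where "edge_form a b w \<longleftrightarrow> (\<exists>k::nat \<Rightarrow> real. \<forall>s t. 0 \<le> s \<longrightarrow> 0 \<le> t \<longrightarrow> s + t = 1 \<longrightarrow>
    w (s *\<^sub>R a + t *\<^sub>R b) = k 0 * s\<^sup>2 + k 1 * t\<^sup>2 + k 2 * (s * t) + k 3 * (s\<^sup>2 * t - t\<^sup>2 * s))"

lemma face_form_edge:
  assumes "face_form a b c w" shows "edge_form a b w"
proof -
  obtain k where k: "\<forall>s t u. 0 \<le> s \<longrightarrow> 0 \<le> t \<longrightarrow> 0 \<le> u \<longrightarrow> s + t + u = 1 \<longrightarrow>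
    w (s *\<^sub>R a + t *\<^sub>R b + u *\<^sub>R c) = face_shape k s t u" using assms unfolding face_form_def by blast
  define k' where "k' i = (if i = 0 then k 0 else if i = 1 then k 1 else if i = 2 then k 3 else k 6)" for i :: nat
  have "w (s *\<^sub>R a + t *\<^sub>R b) = k' 0 * s\<^sup>2 + k' 1 * t\<^sup>2 + k' 2 * (s * t) + k' 3 * (s\<^sup>2 * t - t\<^sup>2 * s)"
    if "0 \<le> s" "0 \<le> t" "s + t = 1" for s t
    using k[rule_format, of s t 0] that by (simp add: face_shape_def face_bubble_def k'_def)
  then show ?thesis unfolding edge_form_def by blast
qed

lemma face_form_add: "face_form a b c w \<Longrightarrow> face_form a b c y \<Longrightarrow> face_form a b c (\<lambda>x. w x + y x)"
  unfolding face_form_def by (elim exE) (rule exI, auto simp: face_shape_add)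

lemma face_form_scale: "face_form a b c w \<Longrightarrow> face_form a b c (\<lambda>x. e * w x)"
  unfolding face_form_def by (elim exE) (rule exI, auto simp: face_shape_scale)

lemma face_form_zero: "face_form a b c (\<lambda>x. 0)"
  unfolding face_form_def by (rule exI[of _ "\<lambda>_. 0"]) (simp add: face_shape_def)

lemma face_form_span:
  assumes "\<And>f. f \<in> B \<Longrightarrow> face_form a b c f" "z \<in> span B" shows "face_form a b c z"
  using assms(2)
proof (induction z rule: span_induct_alt)
  case base
  show ?case unfolding zero_fun_def by (rule face_form_zero)
next
  case (step e x y)
  have "face_form a b c (\<lambda>p. e * x p + y p)"
    by (rule face_form_add[OF face_form_scale[OF assms(1)[OF step(1)]] step(2)])
  then show ?case by (simp add: plus_fun_def scaleR_fun_def)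
qed

context tetrahedron begin

lemma face_point:
  assumes "p \<le> 3" "q \<le> 3" "r \<le> 3" "distinct [p, q, r]" "s + t + u = 1" "j \<le> 3"
  shows "bary v j (s *\<^sub>R v p + t *\<^sub>R v q + u *\<^sub>R v r)
    = (if j = p then s else if j = q then t else if j = r then u else 0)"
proof -
  have set: "{p, q, r} \<subseteq> {0..3}" using assms by auto
  define c where "c j = (if j = p then s else if j = q then t else if j = r then u else 0)" for j
  have sum: "(\<Sum>j=0..3. f j) = (\<Sum>j\<in>{p, q, r}. f j)" if "\<And>j. j \<notin> {p, q, r} \<Longrightarrow> f j = 0" for f ::
    "nat \<Rightarrow> 'c::real_vector"
    by (rule sum.mono_neutral_right) (use set that in auto)
  have "(\<Sum>j=0..3. c j) = 1"
    using assms(4,5) by (subst sum) (auto simp: c_def)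
  moreover have "(\<Sum>j=0..3. c j *\<^sub>R v j) = s *\<^sub>R v p + t *\<^sub>R v q + u *\<^sub>R v r"
    using assms(4) by (subst sum) (auto simp: c_def)
  ultimately show ?thesis using bary_eqI[of c _ j] assms(6) by (simp add: c_def)
qed

text \<open>On the face, \<open>f\<close> is a fixed function \<open>g\<close> of the barycentric coordinates, and these are \<open>s\<close>, \<open>t\<close>, \<open>u\<close>
  and \<open>0\<close>.\<close>

lemma face_formI:
  assumes d: "p \<le> 3" "q \<le> 3" "r \<le> 3" "distinct [p, q, r]"
    and k: "\<And>s t u. 0 \<le> s \<Longrightarrow> 0 \<le> t \<Longrightarrow> 0 \<le> u \<Longrightarrow> s + t + u = 1 \<Longrightarrow>
      g (\<lambda>j. if j = p then s else if j = q then t else if j = r then u else 0) = face_shape k s t u"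
    and f: "\<And>x. f x = g (\<lambda>j. bary v j x)"
    and g: "\<And>x y. (\<And>j. j \<le> 3 \<Longrightarrow> x j = y j) \<Longrightarrow> g x = g y"
  shows "face_form (v p) (v q) (v r) f"
  unfolding face_form_def
proof (intro exI allI impI)
  fix s t u :: real assume stu: "0 \<le> s" "0 \<le> t" "0 \<le> u" "s + t + u = 1"
  show "f (s *\<^sub>R v p + t *\<^sub>R v q + u *\<^sub>R v r) = face_shape k s t u"
    unfolding f k[OF stu, symmetric] by (rule g) (rule face_point[OF d stu(4)])
qed

lemma face_form_products:
  assumes d: "p \<le> 3" "q \<le> 3" "r \<le> 3" "distinct [p, q, r]" and ab: "a \<le> 3" "b \<le> 3"
  shows "face_form (v p) (v q) (v r) (\<lambda>x. bary v a x * bary v b x)"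
proof (rule face_formI[OF d, where g = "\<lambda>y. y a * y b" and
      k = "\<lambda>i. if i = 0 then of_bool (a = p \<and> b = p) else if i = 1 then of_bool (a = q \<and> b = q)
        else if i = 2 then of_bool (a = r \<and> b = r) else
          if i = 3 then of_bool (a = p \<and> b = q \<or> a = q \<and> b = p)
        else if i = 4 then of_bool (a = q \<and> b = r \<or> a = r \<and> b = q)
        else if i = 5 then of_bool (a = r \<and> b = p \<or> a = p \<and> b = r) else 0"])
  show "(if a = p then s else if a = q then t else if a = r then u else 0)
      * (if b = p then s else if b = q then t else if b = r then u else 0) =
      face_shape (\<lambda>i. if i = 0 then of_bool (a = p \<and> b = p) else
        if i = 1 then of_bool (a = q \<and> b = q)
        else if i = 2 then of_bool (a = r \<and> b = r) else
          if i = 3 then of_bool (a = p \<and> b = q \<or> a = q \<and> b = p)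
        else if i = 4 then of_bool (a = q \<and> b = r \<or> a = r \<and> b = q)
        else if i = 5 then of_bool (a = r \<and> b = p \<or> a = p \<and> b = r) else 0) s t u" for s t u
    using d(4) by (simp add: face_shape_def power2_eq_square)
qed (use ab in auto)

lemma face_form_differences:
  assumes d: "p \<le> 3" "q \<le> 3" "r \<le> 3" "distinct [p, q, r]" and ab: "a \<le> 3" "b \<le> 3" "a \<noteq> b"
  shows "face_form (v p) (v q) (v r) (\<lambda>x. (bary v a x)\<^sup>2 * bary v b x - (bary v b x)\<^sup>2 * bary v a x)"
proof (rule face_formI[OF d, where g = "\<lambda>y. (y a)\<^sup>2 * y b - (y b)\<^sup>2 * y a" and
      k = "\<lambda>i. if i = 6 then of_bool (a = p \<and> b = q) - of_bool (a = q \<and> b = p)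
        else if i = 7 then of_bool (a = q \<and> b = r) - of_bool (a = r \<and> b = q)
        else if i = 8 then of_bool (a = r \<and> b = p) - of_bool (a = p \<and> b = r) else 0"])
  show "(if a = p then s else if a = q then t else if a = r then u else 0)\<^sup>2
      * (if b = p then s else if b = q then t else if b = r then u else 0)
      - (if b = p then s else if b = q then t else if b = r then u else 0)\<^sup>2
      * (if a = p then s else if a = q then t else if a = r then u else 0) =
      face_shape (\<lambda>i. if i = 6 then of_bool (a = p \<and> b = q) - of_bool (a = q \<and> b = p)
        else if i = 7 then of_bool (a = q \<and> b = r) - of_bool (a = r \<and> b = q)
        else if i = 8 then of_bool (a = r \<and> b = p) - of_bool (a = p \<and> b = r) else 0) s t u" for s t u
    using d(4) ab(3) by (simp add: face_shape_def)
qed (use ab in auto)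

lemma face_form_bubbles:
  assumes d: "p \<le> 3" "q \<le> 3" "r \<le> 3" "distinct [p, q, r]"
    and lmn: "l \<le> 3" "m \<le> 3" "n \<le> 3" "distinct [l, m, n]"
  shows "face_form (v p) (v q) (v r) (edge_bubble v l m n)"
proof (rule face_formI[OF d, where g = "\<lambda>y. face_bubble (y n) (y l) (y m)" and
      k = "\<lambda>i. if i = 9 then of_bool ({l, m} = {p, q} \<and> n = r)
        else if i = 10 then of_bool ({l, m} = {q, r} \<and> n = p)
        else if i = 11 then of_bool ({l, m} = {r, p} \<and> n = q) else 0"])
  have sym: "face_bubble x y z = face_bubble x z y" for x y z by (simp add: face_bubble_def mult_ac)
  have z: "face_bubble 0 y z = 0" "face_bubble y 0 z = 0" "face_bubble y z 0 = 0" for y z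
    by (simp_all add: face_bubble_def)
  show "face_bubble (if n = p then s else if n = q then t else if n = r then u else 0)
      (if l = p then s else if l = q then t else if l = r then u else 0)
      (if m = p then s else if m = q then t else if m = r then u else 0) =
      face_shape (\<lambda>i. if i = 9 then of_bool ({l, m} = {p, q} \<and> n = r)
        else if i = 10 then of_bool ({l, m} = {q, r} \<and> n = p)
        else if i = 11 then of_bool ({l, m} = {r, p} \<and> n = q) else 0) s t u" for s t u
    using d(4) lmn(4) sym[of u t s] sym[of s u t] sym[of t s u]
    by (simp add: face_shape_def doubleton_eq_iff z)
qed (use lmn in \<open>auto simp: edge_bubble_def face_bubble_def\<close>)

lemma Ze_face_form:
  assumes d: "p \<le> 3" "q \<le> 3" "r \<le> 3" "distinct [p, q, r]" and z: "z \<in> Ze v"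
  shows "face_form (v p) (v q) (v r) z"
proof -
  obtain y e f where zz: "z = (y + f) + e" "y \<in> polys 2"
    "f \<in> span {\<lambda>x. (bary v i x)\<^sup>2 * bary v j x - (bary v j x)\<^sup>2 * bary v i x | i j. i < j \<and> j \<le> 3}"
    "e \<in> span {edge_bubble v l m n | l m n. l < m \<and> m \<le> 3 \<and> n \<in> {0..3} - {l, m}}"
    using z by (auto simp: Ze_def Z0_def)
  have "y \<in> span {bary_ratio N [] | N. set N \<subseteq> {0..3} \<and> length N = 2}"
    using zz(2) polys_homog[of 2] by (auto simp: homog_def)
  then have "face_form (v p) (v q) (v r) y"
  proof (rule face_form_span[rotated])
    fix g assume "g \<in> {bary_ratio N [] | N. set N \<subseteq> {0..3} \<and> length N = 2}"
    then obtain N where N: "g = bary_ratio N []" "set N \<subseteq> {0..3}" "length N = 2" by blast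
    then obtain a b where ab: "N = [a, b]" by (auto simp: length_Suc_conv numeral_2_eq_2)
    show "face_form (v p) (v q) (v r) g"
      using face_form_products[OF d, of a b] N by (simp add: ab bary_ratio_def[abs_def])
  qed
  moreover have "face_form (v p) (v q) (v r) f"
    by (rule face_form_span[OF _ zz(3)]) (use face_form_differences[OF d] in force)
  moreover have "face_form (v p) (v q) (v r) e"
  proof (rule face_form_span[OF _ zz(4)])
    fix g assume "g \<in> {edge_bubble v l m n | l m n. l < m \<and> m \<le> 3 \<and> n \<in> {0..3} - {l, m}}"
    then obtain l m n where "g = edge_bubble v l m n" "l < m" "m \<le> 3" "n \<in> {0..3} - {l, m}" by blast
    then show "face_form (v p) (v q) (v r) g" using face_form_bubbles[OF d, of l m n] by auto
  qed
  ultimately have "face_form (v p) (v q) (v r) (\<lambda>x. (y x + f x) + e x)"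
    by (intro face_form_add)
  then show ?thesis by (simp add: zz(1) plus_fun_def)
qed

end

section \<open>Agreement of two elements on a common face\<close>

text \<open>The constant term of \<open>f\<close> is extracted from a second-order bound on \<open>h * f h\<close>: this is how the
  first derivative of a function with a quadratic Taylor remainder is read off.\<close>

lemma vanishing_quotient:
  fixes f :: "real \<Rightarrow> real"
  assumes "continuous_on {0..1} f" and K: "\<And>h. 0 < h \<Longrightarrow> h < 1 \<Longrightarrow> \<bar>h * f h\<bar> \<le> K * h\<^sup>2"
  shows "f 0 = 0"
proof -
  have bound: "\<bar>f h\<bar> \<le> K * h" if h: "0 < h" "h < 1" for h
  proof -
    have "h * \<bar>f h\<bar> \<le> h * (K * h)"
      using K[OF h] h(1) by (simp add: abs_mult power2_eq_square mult_ac)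
    then show ?thesis using h(1) by (simp only: mult_le_cancel_left_pos)
  qed
  define h where "h n = inverse (real (Suc (Suc n)))" for n
  have "(\<lambda>n. inverse (real (Suc n))) \<longlonglongrightarrow> 0" by (rule LIMSEQ_inverse_real_of_nat)
  then have lim: "h \<longlonglongrightarrow> 0" unfolding h_def by (rule LIMSEQ_Suc)
  have h: "0 < h n" "h n < 1" for n by (auto simp: h_def field_simps)
  have "(\<lambda>n. f (h n)) \<longlonglongrightarrow> f 0"
    using assms(1) lim by (rule continuous_on_tendsto_compose)
      (auto intro!: always_eventually less_imp_le h)
  moreover have "(\<lambda>n. f (h n)) \<longlonglongrightarrow> 0"
  proof (rule Lim_null_comparison)
    show "\<forall>\<^sub>F n in sequentially. norm (f (h n)) \<le> K * h n" using bound[OF h] by simp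
    show "(\<lambda>n. K * h n) \<longlonglongrightarrow> 0" using tendsto_mult[OF tendsto_const[of K] lim] by simp
  qed
  ultimately show ?thesis by (rule LIMSEQ_unique)
qed

text \<open>In every direction \<open>\<xi>\<close> orthogonal to the affine hull of \<open>C\<close> the derivative is affine on the convex
  hull of \<open>C\<close>.\<close>

definition gradient_affine :: "(real^3) set \<Rightarrow> (real^3 \<Rightarrow> real^3) \<Rightarrow> bool"
  where "gradient_affine C G \<longleftrightarrow> (\<forall>\<xi> \<kappa> u. (\<forall>c\<in>C. \<xi> \<bullet> c = \<kappa>) \<longrightarrow> (\<forall>c\<in>C. 0 \<le> u c) \<longrightarrow> sum u C = 1 \<longrightarrow>
    G (\<Sum>c\<in>C. u c *\<^sub>R c) \<bullet> \<xi> = (\<Sum>c\<in>C. u c * (G c \<bullet> \<xi>)))"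

text \<open>What is needed of a function of the reduced space to determine it and its gradient on a face from
  its vertex data, without reference to a numbering of the vertices.\<close>

definition reduced_element :: "(real^3) set \<Rightarrow> (real^3) set \<Rightarrow> (real^3 \<Rightarrow> real) \<Rightarrow> (real^3 \<Rightarrow> real^3) \<Rightarrow> bool"
  where "reduced_element T V w G \<longleftrightarrow> C11 T w G \<and> convex T \<and> compact T \<and> interior T \<noteq> {} \<and>
    T = convex hull V \<and> finite V \<and> card V = 4 \<and> (\<forall>x. x extreme_point_of T \<longleftrightarrow> x \<in> V) \<and>
    (\<forall>a\<in>V. \<forall>b\<in>V. \<forall>c\<in>V. distinct [a, b, c] \<longrightarrow> face_form a b c w) \<and>
    (\<forall>C\<subseteq>V. gradient_affine C G)"

lemma reduced_elementD:
  assumes "reduced_element T V w G"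
  shows "C11 T w G" "convex T" "compact T" "interior T \<noteq> {}" "T = convex hull V" "finite V"
    "card V = 4"
    "x extreme_point_of T \<longleftrightarrow> x \<in> V"
    "a \<in> V \<Longrightarrow> b \<in> V \<Longrightarrow> c \<in> V \<Longrightarrow> distinct [a, b, c] \<Longrightarrow> face_form a b c w"
    "C \<subseteq> V \<Longrightarrow> gradient_affine C G"
  using assms unfolding reduced_element_def by blast+

lemma face_form_cong:
  assumes "face_form a b c z" "\<And>x. x \<in> convex hull {a, b, c} \<Longrightarrow> w x = z x"
  shows "face_form a b c w"
proof -
  have "s *\<^sub>R a + t *\<^sub>R b + u *\<^sub>R c \<in> convex hull {a, b, c}" if "0 \<le> s" "0 \<le> t" "0 \<le> u"
    "s + t + u = 1" for s t u
    unfolding convex_hull_3 using that by blast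
  then show ?thesis using assms unfolding face_form_def by (metis (no_types, lifting))
qed

context tetrahedron begin

text \<open>The direction \<open>\<xi>\<close> is a combination of the normals of those facets \<open>j\<close> that contain \<open>C\<close>
  (\<open>bgrad_expansion_shift\<close>), and the normal derivative is affine on each of these facets.\<close>

lemma gradient_affine_faces:
  assumes p: "\<And>i. i \<le> 3 \<Longrightarrow> \<exists>p\<in>polys 1. \<forall>x\<in>face v i. G x \<bullet> bgrad i = p x"
    and C: "C \<subseteq> v ` {0..3}"
  shows "gradient_affine C G"
  unfolding gradient_affine_def
proof (intro allI impI)
  fix \<xi> \<kappa> and u :: "real^3 \<Rightarrow> real"
  assume \<xi>: "\<forall>c\<in>C. \<xi> \<bullet> c = \<kappa>" and u: "\<forall>c\<in>C. 0 \<le> u c" "sum u C = 1"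
  define U where "U j = (if v j \<in> C then u (v j) else 0)" for j
  define x where "x = (\<Sum>c\<in>C. u c *\<^sub>R c)"
  have conv: "(\<Sum>j=0..3. if v j \<in> C then f (v j) else 0) = sum f C" for f ::
    "real^3 \<Rightarrow> 'b::real_vector"
  proof -
    have "C = v ` {j \<in> {0..3}. v j \<in> C}" using C by blast
    then have "sum f C = sum f (v ` {j \<in> {0..3}. v j \<in> C})" by simp
    also have "\<dots> = (\<Sum>j\<in>{j \<in> {0..3}. v j \<in> C}. f (v j))"
      by (subst sum.reindex[OF inj_on_subset[OF inj_v]]) auto
    also have "\<dots> = (\<Sum>j=0..3. if v j \<in> C then f (v j) else 0)"
      by (subst sum.inter_filter) auto
    finally show ?thesis ..
  qed
  have U1: "(\<Sum>j=0..3. U j) = 1" using conv[of u] u(2) by (simp add: U_def)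
  have Ux: "(\<Sum>j=0..3. U j *\<^sub>R v j) = x"
  proof -
    have "(\<Sum>j=0..3. U j *\<^sub>R v j) = (\<Sum>j=0..3. if v j \<in> C then u (v j) *\<^sub>R v j else 0)"
      by (rule sum.cong) (auto simp: U_def)
    then show ?thesis using conv[of "\<lambda>c. u c *\<^sub>R c"] by (simp add: x_def)
  qed
  have bary: "bary v j x = U j" if "j \<le> 3" for j using bary_eqI[OF U1 Ux that] .
  have xT: "x \<in> tet v" using u(1) by (auto simp: tet_iff bary U_def)
  have summand: "(\<xi> \<bullet> v j - \<kappa>) * (G x \<bullet> bgrad j) = (\<Sum>c\<in>C. u c * ((\<xi> \<bullet> v j - \<kappa>) * (G c \<bullet> bgrad j)))"
    if j: "j \<le> 3" for j
  proof (cases "v j \<in> C")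
    case True
    then have "\<xi> \<bullet> v j - \<kappa> = 0" using \<xi> by simp
    then show ?thesis by simp
  next
    case False
    obtain p where p: "p \<in> polys 1" "\<And>x. x \<in> face v j \<Longrightarrow> G x \<bullet> bgrad j = p x" using p[OF j] by blast
    have xf: "x \<in> face v j" using xT bary[OF j] False by (simp add: face_iff U_def)
    have cf: "c \<in> face v j" if c: "c \<in> C" for c
    proof -
      obtain k where k: "c = v k" "k \<le> 3" using C c by auto
      then have "k \<noteq> j" using False c by auto
      then show ?thesis using k j by (simp add: face_iff vertex_in_tet bary_vertex)
    qed
    have "G x \<bullet> bgrad j = p (\<Sum>j=0..3. U j *\<^sub>R v j)" using p(2)[OF xf] by (simp add: Ux)
    also have "\<dots> = (\<Sum>j=0..3. U j * p (v j))" by (rule polys_1_affine[OF p(1) U1])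
    also have "\<dots> = (\<Sum>j=0..3. if v j \<in> C then u (v j) * p (v j) else 0)"
      by (rule sum.cong) (auto simp: U_def)
    also have "\<dots> = (\<Sum>c\<in>C. u c * p c)" by (rule conv)
    also have "\<dots> = (\<Sum>c\<in>C. u c * (G c \<bullet> bgrad j))" by (rule sum.cong) (simp_all add: p(2) cf)
    finally show ?thesis by (simp add: sum_distrib_left mult_ac)
  qed
  have exp: "y \<bullet> \<xi> = (\<Sum>j=0..3. (\<xi> \<bullet> v j - \<kappa>) * (y \<bullet> bgrad j))" for y
  proof -
    have "y \<bullet> \<xi> = y \<bullet> (\<Sum>j=0..3. (\<xi> \<bullet> v j - \<kappa>) *\<^sub>R bgrad j)"
      by (subst bgrad_expansion_shift[of \<xi> \<kappa>]) simp
    then show ?thesis by (simp add: inner_sum_right)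
  qed
  have "G x \<bullet> \<xi> = (\<Sum>j=0..3. \<Sum>c\<in>C. u c * ((\<xi> \<bullet> v j - \<kappa>) * (G c \<bullet> bgrad j)))"
    unfolding exp[of "G x"] by (rule sum.cong) (auto intro: summand)
  also have "\<dots> = (\<Sum>c\<in>C. \<Sum>j=0..3. u c * ((\<xi> \<bullet> v j - \<kappa>) * (G c \<bullet> bgrad j)))" by (rule sum.swap)
  also have "\<dots> = (\<Sum>c\<in>C. u c * (G c \<bullet> \<xi>))" by (simp only: exp sum_distrib_left[symmetric])
  finally show "G (\<Sum>c\<in>C. u c *\<^sub>R c) \<bullet> \<xi> = (\<Sum>c\<in>C. u c * (G c \<bullet> \<xi>))" by (simp add: x_def)
qed

lemma Z_red_reduced_element:
  assumes "w \<in> Z_red v"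
  obtains G where "reduced_element (tet v) (v ` {0..3}) w G"
    "\<And>x. x \<in> tet v \<Longrightarrow> cont_ext (tet v) w x = w x"
    "\<And>x. x \<in> tet v \<Longrightarrow> cont_ext (tet v) (grad w) x = G x"
proof -
  obtain G z where G: "C11 (tet v) w G" and z: "z \<in> Ze v"
    "\<And>i x. i \<le> 3 \<Longrightarrow> x \<in> face v i \<Longrightarrow> w x = z x"
    and p: "\<And>i. i \<le> 3 \<Longrightarrow> \<exists>p\<in>polys 1. \<forall>x\<in>face v i. G x \<bullet> bgrad i = p x"
    using Z_red_structure[OF assms] by metis
  have "face_form a b c w" if abc: "a \<in> v ` {0..3}" "b \<in> v ` {0..3}" "c \<in> v ` {0..3}"
    "distinct [a, b, c]" for a b c
  proof -
    obtain p q r where pqr: "p \<le> 3" "q \<le> 3" "r \<le> 3" "a = v p" "b = v q" "c = v r" using abc by auto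
    then have d: "distinct [p, q, r]" using abc(4) by auto
    obtain i where i: "i \<le> 3" "i \<notin> {p, q, r}"
    proof -
      have "card {p, q, r} < card {0..3::nat}" using card_length[of "[p, q, r]"] by simp
      then have "\<not> {0..3} \<subseteq> {p, q, r}" using card_mono[of "{p, q, r}" "{0..3}"] by auto
      then obtain i where "i \<in> {0..3}" "i \<notin> {p, q, r}" by blast
      then show ?thesis using that[of i] by simp
    qed
    have face: "x \<in> face v i" if x: "x \<in> convex hull {a, b, c}" for x
    proof -
      have "x \<in> tet v" using x hull_mono[of "{a, b, c}" "v ` {0..3}" convex] abc
        by (auto simp: tet_def)
      moreover obtain s t u where "x = s *\<^sub>R v p + t *\<^sub>R v q + u *\<^sub>R v r" "s + t + u = 1"
        using x unfolding convex_hull_3 pqr by blast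
      then have "bary v i x = 0" using face_point[OF pqr(1-3) d _ i(1)] i(2) by auto
      ultimately show ?thesis by (simp add: face_iff)
    qed
    have "face_form a b c z" using Ze_face_form[OF pqr(1-3) d z(1)] pqr(4-6) by simp
    then show ?thesis by (rule face_form_cong) (rule z(2)[OF i(1) face])
  qed
  moreover have "gradient_affine C G" if "C \<subseteq> v ` {0..3}" for C
    using gradient_affine_faces[OF p that] .
  moreover have "x extreme_point_of tet v \<longleftrightarrow> x \<in> v ` {0..3}" for x
    unfolding tet_def by (rule extreme_point_of_convex_hull_affine_independent[OF indep_v])
  ultimately have "reduced_element (tet v) (v ` {0..3}) w G"
    unfolding reduced_element_def using G tet_convex tet_compact interior_nonempty inj_v
    by (simp add: card_image tet_def[symmetric])
  then show ?thesis by (rule that) (use C11_cont_ext[OF G] in simp_all)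
qed

end

lemma third_vertex:
  assumes "reduced_element S U y H" "a \<in> U" "b \<in> U"
  obtains c where "c \<in> U" "c \<noteq> a" "c \<noteq> b"
proof -
  have "card {a, b} < card U" using reduced_elementD(7)[OF assms(1)] card_length[of "[a, b]"]
    by simp
  then have "\<not> U \<subseteq> {a, b}" using card_mono[of "{a, b}" U] by auto
  then obtain c where "c \<in> U" "c \<notin> {a, b}" by blast
  then show ?thesis using that[of c] by simp
qed

lemma edge_formula:
  assumes "reduced_element S U y H" "a \<in> U" "b \<in> U" "a \<noteq> b"
  shows "edge_form a b y"
proof -
  obtain c where "c \<in> U" "c \<noteq> a" "c \<noteq> b" by (rule third_vertex[OF assms(1-3)])
  then have "face_form a b c y" using reduced_elementD(9)[OF assms(1-3), of c] assms(4) by auto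
  then show ?thesis by (rule face_form_edge)
qed

lemma difference_expansion:
  assumes "C11 T w G" "convex T" "compact T" "interior T \<noteq> {}"
    and "C11 T' w' G'" "convex T'" "compact T'" "interior T' \<noteq> {}"
    and x: "x \<in> T" "x \<in> T'" "w x = w' x"
  obtains K where "\<And>y. y \<in> T \<Longrightarrow> y \<in> T' \<Longrightarrow>
    \<bar>w y - w' y - (G x - G' x) \<bullet> (y - x)\<bar> \<le> K * (norm (y - x))\<^sup>2"
proof -
  obtain L where L: "\<And>x y. x \<in> T \<Longrightarrow> y \<in> T \<Longrightarrow> \<bar>w y - w x - G x \<bullet> (y - x)\<bar> \<le> L * (norm (y - x))\<^sup>2"
    using C11_taylor[OF assms(1,2) compact_imp_closed[OF assms(3)] assms(4)] by metis
  obtain L' where L': "\<And>x y. x \<in> T' \<Longrightarrow> y \<in> T' \<Longrightarrow> \<bar>w' y - w' x - G' x \<bullet> (y - x)\<bar> \<le> L' * (norm (y - x))\<^sup>2"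
    using C11_taylor[OF assms(5,6) compact_imp_closed[OF assms(7)] assms(8)] by metis
  show ?thesis
  proof (rule that[of "L + L'"])
    fix y assume "y \<in> T" "y \<in> T'"
    then show "\<bar>w y - w' y - (G x - G' x) \<bullet> (y - x)\<bar> \<le> (L + L') * (norm (y - x))\<^sup>2"
      using L[of x y] L'[of x y] x by (simp add: inner_diff_left distrib_right abs_le_iff)
  qed
qed

locale two_elements =
  fixes T T' V V' w w' G G'
  assumes el: "reduced_element T V w G" and el': "reduced_element T' V' w' G'"
begin

lemma expansion:
  assumes "x \<in> T" "x \<in> T'" "w x = w' x"
  obtains K where "\<And>y. y \<in> T \<Longrightarrow> y \<in> T' \<Longrightarrow>
    \<bar>w y - w' y - (G x - G' x) \<bullet> (y - x)\<bar> \<le> K * (norm (y - x))\<^sup>2"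
  using difference_expansion[OF reduced_elementD(1-4)[OF el] reduced_elementD(1-4)[OF el'] assms]
    by metis

lemma convex_both: "convex T" "convex T'"
  by (rule reduced_elementD(2)[OF el], rule reduced_elementD(2)[OF el'])

lemma tangential_agree:
  assumes S: "S \<subseteq> T" "S \<subseteq> T'" "convex S" "\<And>x. x \<in> S \<Longrightarrow> w x = w' x" and xy: "x \<in> S" "y \<in> S"
  shows "(G x - G' x) \<bullet> (y - x) = 0"
proof -
  obtain K where K: "\<And>y. y \<in> T \<Longrightarrow> y \<in> T' \<Longrightarrow>
    \<bar>w y - w' y - (G x - G' x) \<bullet> (y - x)\<bar> \<le> K * (norm (y - x))\<^sup>2"
    using expansion[of x] S xy by blast
  have "\<bar>h * ((G x - G' x) \<bullet> (y - x))\<bar> \<le> (K * (norm (y - x))\<^sup>2) * h\<^sup>2" if h: "0 < h" "h < 1" for h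
  proof -
    have "(1 - h) *\<^sub>R x + h *\<^sub>R y \<in> S" using S(3) xy h by (intro convexD_alt) auto
    moreover have e: "(1 - h) *\<^sub>R x + h *\<^sub>R y = x + h *\<^sub>R (y - x)" by (simp add: algebra_simps)
    ultimately have p: "x + h *\<^sub>R (y - x) \<in> S" by simp
    then have "\<bar>(G x - G' x) \<bullet> (h *\<^sub>R (y - x))\<bar> \<le> K * (norm (h *\<^sub>R (y - x)))\<^sup>2"
      using K[of "x + h *\<^sub>R (y - x)"] S(1,2) S(4)[OF p] by auto
    then show ?thesis by (simp add: power_mult_distrib mult_ac)
  qed
  then show ?thesis
    by (rule vanishing_quotient[of "\<lambda>_. (G x - G' x) \<bullet> (y - x)", OF continuous_on_const])
qed

text \<open>Let \<open>D\<close> be the jump of the gradient at \<open>x\<close>. It is orthogonal to the face, because the values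
  agree there. So both gradients are affine on the face in the direction \<open>D\<close>, hence they agree in
  this direction because they do at the vertices.\<close>

lemma gradients_agree:
  assumes C: "C \<subseteq> V" "C \<subseteq> V'" "\<And>c. c \<in> C \<Longrightarrow> G c = G' c"
    and w: "\<And>x. x \<in> convex hull C \<Longrightarrow> w x = w' x" and x: "x \<in> convex hull C"
  shows "G x = G' x"
proof -
  have fin: "finite C" by (rule finite_subset[OF C(1) reduced_elementD(6)[OF el]])
  have sub: "convex hull C \<subseteq> T" "convex hull C \<subseteq> T'"
    using hull_mono[OF C(1), of convex] hull_mono[OF C(2), of convex] reduced_elementD(5)[OF el] reduced_elementD(5)[OF el'] by simp_all
  obtain u where u: "\<forall>c\<in>C. 0 \<le> u c" "sum u C = 1" "(\<Sum>c\<in>C. u c *\<^sub>R c) = x"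
    using x fin by (auto simp: convex_hull_finite)
  define D where "D = G x - G' x"
  have D: "D \<bullet> c = D \<bullet> x" if "c \<in> C" for c
  proof -
    have "D \<bullet> (c - x) = 0"
      unfolding D_def by (rule tangential_agree[OF sub convex_convex_hull w x hull_inc[OF that]])
    then show ?thesis by (simp add: inner_diff_right)
  qed
  have "gradient_affine C G" "gradient_affine C G'"
    using reduced_elementD(10)[OF el C(1)] reduced_elementD(10)[OF el' C(2)] .
  then have "G (\<Sum>c\<in>C. u c *\<^sub>R c) \<bullet> D = (\<Sum>c\<in>C. u c * (G c \<bullet> D))"
    "G' (\<Sum>c\<in>C. u c *\<^sub>R c) \<bullet> D = (\<Sum>c\<in>C. u c * (G' c \<bullet> D))"
    unfolding gradient_affine_def using u(1,2) D by blast+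
  then have "G x \<bullet> D = (\<Sum>c\<in>C. u c * (G c \<bullet> D))" "G' x \<bullet> D = (\<Sum>c\<in>C. u c * (G' c \<bullet> D))"
    by (simp_all only: u(3))
  moreover have "(\<Sum>c\<in>C. u c * (G c \<bullet> D)) = (\<Sum>c\<in>C. u c * (G' c \<bullet> D))"
    by (rule sum.cong) (simp_all add: C(3))
  ultimately have "D \<bullet> D = 0" by (simp add: D_def inner_diff_left)
  then show ?thesis by (simp add: D_def)
qed

lemma slope_agree:
  assumes "a \<in> T" "b \<in> T" "a \<in> T'" "b \<in> T'" "w a = w' a" "G a = G' a"
  obtains K where "\<And>h. 0 < h \<Longrightarrow> h < 1 \<Longrightarrow> \<bar>w ((1 - h) *\<^sub>R a + h *\<^sub>R b) - w' ((1 - h) *\<^sub>R a + h *\<^sub>R b)\<bar> \<le> K * h\<^sup>2"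
proof -
  obtain K where K: "\<And>y. y \<in> T \<Longrightarrow> y \<in> T' \<Longrightarrow>
    \<bar>w y - w' y - (G a - G' a) \<bullet> (y - a)\<bar> \<le> K * (norm (y - a))\<^sup>2"
    using expansion[OF assms(1,3,5)] by blast
  show ?thesis
  proof (rule that[of "K * (norm (b - a))\<^sup>2"])
    fix h :: real assume h: "0 < h" "h < 1"
    have "(1 - h) *\<^sub>R a + h *\<^sub>R b \<in> T" "(1 - h) *\<^sub>R a + h *\<^sub>R b \<in> T'"
      using assms(1-4) h convex_both by (auto intro!: convexD_alt)
    moreover have "(1 - h) *\<^sub>R a + h *\<^sub>R b - a = h *\<^sub>R (b - a)" by (simp add: algebra_simps)
    ultimately show "\<bar>w ((1 - h) *\<^sub>R a + h *\<^sub>R b) - w' ((1 - h) *\<^sub>R a + h *\<^sub>R b)\<bar> \<le> K * (norm (b - a))\<^sup>2 * h\<^sup>2"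
      using K[of "(1 - h) *\<^sub>R a + h *\<^sub>R b"] assms(6) by (simp add: power_mult_distrib mult_ac)
  qed
qed

lemma vertices_in: "a \<in> V \<Longrightarrow> a \<in> T" "a \<in> V' \<Longrightarrow> a \<in> T'"
  using reduced_elementD(5)[OF el] reduced_elementD(5)[OF el'] by (simp_all add: hull_inc)

text \<open>Cubic Hermite interpolation: the four coefficients on an edge are determined by the values and
  the slopes at its ends. The slopes are compared through the quadratic bound of \<open>slope_agree\<close>.\<close>

lemma edge_values_agree:
  assumes a: "a \<in> V" "a \<in> V'" "w a = w' a" "G a = G' a" and b: "b \<in> V" "b \<in> V'" "w b = w' b"
    "G b = G' b"
    and x: "x \<in> convex hull {a, b}"
  shows "w x = w' x"
proof (cases "a = b")
  case True
  then show ?thesis using x a(3) by simp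
next
  case False
  obtain k where k: "\<And>s t. 0 \<le> s \<Longrightarrow> 0 \<le> t \<Longrightarrow> s + t = 1 \<Longrightarrow>
    w (s *\<^sub>R a + t *\<^sub>R b) = k 0 * s\<^sup>2 + k 1 * t\<^sup>2 + k 2 * (s * t) + k (3::nat) * (s\<^sup>2 * t - t\<^sup>2 * s)"
    using edge_formula[OF el a(1) b(1) False] unfolding edge_form_def by blast
  obtain k' where k': "\<And>s t. 0 \<le> s \<Longrightarrow> 0 \<le> t \<Longrightarrow> s + t = 1 \<Longrightarrow>
    w' (s *\<^sub>R a + t *\<^sub>R b) = k' 0 * s\<^sup>2 + k' 1 * t\<^sup>2 + k' 2 * (s * t) + k' (3::nat) * (s\<^sup>2 * t - t\<^sup>2 * s)"
    using edge_formula[OF el' a(2) b(2) False] unfolding edge_form_def by blast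
  define e where "e i = k i - k' i" for i
  have diff: "w (s *\<^sub>R a + t *\<^sub>R b) - w' (s *\<^sub>R a + t *\<^sub>R b) = e 0 * s\<^sup>2 + e 1 * t\<^sup>2 + e 2 * (s * t) + e 3 * (s\<^sup>2 * t - t\<^sup>2 * s)"
    if "0 \<le> s" "0 \<le> t" "s + t = 1" for s t
    unfolding k[OF that] k'[OF that] by (simp add: e_def algebra_simps)
  \<comment> \<open>The end points give the first two coefficients, the slopes there the sum and
    the difference of the others.\<close>
  have e01: "e 0 = 0" "e (Suc 0) = 0" using diff[of 1 0] diff[of 0 1] a(3) b(3) by auto
  obtain K where K: "\<And>h. 0 < h \<Longrightarrow> h < 1 \<Longrightarrow> \<bar>w ((1 - h) *\<^sub>R a + h *\<^sub>R b) - w' ((1 - h) *\<^sub>R a + h *\<^sub>R b)\<bar> \<le> K * h\<^sup>2"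
    using slope_agree[of a b] vertices_in a b by metis
  obtain L where L: "\<And>h. 0 < h \<Longrightarrow> h < 1 \<Longrightarrow> \<bar>w ((1 - h) *\<^sub>R b + h *\<^sub>R a) - w' ((1 - h) *\<^sub>R b + h *\<^sub>R a)\<bar> \<le> L * h\<^sup>2"
    using slope_agree[of b a] vertices_in a b by metis
  have "(1 - 0) * (e 2 + e 3 * (1 - 2 * 0)) = 0"
  proof (rule vanishing_quotient[of "\<lambda>h. (1 - h) * (e 2 + e 3 * (1 - 2 * h))"])
    fix h :: real assume h: "0 < h" "h < 1"
    have "h * ((1 - h) * (e 2 + e 3 * (1 - 2 * h))) = w ((1 - h) *\<^sub>R a + h *\<^sub>R b) - w' ((1 - h) *\<^sub>R a + h *\<^sub>R b)"
      using h by (subst diff) (auto simp: e01 power2_eq_square algebra_simps)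
    then show "\<bar>h * ((1 - h) * (e 2 + e 3 * (1 - 2 * h)))\<bar> \<le> K * h\<^sup>2"
      using K[OF h] by (simp only: add.commute)
  qed (intro continuous_intros)
  moreover have "(1 - 0) * (e 2 - e 3 * (1 - 2 * 0)) = 0"
  proof (rule vanishing_quotient[of "\<lambda>h. (1 - h) * (e 2 - e 3 * (1 - 2 * h))"])
    fix h :: real assume h: "0 < h" "h < 1"
    have "h * ((1 - h) * (e 2 - e 3 * (1 - 2 * h))) = w (h *\<^sub>R a + (1 - h) *\<^sub>R b) - w' (h *\<^sub>R a + (1 - h) *\<^sub>R b)"
      using h by (subst diff) (auto simp: e01 power2_eq_square algebra_simps)
    then show "\<bar>h * ((1 - h) * (e 2 - e 3 * (1 - 2 * h)))\<bar> \<le> L * h\<^sup>2"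
      using L[OF h] by (simp only: add.commute)
  qed (intro continuous_intros)
  ultimately have e23: "e 2 = 0" "e 3 = 0" by auto
  obtain s t where "0 \<le> s" "0 \<le> t" "s + t = 1" "x = s *\<^sub>R a + t *\<^sub>R b"
    using x by (auto simp: convex_hull_2)
  then show ?thesis using diff[of s t] by (simp add: e01 e23)
qed

lemma edge_gradients_agree:
  assumes a: "a \<in> V" "a \<in> V'" "w a = w' a" "G a = G' a" and b: "b \<in> V" "b \<in> V'" "w b = w' b"
    "G b = G' b"
    and x: "x \<in> convex hull {a, b}"
  shows "G x = G' x"
  by (rule gradients_agree[where C = "{a, b}"]) (use edge_values_agree[OF a b] a b x in auto)

text \<open>The bubble of an edge is the only one of the three whose derivative does not vanish on this
  edge; it is tested at the midpoint, in the direction of the opposite vertex.\<close>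

text \<open>Across the edge from \<open>a\<close> to \<open>b\<close> the derivative of the bubble of this edge is \<open>s * t\<close>, while the two
  other bubbles vanish to second order. At the midpoint, in the direction of \<open>c\<close>, the difference of
  the two functions therefore has slope \<open>e1 / 4\<close>, but this slope is zero since the gradients agree
  on the edge.\<close>

lemma bubble_coefficient_zero:
  assumes V: "a \<in> V" "b \<in> V" "c \<in> V" "a \<in> V'" "b \<in> V'" "c \<in> V'"
    and ab: "\<And>x. x \<in> convex hull {a, b} \<Longrightarrow> w x = w' x" "\<And>x. x \<in> convex hull {a, b} \<Longrightarrow> G x = G' x"
    and e: "\<And>s t u. 0 \<le> s \<Longrightarrow> 0 \<le> t \<Longrightarrow> 0 \<le> u \<Longrightarrow> s + t + u = 1 \<Longrightarrow>
      w (s *\<^sub>R a + t *\<^sub>R b + u *\<^sub>R c) - w' (s *\<^sub>R a + t *\<^sub>R b + u *\<^sub>R c)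
      = e1 * face_bubble u s t + e2 * face_bubble s t u + e3 * face_bubble t u s"
  shows "e1 = 0"
proof -
  define m where "m = (1/2) *\<^sub>R a + (1/2) *\<^sub>R b"
  have m: "m \<in> convex hull {a, b}" unfolding convex_hull_2 m_def by force
  have "convex hull {a, b} \<subseteq> T" "convex hull {a, b} \<subseteq> T'"
    using V vertices_in convex_both by (simp_all add: hull_minimal)
  then obtain K where K: "\<And>h. 0 < h \<Longrightarrow> h < 1 \<Longrightarrow> \<bar>w ((1 - h) *\<^sub>R m + h *\<^sub>R c) - w' ((1 - h) *\<^sub>R m + h *\<^sub>R c)\<bar> \<le> K * h\<^sup>2"
    using slope_agree[of m c] vertices_in V ab(1)[OF m] ab(2)[OF m] m by (metis subsetD)
  define f where "f h = e1 * ((1 - h) ^ 4 / (4 * (1 + h)\<^sup>2)) + (e2 + e3) * (h * (1 - h)\<^sup>2 / (4 * (1 + h)))" for h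
  have "f 0 = 0"
  proof (rule vanishing_quotient[of f])
    show "continuous_on {0..1} f" unfolding f_def by (intro continuous_intros) auto
    fix h :: real assume h: "0 < h" "h < 1"
    define s where "s = (1 - h) / 2"
    have hs: "h = 1 - 2 * s" "0 < s" using h by (simp_all add: s_def field_simps)
    have "(1 - h) *\<^sub>R m + h *\<^sub>R c = s *\<^sub>R a + s *\<^sub>R b + h *\<^sub>R c"
      by (simp add: m_def s_def scaleR_right_distrib)
    then have "w ((1 - h) *\<^sub>R m + h *\<^sub>R c) - w' ((1 - h) *\<^sub>R m + h *\<^sub>R c)
        = e1 * face_bubble h s s + e2 * face_bubble s s h + e3 * face_bubble s h s"
      using e[of s s h] h hs by simp
    also have "\<dots> = h * f h"
    proof -
      have "1 - s \<noteq> 0" using h hs by auto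
      have 1: "face_bubble h s s = h * ((1 - h) ^ 4 / (4 * (1 + h)\<^sup>2))"
        using h unfolding face_bubble_def s_def by (simp add: divide_simps)
          (simp add: power4_eq_xxxx power2_eq_square algebra_simps)
      have 2: "face_bubble s s h = h * (h * (1 - h)\<^sup>2 / (4 * (1 + h)))"
        using h unfolding face_bubble_def s_def by (simp add: divide_simps)
          (simp add: power4_eq_xxxx power2_eq_square algebra_simps)
      have 3: "face_bubble s h s = face_bubble s s h" by (simp add: face_bubble_def mult_ac)
      show ?thesis unfolding 3 1 2 f_def by (simp add: algebra_simps add_divide_distrib)
    qed
    finally show "\<bar>h * f h\<bar> \<le> K * h\<^sup>2" using K[OF h] by (simp only:)
  qed
  then show ?thesis by (simp add: f_def)
qed

text \<open>The difference vanishes on the three edges, which kills all polynomial terms: the vertices give the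
  squares, the midpoints the mixed products, and the points at one third the cubic terms.\<close>

lemma face_values_agree:
  assumes V: "{a, b, c} \<subseteq> V" "{a, b, c} \<subseteq> V'" and d: "distinct [a, b, c]"
    and data: "\<And>p. p \<in> {a, b, c} \<Longrightarrow> w p = w' p" "\<And>p. p \<in> {a, b, c} \<Longrightarrow> G p = G' p"
    and x: "x \<in> convex hull {a, b, c}"
  shows "w x = w' x"
proof -
  have edge: "w y = w' y" "G y = G' y" if "p \<in> {a, b, c}" "q \<in> {a, b, c}" "y \<in> convex hull {p, q}"
    for p q y
    using edge_values_agree[of p q y] edge_gradients_agree[of p q y] that V data by blast+
  have "face_form a b c w" "face_form a b c w'"
    using reduced_elementD(9)[OF el _ _ _ d] reduced_elementD(9)[OF el' _ _ _ d] V by simp_all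
  then obtain k k' where k: "\<And>s t u. 0 \<le> s \<Longrightarrow> 0 \<le> t \<Longrightarrow> 0 \<le> u \<Longrightarrow> s + t + u = 1 \<Longrightarrow>
      w (s *\<^sub>R a + t *\<^sub>R b + u *\<^sub>R c) = face_shape k s t u"
    and k': "\<And>s t u. 0 \<le> s \<Longrightarrow> 0 \<le> t \<Longrightarrow> 0 \<le> u \<Longrightarrow> s + t + u = 1 \<Longrightarrow>
      w' (s *\<^sub>R a + t *\<^sub>R b + u *\<^sub>R c) = face_shape k' s t u"
    unfolding face_form_def by blast
  define e where "e i = k i - k' i" for i
  have diff: "w (s *\<^sub>R a + t *\<^sub>R b + u *\<^sub>R c) - w' (s *\<^sub>R a + t *\<^sub>R b + u *\<^sub>R c) = face_shape e s t u"
    if "0 \<le> s" "0 \<le> t" "0 \<le> u" "s + t + u = 1" for s t u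
    unfolding k[OF that] k'[OF that] by (simp add: face_shape_def e_def algebra_simps)
  have hull2: "s *\<^sub>R p + t *\<^sub>R q \<in> convex hull {p, q}" if "0 \<le> s" "0 \<le> t" "s + t = 1" for s t
    and p q :: "real^3"
    unfolding convex_hull_2 using that by blast
  have e_ab: "face_shape e s t 0 = 0" and e_bc: "face_shape e 0 s t = 0" and e_ca:
    "face_shape e t 0 s = 0"
    if st: "0 \<le> s" "0 \<le> t" "s + t = 1" for s t
    using diff[of s t 0] diff[of 0 s t] diff[of t 0 s] st
      edge(1)[OF _ _ hull2[OF st, of a b]] edge(1)[OF _ _ hull2[OF st, of b c]] edge(1)[OF _ _ hull2[OF st, of c a]]
    by (simp_all add: add.commute)
  have "e 0 = 0" "e 1 = 0" "e 2 = 0"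
    using e_ab[of 1 0] e_ab[of 0 1] e_bc[of 0 1] by (simp_all add: face_shape_def face_bubble_def)
  moreover from this have "e 3 = 0" "e 4 = 0" "e 5 = 0"
    using e_ab[of "1/2" "1/2"] e_bc[of "1/2" "1/2"] e_ca[of "1/2" "1/2"]
      by (simp_all add: face_shape_def face_bubble_def)
  moreover from calculation have "e 6 = 0" "e 7 = 0" "e 8 = 0"
    using e_ab[of "1/3" "2/3"] e_bc[of "1/3" "2/3"] e_ca[of "1/3" "2/3"]
    by (simp_all add: face_shape_def face_bubble_def power2_eq_square)
  ultimately have bubbles: "face_shape e s t u = e 9 * face_bubble u s t + e 10 * face_bubble s t u + e 11 * face_bubble t u s" for s t u
    by (simp add: face_shape_def)
  have "e 9 = 0"
  proof (rule bubble_coefficient_zero[of a b c "e 9" "e 10" "e 11"])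
    show "w x = w' x" "G x = G' x" if "x \<in> convex hull {a, b}" for x
      using edge[of a b x] that by simp_all
    show "w (s *\<^sub>R a + t *\<^sub>R b + u *\<^sub>R c) - w' (s *\<^sub>R a + t *\<^sub>R b + u *\<^sub>R c)
      = e 9 * face_bubble u s t + e 10 * face_bubble s t u + e 11 * face_bubble t u s"
      if "0 \<le> s" "0 \<le> t" "0 \<le> u" "s + t + u = 1" for s t u
      using diff[OF that] by (simp add: bubbles)
  qed (use V in simp_all)
  moreover have "e 10 = 0"
  proof (rule bubble_coefficient_zero[of b c a "e 10" "e 11" "e 9"])
    show "w x = w' x" "G x = G' x" if "x \<in> convex hull {b, c}" for x
      using edge[of b c x] that by simp_all
    show "w (s *\<^sub>R b + t *\<^sub>R c + u *\<^sub>R a) - w' (s *\<^sub>R b + t *\<^sub>R c + u *\<^sub>R a)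
      = e 10 * face_bubble u s t + e 11 * face_bubble s t u + e 9 * face_bubble t u s"
      if "0 \<le> s" "0 \<le> t" "0 \<le> u" "s + t + u = 1" for s t u
      using diff[of u s t] that by (simp add: bubbles algebra_simps)
  qed (use V in simp_all)
  moreover have "e 11 = 0"
  proof (rule bubble_coefficient_zero[of c a b "e 11" "e 9" "e 10"])
    show "w x = w' x" "G x = G' x" if "x \<in> convex hull {c, a}" for x
      using edge[of c a x] that by simp_all
    show "w (s *\<^sub>R c + t *\<^sub>R a + u *\<^sub>R b) - w' (s *\<^sub>R c + t *\<^sub>R a + u *\<^sub>R b)
      = e 11 * face_bubble u s t + e 9 * face_bubble s t u + e 10 * face_bubble t u s"
      if "0 \<le> s" "0 \<le> t" "0 \<le> u" "s + t + u = 1" for s t u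
      using diff[of t u s] that by (simp add: bubbles algebra_simps)
  qed (use V in simp_all)
  ultimately have "face_shape e s t u = 0" for s t u by (simp add: bubbles)
  moreover obtain s t u where "0 \<le> s" "0 \<le> t" "0 \<le> u" "s + t + u = 1"
    "x = s *\<^sub>R a + t *\<^sub>R b + u *\<^sub>R c"
    using x unfolding convex_hull_3 by blast
  ultimately show ?thesis using diff[of s t u] by simp
qed

text \<open>By the number of common vertices: a vertex, an edge or a triangle.\<close>

lemma agree_on_common_face:
  assumes C: "C \<subseteq> V" "C \<subseteq> V'" "card C \<le> 3"
    and data: "\<And>p. p \<in> C \<Longrightarrow> w p = w' p" "\<And>p. p \<in> C \<Longrightarrow> G p = G' p"
    and x: "x \<in> convex hull C"
  shows "w x = w' x \<and> G x = G' x"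
proof -
  have fin: "finite C" by (rule finite_subset[OF C(1) reduced_elementD(6)[OF el]])
  have "w y = w' y" if y: "y \<in> convex hull C" for y
  proof -
    have "C \<noteq> {}" using y by auto
    then have "card C \<noteq> 0" using fin by simp
    then consider "card C = 1" | "card C = 2" | "card C = 3" using C(3) by linarith
    then show ?thesis
    proof cases
      case 1
      then obtain a where "C = {a}" by (auto simp: card_1_singleton_iff)
      then show ?thesis using y data(1) by simp
    next
      case 2
      then obtain a b where "C = {a, b}" by (auto simp: card_2_iff)
      then show ?thesis using edge_values_agree[of a b y] C data y by simp
    next
      case 3
      then obtain a b c where "C = {a, b, c}" "distinct [a, b, c]" by (auto simp: card_3_iff)
      then show ?thesis using face_values_agree[of a b c y] C data y by simp
    qed
  qed
  then show ?thesis using gradients_agree[OF C(1,2) data(2)] x by blast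
qed

end

section \<open>The space on the triangulation\<close>

lemma Z_red_on_reduced_element:
  assumes "w \<in> Z_red_on T"
  shows "\<exists>V G. reduced_element T V w G \<and> (\<forall>x\<in>T. cont_ext T w x = w x \<and> cont_ext T (grad w) x = G x)"
proof -
  obtain v where v: "w \<in> Z_red v" "nondegenerate v" "tet v = T"
    using assms by (auto simp: Z_red_on_def)
  interpret tetrahedron v by standard (rule v(2))
  obtain G where "reduced_element (tet v) (v ` {0..3}) w G"
    "\<And>x. x \<in> tet v \<Longrightarrow> cont_ext (tet v) w x = w x"
    "\<And>x. x \<in> tet v \<Longrightarrow> cont_ext (tet v) (grad w) x = G x"
    using Z_red_reduced_element[OF v(1)] by metis
  then show ?thesis unfolding v(3) by blast
qed

text \<open>The common vertices of the two tetrahedra are the extreme points of the common face, which is their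
  convex hull. Four of them would make the tetrahedra equal.\<close>

lemma adjacent_elements_agree:
  assumes el: "reduced_element T V w G" "reduced_element T' V' w' G'"
    and faces: "(T \<inter> T') face_of T" "(T' \<inter> T) face_of T'" and ne: "T \<noteq> T'"
    and data: "\<And>a. a extreme_point_of T \<Longrightarrow> a extreme_point_of T' \<Longrightarrow> w a = w' a \<and> G a = G' a"
    and x: "x \<in> T \<inter> T'"
  shows "w x = w' x \<and> G x = G' x"
proof -
  interpret two: two_elements T T' V V' w w' G G' using el by unfold_locales
  define C where "C = {a. a extreme_point_of (T \<inter> T')}"
  have C: "C = V \<inter> (T \<inter> T')"
    unfolding C_def extreme_point_of_face[OF faces(1)] reduced_elementD(8)[OF el(1)] by blast
  have "T' \<inter> T = T \<inter> T'" by blast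
  then have C': "C = V' \<inter> (T \<inter> T')"
    using extreme_point_of_face[OF faces(2)] reduced_elementD(8)[OF el(2)] unfolding C_def by auto
  have "compact (T \<inter> T')" "convex (T \<inter> T')"
    by (rule compact_Int[OF reduced_elementD(3)[OF el(1)] reduced_elementD(3)[OF el(2)]],
        rule convex_Int[OF reduced_elementD(2)[OF el(1)] reduced_elementD(2)[OF el(2)]])
  then have hull: "T \<inter> T' = convex hull C"
    unfolding C_def by (rule Krein_Milman_Minkowski)
  have "card C \<le> 3"
  proof (rule ccontr)
    assume "\<not> card C \<le> 3"
    then have "C = V"
      by (intro card_seteq[OF reduced_elementD(6)[OF el(1)]])
        (use C reduced_elementD(7)[OF el(1)] in simp_all)
    moreover have "C = V'"
      by (intro card_seteq[OF reduced_elementD(6)[OF el(2)]])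
        (use C' \<open>\<not> card C \<le> 3\<close> reduced_elementD(7)[OF el(2)] in simp_all)
    ultimately have "V = V'" by simp
    then show False using reduced_elementD(5)[OF el(1)] reduced_elementD(5)[OF el(2)] ne by simp
  qed
  moreover have "w p = w' p" "G p = G' p" if p: "p \<in> C" for p
  proof -
    have "p extreme_point_of T" "p extreme_point_of T'"
      using p C C' reduced_elementD(8)[OF el(1), of p] reduced_elementD(8)[OF el(2), of p] by blast+
    then show "w p = w' p" "G p = G' p" using data by blast+
  qed
  moreover have "C \<subseteq> V" "C \<subseteq> V'" using C C' by auto
  ultimately show ?thesis using x unfolding hull by (intro two.agree_on_common_face)
qed

theorem lemma3p19:
  fixes \<Omega> :: "(real^3) set" and \<T> :: "(real^3) set set"
  assumes "bounded_polyhedral_domain \<Omega>"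
    and "tetrahedral_triangulation \<T> \<Omega>"
  shows "Z_red_mesh \<Omega> \<T> \<subseteq> sobolev_H 2 \<Omega>"
proof
  fix z assume "z \<in> Z_red_mesh \<Omega> \<T>"
  then obtain w where z: "z \<in> L2_space \<Omega>"
    and w: "\<And>T. T \<in> \<T> \<Longrightarrow> w T \<in> Z_red_on T"
    and ae: "\<And>T. T \<in> \<T> \<Longrightarrow> AE x in lebesgue_on (T \<inter> \<Omega>). z x = w T x"
    and nodes: "\<And>T T' a. T \<in> \<T> \<Longrightarrow> T' \<in> \<T> \<Longrightarrow> a extreme_point_of T \<Longrightarrow> a extreme_point_of T' \<Longrightarrow>
      cont_ext T (w T) a = cont_ext T' (w T') a \<and> cont_ext T (grad (w T)) a = cont_ext T' (grad (w T')) a"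
    unfolding Z_red_mesh_def by blast
  have \<Omega>: "open \<Omega>" "bounded \<Omega>" using assms(1) by (simp_all add: bounded_polyhedral_domain_def)
  have fin: "finite \<T>" and faces: "\<And>T T'. T \<in> \<T> \<Longrightarrow> T' \<in> \<T> \<Longrightarrow> (T \<inter> T') face_of T"
    and union: "\<Union>\<T> = closure \<Omega>"
    using assms(2) by (auto simp: tetrahedral_triangulation_def triangulation_def)
  have cover: "\<Omega> \<subseteq> \<Union>\<T>" unfolding union by (rule closure_subset)
  have "\<forall>T\<in>\<T>. \<exists>V G. reduced_element T V (w T) G \<and>
      (\<forall>x\<in>T. cont_ext T (w T) x = w T x \<and> cont_ext T (grad (w T)) x = G x)"
    using Z_red_on_reduced_element[OF w] by blast
  then obtain V G where el: "\<And>T. T \<in> \<T> \<Longrightarrow> reduced_element T (V T) (w T) (G T)"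
    and ext: "\<And>T x. T \<in> \<T> \<Longrightarrow> x \<in> T \<Longrightarrow> cont_ext T (w T) x = w T x \<and> cont_ext T (grad (w T)) x = G T x"
    by metis
  have agree: "w T x = w T' x \<and> G T x = G T' x" if T: "T \<in> \<T>" "T' \<in> \<T>" "x \<in> T" "x \<in> T'" for T T' x
  proof (cases "T = T'")
    case False
    show ?thesis
    proof (rule adjacent_elements_agree[OF el[OF T(1)] el[OF T(2)] faces[OF T(1,2)] faces[OF T(2,1)] False])
      fix a assume a: "a extreme_point_of T" "a extreme_point_of T'"
      then have "a \<in> T" "a \<in> T'" by (simp_all add: extreme_point_of_def)
      then show "w T a = w T' a \<and> G T a = G T' a"
        using nodes[OF T(1,2) a] ext[OF T(1), of a] ext[OF T(2), of a] by simp
    qed (use T in simp)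
  qed simp
  \<comment> \<open>The glued function; the choice of the tetrahedron does not matter.\<close>
  define pick where "pick x = (SOME T. T \<in> \<T> \<and> x \<in> T)" for x
  have pick: "pick x \<in> \<T> \<and> x \<in> pick x" if "T \<in> \<T>" "x \<in> T" for T x
    unfolding pick_def by (rule someI[of _ T]) (use that in simp)
  define u where "u x = w (pick x) x" for x
  define H where "H x = G (pick x) x" for x
  have glue: "w T x = u x" "G T x = H x" if "T \<in> \<T>" "x \<in> T" for T x
    using agree[OF that(1) _ that(2), of "pick x"] pick[OF that] by (simp_all add: u_def H_def)
  show "z \<in> sobolev_H 2 \<Omega>"
  proof (rule piecewise_C11_sobolev[OF \<Omega> fin _ _ _ cover _ z])
    fix T assume T: "T \<in> \<T>"
    show "compact T" "convex T" "interior T \<noteq> {}" using reduced_elementD(2-4)[OF el[OF T]] by auto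
    show "C11 T u H" by (rule C11_cong[OF reduced_elementD(1)[OF el[OF T]] glue[OF T]])
  next
    have "AE x in lebesgue. \<forall>T\<in>\<T>. x \<in> T \<inter> \<Omega> \<longrightarrow> z x = w T x"
    proof (rule AE_finite_allI[OF fin])
      fix T assume T: "T \<in> \<T>"
      have "T \<inter> \<Omega> \<in> sets lebesgue"
        using compact_imp_closed[OF reduced_elementD(3)[OF el[OF T]]] \<Omega>(1) by auto
      then show "AE x in lebesgue. x \<in> T \<inter> \<Omega> \<longrightarrow> z x = w T x"
        using ae[OF T] by (simp add: AE_restrict_space_iff)
    qed
    then have "AE x in lebesgue. x \<in> \<Omega> \<longrightarrow> z x = u x"
    proof eventually_elim
      case (elim x)
      show ?case
      proof
        assume x: "x \<in> \<Omega>"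
        then obtain T where "T \<in> \<T>" "x \<in> T" using cover by blast
        then show "z x = u x" using elim x glue(1)[of T x] by simp
      qed
    qed
    then show "AE x in lebesgue_on \<Omega>. z x = u x"
      using \<Omega>(1) by (simp add: AE_restrict_space_iff)
  qed
qed

end
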